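(* (Brezis–Merle type exponential inequality for mixed boundary value problems) Let $N\ge2$ and let $\Omega\subset\mathbb R^N$ be a bounded domain. Assume that there exists a radial center $P\in\mathbb R^N$ (usually not unique) such that $\Omega$ satisfies property $(P)$. Let $H\in C^2(\mathbb R^N\setminus\{0\})$ be a uniformly elliptic gauge. Assume that $u,h\in W^{1,N}(\Omega)$ are weak solutions of $$\begin{cases}-\Delta_N^Hu=f,\quad -\Delta_N^Hh=0 & \text{in }\Omega,\\ u=h & \text{on }\Gamma,\\ \langle a(\nabla u),\nu\rangle=\langle a(\nabla h),\nu\rangle=0 & \text{on }\partial\Omega\setminus\Gamma,\end{cases}$$ where $f\in L^1(\Omega)$, the boundary subset $\Gamma$ satisfies $\Gamma_P^+\subseteq\Gamma\subset\partial\Omega$, and $\Gamma_P^+$ is the (back) radial contact set. Then there exists a positive constant $\mu_\Omega$, depending only on $N$, $H$, $\Omega$ and $P$, given by $$\mu_\Omega:=\left(\frac{c_1^{1/N}}{S(\Omega)\,(d_{r,P}(\Omega)+1)}\right)^{\frac{N}{N-1}},$$ such that for every $0<\lambda<\mu_\Omega\|f\|_{L^1(\Omega)}^{-\frac1{N-1}}$, it holds $$\int_\Omega e^{\lambda|u-h|}\,dx\le\frac{\mathcal L^N(\Omega)}{1-\lambda\,\mu_\Omega^{-1}\|f\|_{L^1(\Omega)}^{\frac1{N-1}}}.$$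
   Context: A gauge is a nonnegative, convex function $H:\mathbb R^N\to\mathbb R$, positively homogeneous of degree $1$, with $H>0$ on $\mathbb S^{N-1}=\partial B_1(0)$. It is uniformly elliptic if $\{\xi\in\mathbb R^N: H(\xi)<1\}$ is uniformly convex. Set $a(\xi):=H^{N-1}(\xi)\nabla H(\xi)$ and $\Delta^H_Nu:=\operatorname{div}(a(\nabla u))$ (the Finsler $N$-Laplacian); $\nu$ is the unit outer normal and $\mathcal L^N$ is Lebesgue measure. The constant $c_1>0$, depending only on $N$ and $H$, is one for which $$\langle a(\xi_1)-a(\xi_2),\xi_1-\xi_2\rangle\ge c_1(|\xi_1|+|\xi_2|)^{N-2}|\xi_1-\xi_2|^2\qquad\text{for all }\xi_1,\xi_2\in\mathbb R^N\setminus\{0\}$$ (such a constant exists because $H$ is uniformly elliptic). $S(\Omega)$ is the Sobolev constant of the embedding $W^{1,1}(\Omega)\hookrightarrow L^{\frac N{N-1}}(\Omega)$, i.e. $\|g\|_{L^{N/(N-1)}(\Omega)}\le S(\Omega)\big(\|\nabla g\|_{L^1(\Omega)}+\|g\|_{L^1(\Omega)}\big)$. For $P\in\mathbb R^N$ let $\Sigma_\Omega^P:=\big\{\tfrac{x-P}{|x-P|}: x\in\Omega,\ x\ne P\big\}\subset\mathbb S^{N-1}$ and let $\mathcal C_{\Sigma^P_\Omega,P}:=\{P\}+\bigcup_{0<r<+\infty}r\Sigma^P_\Omega$. Property $(P)$ (for the radial center $P$): for any unit vector $\omega\in\Sigma^P_\Omega$, there exist an integer $K_\omega\ge1$ and a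 sequence of radii $$0\le\underline r^1_\omega\le\overline r^1_\omega<\underline r^2_\omega\le\overline r^2_\omega<\cdots<\underline r^{K_\omega}_\omega\le\overline r^{K_\omega}_\omega$$ such that $$\Big(\bigcup_{0\le r<+\infty}\{P+r\omega\}\Big)\cap\partial\Omega=\bigcup_{1\le k\le K_\omega}\{P+\overline r^k_\omega\omega,\ P+\underline r^k_\omega\omega\}.$$ Set $\Gamma_P:=\partial\Omega\cap\mathcal C_{\Sigma^P_\Omega,P}$. The (front) radial contact set is $\Gamma_P^-:=\{P+\underline r^k_\omega\omega: 1\le k\le K_\omega,\ \omega\in\Sigma^P_\Omega\}\subset\Gamma_P$, and the (back) radial contact set is $\Gamma_P^+:=\Gamma_P\setminus\Gamma_P^-=\{P+\overline r^k_\omega\omega: 1\le k\le K_\omega,\ \omega\in\Sigma^P_\Omega\}$. The radial width of $\Omega$ with respect to $P$ is $$d_{r,P}(\Omega):=\sup_{\omega\in\Sigma_\Omega^P}\ \max_{1\le k\le K_\omega}\big(\overline r^k_\omega-\underline r^k_\omega\big).$$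
   Formalization: Property (P) is read with the extra requirement that almost every point of Ω lies on a segment from P+r̲ω to P+r̄ω (else all pairs may be degenerate, d=0, and the claim fails); if P∈Ω, P itself counts as a first end point (r̲¹=0). *)

theory Defs
  imports "HOL-Analysis.Analysis"
begin

section \<open>Differentiability classes\<close>

text \<open>Class \<open>C\<^sup>k\<close> on an open set \<open>S\<close>: all iterated directional derivatives up to order \<open>k\<close> exist
  and are continuous.\<close>

primrec Ck_on :: "nat \<Rightarrow> 'a::real_normed_vector set \<Rightarrow> ('a \<Rightarrow> real) \<Rightarrow> bool" where
  "Ck_on 0 S f \<longleftrightarrow> continuous_on S f"
| "Ck_on (Suc k) S f \<longleftrightarrow>
     (\<forall>x\<in>S. f differentiable (at x)) \<and> (\<forall>v. Ck_on k S (\<lambda>x. frechet_derivative f (at x) v))"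

definition test_functions :: "'a::euclidean_space set \<Rightarrow> ('a \<Rightarrow> real) set" where
  "test_functions \<Omega> = {\<phi>. (\<forall>k. Ck_on k UNIV \<phi>) \<and>
     compact (closure {x. \<phi> x \<noteq> 0}) \<and> closure {x. \<phi> x \<noteq> 0} \<subseteq> \<Omega>}"

section \<open>Lebesgue and Sobolev spaces\<close>

text \<open>Elements are functions on the whole type; only their values almost everywhere on \<open>\<Omega>\<close>
  matter.\<close>

definition Lp_space :: "real \<Rightarrow> 'a::euclidean_space set \<Rightarrow> ('a \<Rightarrow> 'b::real_normed_vector) set" where
  "Lp_space p \<Omega> = {f. f \<in> borel_measurable (lebesgue_on \<Omega>) \<and>
     integrable (lebesgue_on \<Omega>) (\<lambda>x. norm (f x) powr p)}"

definition Lp_norm :: "real \<Rightarrow> 'a::euclidean_space set \<Rightarrow> ('a \<Rightarrow> 'b::real_normed_vector) \<Rightarrow> real" where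
  "Lp_norm p \<Omega> f = (LINT x|lebesgue_on \<Omega>. norm (f x) powr p) powr (1 / p)"

definition essentially_bounded :: "'a::euclidean_space set \<Rightarrow> ('a \<Rightarrow> real) \<Rightarrow> bool" where
  "essentially_bounded \<Omega> f \<longleftrightarrow> (\<exists>M. AE x in lebesgue_on \<Omega>. \<bar>f x\<bar> \<le> M)"

definition has_weak_gradient ::
    "'a::euclidean_space set \<Rightarrow> ('a \<Rightarrow> real) \<Rightarrow> ('a \<Rightarrow> 'a) \<Rightarrow> bool" where
  "has_weak_gradient \<Omega> u G \<longleftrightarrow>
     (\<forall>C. compact C \<and> C \<subseteq> \<Omega> \<longrightarrow> set_integrable lebesgue C u \<and> set_integrable lebesgue C G) \<and>
     (\<forall>\<phi>\<in>test_functions \<Omega>. \<forall>b\<in>Basis.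
        (LINT x|lebesgue_on \<Omega>. u x * frechet_derivative \<phi> (at x) b) =
        - (LINT x|lebesgue_on \<Omega>. (G x \<bullet> b) * \<phi> x))"

text \<open>Weak gradients are unique up to null sets, so the choice below is immaterial; it is only
  meaningful for functions that have a weak gradient.\<close>

definition weak_grad :: "'a::euclidean_space set \<Rightarrow> ('a \<Rightarrow> real) \<Rightarrow> 'a \<Rightarrow> 'a" where
  "weak_grad \<Omega> u = (SOME G. has_weak_gradient \<Omega> u G)"

definition sobolev_space :: "real \<Rightarrow> 'a::euclidean_space set \<Rightarrow> ('a \<Rightarrow> real) set" where
  "sobolev_space p \<Omega> =
     {u \<in> Lp_space p \<Omega>. (\<exists>G. has_weak_gradient \<Omega> u G) \<and> weak_grad \<Omega> u \<in> Lp_space p \<Omega>}"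

definition sobolev_norm :: "real \<Rightarrow> 'a::euclidean_space set \<Rightarrow> ('a \<Rightarrow> real) \<Rightarrow> real" where
  "sobolev_norm p \<Omega> u = Lp_norm p \<Omega> u + Lp_norm p \<Omega> (weak_grad \<Omega> u)"

text \<open>The functions in \<open>W\<^sup>1\<^sup>,\<^sup>p(\<Omega>)\<close> that vanish on \<open>\<Gamma> \<subseteq> \<partial>\<Omega>\<close>. No regularity of \<open>\<partial>\<Omega>\<close> is available, so
  there is no trace operator; as usual for mixed problems on general domains, vanishing on \<open>\<Gamma>\<close>
  means being a limit in \<open>W\<^sup>1\<^sup>,\<^sup>p(\<Omega>)\<close> of functions that vanish near \<open>\<Gamma>\<close>.\<close>

definition vanishing_near ::
    "real \<Rightarrow> 'a::euclidean_space set \<Rightarrow> 'a set \<Rightarrow> ('a \<Rightarrow> real) set" where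
  "vanishing_near p \<Omega> \<Gamma> = {v \<in> sobolev_space p \<Omega>.
     \<exists>U. open U \<and> \<Gamma> \<subseteq> U \<and> (AE x in lebesgue_on \<Omega>. x \<in> U \<longrightarrow> v x = 0)}"

definition sobolev_space_vanishing ::
    "real \<Rightarrow> 'a::euclidean_space set \<Rightarrow> 'a set \<Rightarrow> ('a \<Rightarrow> real) set" where
  "sobolev_space_vanishing p \<Omega> \<Gamma> = {v \<in> sobolev_space p \<Omega>.
     \<exists>w. (\<forall>j::nat. w j \<in> vanishing_near p \<Omega> \<Gamma>) \<and>
         (\<lambda>j. sobolev_norm p \<Omega> (\<lambda>x. w j x - v x)) \<longlonglongrightarrow> 0}"

text \<open>The admissible constants of the embedding of \<open>W\<^sup>1\<^sup>,\<^sup>1(\<Omega>)\<close> into \<open>L\<^sup>N\<^sup>/\<^sup>(\<^sup>N\<^sup>-\<^sup>1\<^sup>)(\<Omega>)\<close>, \<open>N = DIM('a)\<close>. The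
  infimum is itself admissible whenever the embedding holds, i.e. when the set is nonempty.\<close>

definition sobolev_constants :: "'a::euclidean_space set \<Rightarrow> real set" where
  "sobolev_constants \<Omega> = (let q = real DIM('a) / (real DIM('a) - 1) in
     {S. 0 \<le> S \<and> (\<forall>g\<in>sobolev_space 1 \<Omega>. g \<in> Lp_space q \<Omega> \<and>
        Lp_norm q \<Omega> g \<le> S * (Lp_norm 1 \<Omega> (weak_grad \<Omega> g) + Lp_norm 1 \<Omega> g))})"

definition sobolev_constant :: "'a::euclidean_space set \<Rightarrow> real" where
  "sobolev_constant \<Omega> = Inf (sobolev_constants \<Omega>)"

section \<open>Gauges and the Finsler N-Laplacian\<close>

definition gauge_function :: "('a::euclidean_space \<Rightarrow> real) \<Rightarrow> bool" where
  "gauge_function H \<longleftrightarrow> (\<forall>\<xi>. 0 \<le> H \<xi>) \<and> convex_on UNIV H \<and>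
     (\<forall>t>0. \<forall>\<xi>. H (t *\<^sub>R \<xi>) = t * H \<xi>) \<and> (\<forall>\<xi>\<in>sphere 0 1. 0 < H \<xi>)"

text \<open>Uniform convexity of a set with quadratic modulus. For bounded sets with \<open>C\<^sup>2\<close> boundary this
  says that the principal curvatures of the boundary are bounded below by a positive constant;
  an arbitrary modulus would only amount to strict convexity in finite dimension.\<close>

definition uniformly_convex_set :: "'a::euclidean_space set \<Rightarrow> bool" where
  "uniformly_convex_set C \<longleftrightarrow>
     (\<exists>\<delta>>0. \<forall>x\<in>C. \<forall>y\<in>C. ball (midpoint x y) (\<delta> * (dist x y)\<^sup>2) \<subseteq> C)"

definition uniformly_elliptic :: "('a::euclidean_space \<Rightarrow> real) \<Rightarrow> bool" where
  "uniformly_elliptic H \<longleftrightarrow> uniformly_convex_set {\<xi>. H \<xi> < 1}"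

definition gradient :: "('a::euclidean_space \<Rightarrow> real) \<Rightarrow> 'a \<Rightarrow> 'a" where
  "gradient H \<xi> = (THE D. GDERIV H \<xi> :> D)"

text \<open>For a gauge \<open>H\<close> and \<open>DIM('a) \<ge> 2\<close> the field vanishes at the origin, where \<open>H\<close> is not
  differentiable, because \<open>H 0 = 0\<close>.\<close>

definition finsler_field :: "('a::euclidean_space \<Rightarrow> real) \<Rightarrow> 'a \<Rightarrow> 'a" where
  "finsler_field H \<xi> = H \<xi> ^ (DIM('a) - 1) *\<^sub>R gradient H \<xi>"

text \<open>Weak form of the mixed problem \<open>- div (a (\<nabla>u)) = f\<close> in \<open>\<Omega>\<close> with \<open>\<langle>a (\<nabla>u), \<nu>\<rangle> = 0\<close> on
  \<open>\<partial>\<Omega> - \<Gamma>\<close>: the conormal condition is natural and is encoded by the test functions being free off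
  \<open>\<Gamma>\<close>. They are bounded since \<open>f\<close> is merely integrable. The Dirichlet condition on \<open>\<Gamma>\<close> is not part
  of this predicate.\<close>

definition weak_solution ::
    "('a::euclidean_space \<Rightarrow> real) \<Rightarrow> 'a set \<Rightarrow> 'a set \<Rightarrow> ('a \<Rightarrow> real) \<Rightarrow> ('a \<Rightarrow> real) \<Rightarrow> bool" where
  "weak_solution H \<Omega> \<Gamma> f u \<longleftrightarrow>
     (\<forall>\<phi>\<in>sobolev_space_vanishing (real DIM('a)) \<Omega> \<Gamma>. essentially_bounded \<Omega> \<phi> \<longrightarrow>
        (LINT x|lebesgue_on \<Omega>. finsler_field H (weak_grad \<Omega> u x) \<bullet> weak_grad \<Omega> \<phi> x) =
        (LINT x|lebesgue_on \<Omega>. f x * \<phi> x))"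

section \<open>Radial geometry\<close>

definition radial_directions :: "'a::euclidean_space set \<Rightarrow> 'a \<Rightarrow> 'a set" where
  "radial_directions \<Omega> P = {sgn (x - P) | x. x \<in> \<Omega> \<and> x \<noteq> P}"

definition radial_cone :: "'a::euclidean_space set \<Rightarrow> 'a \<Rightarrow> 'a set" where
  "radial_cone \<Omega> P = {P + r *\<^sub>R \<omega> | r \<omega>. 0 < r \<and> \<omega> \<in> radial_directions \<Omega> P}"

text \<open>The radii \<open>lo \<omega> k \<le> hi \<omega> k\<close>, \<open>1 \<le> k \<le> K \<omega>\<close>, are kept as explicit data because the boundary
  points of a ray do not determine how they are grouped into pairs: two points \<open>r\<^sub>1 < r\<^sub>2\<close> can form
  one pair or two degenerate ones, and the contact sets and the radial width depend on this.
  That \<open>lo\<close> and \<open>hi\<close> are the front and back ends of the radial segments of \<open>\<Omega>\<close> is expressed by the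
  last conjunct: up to a null set (tangential rays may be exceptional), \<open>\<Omega>\<close> is swept out by the
  segments from \<open>P + lo \<omega> k *\<^sub>R \<omega>\<close> to \<open>P + hi \<omega> k *\<^sub>R \<omega>\<close>. If \<open>P\<close> lies in \<open>\<Omega>\<close>, the first segment starts
  at \<open>P\<close>, which is then counted as an end point (\<open>lo \<omega> 1 = 0\<close>) although it is not in \<open>\<partial>\<Omega>\<close>.\<close>

definition radial_property ::
    "'a::euclidean_space set \<Rightarrow> 'a \<Rightarrow> ('a \<Rightarrow> nat) \<Rightarrow> ('a \<Rightarrow> nat \<Rightarrow> real) \<Rightarrow> ('a \<Rightarrow> nat \<Rightarrow> real) \<Rightarrow> bool"
  where
  "radial_property \<Omega> P K lo hi \<longleftrightarrow>
     (\<forall>\<omega>\<in>radial_directions \<Omega> P.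
        1 \<le> K \<omega> \<and> 0 \<le> lo \<omega> 1 \<and>
        (\<forall>k\<in>{1..K \<omega>}. lo \<omega> k \<le> hi \<omega> k) \<and>
        (\<forall>k\<in>{1..<K \<omega>}. hi \<omega> k < lo \<omega> (k + 1)) \<and>
        {P + r *\<^sub>R \<omega> | r. 0 \<le> r} \<inter> (frontier \<Omega> \<union> ({P} \<inter> \<Omega>)) =
          (\<Union>k\<in>{1..K \<omega>}. {P + hi \<omega> k *\<^sub>R \<omega>, P + lo \<omega> k *\<^sub>R \<omega>})) \<and>
     (AE x in lebesgue_on \<Omega>.
        \<exists>k\<in>{1..K (sgn (x - P))}. lo (sgn (x - P)) k \<le> dist P x \<and> dist P x \<le> hi (sgn (x - P)) k)"

definition front_contact_set ::
    "'a::euclidean_space set \<Rightarrow> 'a \<Rightarrow> ('a \<Rightarrow> nat) \<Rightarrow> ('a \<Rightarrow> nat \<Rightarrow> real) \<Rightarrow> 'a set" where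
  "front_contact_set \<Omega> P K lo =
     {P + lo \<omega> k *\<^sub>R \<omega> | \<omega> k. \<omega> \<in> radial_directions \<Omega> P \<and> k \<in> {1..K \<omega>}}"

text \<open>This drops the degenerate contact points with \<open>lo \<omega> k = hi \<omega> k\<close>, so it may be smaller than
  the set of all \<open>P + hi \<omega> k *\<^sub>R \<omega>\<close>.\<close>

definition back_contact_set ::
    "'a::euclidean_space set \<Rightarrow> 'a \<Rightarrow> ('a \<Rightarrow> nat) \<Rightarrow> ('a \<Rightarrow> nat \<Rightarrow> real) \<Rightarrow> 'a set" where
  "back_contact_set \<Omega> P K lo = (frontier \<Omega> \<inter> radial_cone \<Omega> P) - front_contact_set \<Omega> P K lo"

definition radial_width ::
    "'a::euclidean_space set \<Rightarrow> 'a \<Rightarrow> ('a \<Rightarrow> nat) \<Rightarrow> ('a \<Rightarrow> nat \<Rightarrow> real) \<Rightarrow> ('a \<Rightarrow> nat \<Rightarrow> real) \<Rightarrow> real"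
  where
  "radial_width \<Omega> P K lo hi =
     (SUP \<omega>\<in>radial_directions \<Omega> P. Max ((\<lambda>k. hi \<omega> k - lo \<omega> k) ` {1..K \<omega>}))"

end

theory Submission
  imports Defs
begin

text \<open>
  Put \<open>w = u - h\<close>. Testing the two weak formulations with \<open>\<phi> \<circ> w\<close>, where \<open>\<phi>\<close> is a smoothed odd
  truncation that rises from \<open>0\<close> to \<open>\<delta>\<close> on \<open>[t, t + \<delta>]\<close>, and using the monotonicity of the Finsler field
  gives \<open>c\<^sub>1 \<integral> \<phi>'(w) |\<nabla>w|\<^sup>N \<le> \<delta> \<parallel>f\<parallel>\<^sub>1\<close>. As \<open>\<phi> \<circ> w\<close> vanishes at the back contact set, integration along
  rays gives \<open>\<parallel>\<phi>(w)\<parallel>\<^sub>1 \<le> d \<parallel>\<nabla>\<phi>(w)\<parallel>\<^sub>1\<close> with \<open>d\<close> the radial width, so the Sobolev inequality and Hoelder's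
  inequality with weight \<open>\<phi>'(w)\<close> bound the measure \<open>m\<close> of the level sets of \<open>|w|\<close> by
  \<open>\<delta> m(t + \<delta>) \<le> A (m(t) - m(t + \<delta>))\<close> with \<open>A = \<parallel>f\<parallel>\<^sub>1\<^sup>1\<^sup>/\<^sup>(\<^sup>N\<^sup>-\<^sup>1\<^sup>) / \<mu>\<close>. Letting \<open>\<delta>\<close> tend to \<open>0\<close> yields
  \<open>m(t) \<le> |\<Omega>| exp(-t/A)\<close>, and the layer cake formula concludes.

  The calculus of weak gradients needed for this rests on one identity along the affine flows
  \<open>\<theta>\<^sub>s x = (1 + s \<alpha>) x + s e\<close>: translations (\<open>\<alpha> = 0\<close>) give the chain rule and dilations about the radial
  center (\<open>\<alpha> = 1\<close>, \<open>e = - P\<close>) give the radial Poincare inequality without polar coordinates.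
\<close>

section \<open>Smooth bump functions and the fundamental lemma\<close>

text \<open>The decay is exponential because of a coincidence of exponents. With q = N / (N - 1),
  the Sobolev inequality is raised to the power q and contributes \<delta>^q on the left. The energy
  bound then carries the power q / N = 1 / (N - 1) and contributes \<delta>^(1 / (N - 1)) on the
  right. The weight carries the power 1 - 1 / N = 1 / q in Hoelder's inequality, so the measure of
  the slab t < |w| < t + \<delta> ends up linear. As q = 1 + 1 / (N - 1), exactly one factor
  \<delta> survives. The Poincare constant has to be the radial width itself, because it enters
  \<open>\<mu>\<close>; the Jacobian of the dilations provides just enough decay for this. Two
  obstacles shape the rest. Vanishing on \<Gamma> is known only through approximating functions, so
  facts about it are shown for functions that vanish near \<Gamma> and passed to the limit. Weak
  gradients are chosen among functions that agree almost everywhere, so computations are made on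
  representatives and transferred back.\<close>

lemma Ck_on_SucI:
  assumes "\<And>x. (f has_derivative f' x) (at x)" "\<And>v. Ck_on k UNIV (\<lambda>x. f' x v)"
  shows "Ck_on (Suc k) UNIV f"
proof -
  have "frechet_derivative f (at x) = f' x" for x
    using frechet_derivative_at[OF assms(1)[of x]] by simp
  then show ?thesis using assms by (auto simp: differentiable_def)
qed

lemma Ck_on_Suc_has_derivative:
  "Ck_on (Suc k) UNIV f \<Longrightarrow> (f has_derivative frechet_derivative f (at x)) (at x)"
  using frechet_derivative_works by auto

text \<open>The product rule leaves one factor undifferentiated, so an induction over products has
  to lower the order of that factor by one.\<close>

lemma Ck_on_mono_Suc: "Ck_on (Suc k) UNIV f \<Longrightarrow> Ck_on k UNIV f"
proof (induction k arbitrary: f)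
  case 0
  then show ?case
    by (auto simp: continuous_on_eq_continuous_at differentiable_imp_continuous_within)
qed auto

lemma Ck_on_const: "Ck_on k UNIV (\<lambda>x. c)"
proof (induction k arbitrary: c)
  case (Suc k)
  show ?case by (rule Ck_on_SucI[where f'="\<lambda>_ _. 0"]) (auto intro: Suc)
qed auto

lemma Ck_on_add: "Ck_on k UNIV f \<Longrightarrow> Ck_on k UNIV g \<Longrightarrow> Ck_on k UNIV (\<lambda>x. f x + g x)"
proof (induction k arbitrary: f g)
  case (Suc k)
  show ?case
    by (rule Ck_on_SucI[OF has_derivative_add[OF Ck_on_Suc_has_derivative[OF Suc(2)]
      Ck_on_Suc_has_derivative[OF Suc(3)]]]) (use Suc in auto)
qed (auto intro: continuous_intros)

lemma Ck_on_mult: "Ck_on k UNIV f \<Longrightarrow> Ck_on k UNIV g \<Longrightarrow> Ck_on k UNIV (\<lambda>x. f x * g x)"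
proof (induction k arbitrary: f g)
  case (Suc k)
  show ?case
    by (rule Ck_on_SucI[OF has_derivative_mult[OF Ck_on_Suc_has_derivative[OF Suc(2)]
      Ck_on_Suc_has_derivative[OF Suc(3)]]])
      (use Suc Ck_on_mono_Suc[OF Suc(2)] Ck_on_mono_Suc[OF Suc(3)] in \<open>auto intro!: Ck_on_add\<close>)
qed (auto intro: continuous_intros)

lemma Ck_on_prod:
  "finite I \<Longrightarrow> (\<And>i. i \<in> I \<Longrightarrow> Ck_on k UNIV (f i)) \<Longrightarrow> Ck_on k UNIV (\<lambda>x. \<Prod>i\<in>I. f i x)"
  by (induction I rule: finite_induct) (auto intro: Ck_on_const Ck_on_mult)

lemma Ck_on_inner: "Ck_on k UNIV (\<lambda>x. x \<bullet> b)"
proof (cases k)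
  case (Suc k')
  show ?thesis unfolding Suc
    by (rule Ck_on_SucI[where f'="\<lambda>_ v. v \<bullet> b"]) (auto intro: derivative_eq_intros Ck_on_const)
qed (auto intro: continuous_intros)

lemma Ck_on_affine: "Ck_on k UNIV f \<Longrightarrow> Ck_on k UNIV (\<lambda>x. f (c *\<^sub>R x + v))"
proof (induction k arbitrary: f)
  case 0
  then show ?case
    by (auto intro!: continuous_on_compose2[of UNIV f] continuous_intros)
next
  case (Suc k)
  have d: "((\<lambda>x. f (c *\<^sub>R x + v)) has_derivative (\<lambda>w. frechet_derivative f (at (c *\<^sub>R x + v)) (c *\<^sub>R w))) (at x)" for x
    by (rule has_derivative_compose[of "\<lambda>x. c *\<^sub>R x + v" "\<lambda>w. c *\<^sub>R w" x UNIV f])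
       (auto intro!: derivative_eq_intros Ck_on_Suc_has_derivative[OF Suc(2)])
  show ?case by (rule Ck_on_SucI[OF d]) (use Suc in auto)
qed

text \<open>The family \<open>flat_fun p\<close> is closed under differentiation, so smoothness is an induction over all \<open>p\<close>.\<close>

definition flat_fun :: "real poly \<Rightarrow> real \<Rightarrow> real" where
  "flat_fun p t = (if t > 0 then poly p (1 / t) * exp (- 1 / t) else 0)"

lemma poly_mult_exp_minus_tendsto_0: "((\<lambda>x. poly p x * exp (- x)) \<longlongrightarrow> (0::real)) at_top"
proof -
  have "((\<lambda>x. \<Sum>i\<le>degree p. coeff p i * (x ^ i / exp x)) \<longlongrightarrow> (\<Sum>i\<le>degree p. coeff p i * 0)) at_top"
    by (intro tendsto_intros tendsto_power_div_exp_0)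
  then show ?thesis
    by (simp add: poly_altdef exp_minus field_simps sum_distrib_left)
qed

text \<open>From the right, x = 1 / t reduces the limit to the decay of p(x) exp(-x) at infinity;
  from the left the function is constantly 0.\<close>

lemma flat_fun_tendsto_0: "(flat_fun p \<longlongrightarrow> 0) (at 0)"
proof -
  have "((\<lambda>t. poly p (inverse t) * exp (- inverse t)) \<longlongrightarrow> 0) (at_right (0::real))"
    by (rule filterlim_compose[OF poly_mult_exp_minus_tendsto_0 filterlim_inverse_at_top_right])
  moreover have "eventually (\<lambda>t. poly p (inverse t) * exp (- inverse t) = flat_fun p t) (at_right (0::real))"
    by (auto simp: eventually_at_filter flat_fun_def divide_inverse)
  ultimately have 1: "(flat_fun p \<longlongrightarrow> 0) (at_right 0)"
    by (rule Lim_transform_eventually)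
  have "eventually (\<lambda>t. 0 = flat_fun p t) (at_left (0::real))"
    by (auto simp: eventually_at_filter flat_fun_def)
  then have 2: "(flat_fun p \<longlongrightarrow> 0) (at_left 0)"
    by (rule Lim_transform_eventually[OF tendsto_const])
  show ?thesis using 1 2 by (simp add: filterlim_split_at)
qed

text \<open>For t > 0 the derivative of p(1 / t) exp(-1 / t) is x^2 (p(x) - p'(x)) exp(-x) at x = 1
  / t, and \<open>[:0, 0, 1:]\<close> is the polynomial x^2.\<close>

lemma flat_fun_has_derivative:
  "(flat_fun p has_real_derivative flat_fun ([:0, 0, 1:] * (p - pderiv p)) t) (at t)"
proof -
  consider "t > 0" | "t < 0" | "t = 0" by linarith
  then show ?thesis
  proof cases
    case 1
    have "((\<lambda>t. poly p (1 / t) * exp (- 1 / t)) has_real_derivative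
        flat_fun ([:0, 0, 1:] * (p - pderiv p)) t) (at t)"
      using 1 by (auto intro!: derivative_eq_intros simp: flat_fun_def field_simps power2_eq_square)
    then show ?thesis
    proof (rule has_field_derivative_transform_within_open[where S="{0<..}"])
    qed (use 1 in \<open>auto simp: flat_fun_def\<close>)
  next
    case 2
    have "((\<lambda>t. 0) has_real_derivative flat_fun ([:0, 0, 1:] * (p - pderiv p)) t) (at t)"
      using 2 by (auto simp: flat_fun_def)
    then show ?thesis
    proof (rule has_field_derivative_transform_within_open[where S="{..<0}"])
    qed (use 2 in \<open>auto simp: flat_fun_def\<close>)
  next
    case 3
    \<comment> \<open>The difference quotient at 0 is itself a member of the family: dividing by h
      multiplies the polynomial by x = 1 / h, so the limit lemma applies once more.\<close>
    have "(flat_fun p (0 + h) - flat_fun p 0) / h = flat_fun ([:0, 1:] * p) h" for h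
      by (auto simp: flat_fun_def)
    then have "(flat_fun p has_real_derivative 0) (at 0)"
      unfolding DERIV_def using flat_fun_tendsto_0[of "[:0, 1:] * p"] by presburger
    moreover have "flat_fun ([:0, 0, 1:] * (p - pderiv p)) 0 = 0" by (simp add: flat_fun_def)
    ultimately show ?thesis unfolding 3 by (simp only:)
  qed
qed

lemma Ck_on_flat_fun: "Ck_on k UNIV (\<lambda>x. flat_fun p (a * (x \<bullet> b) + c))"
proof (induction k arbitrary: p)
  case 0
  have "continuous_on UNIV (flat_fun p)"
    by (simp add: continuous_on_eq_continuous_at DERIV_isCont[OF flat_fun_has_derivative])
  then show ?case
    by (auto intro!: continuous_on_compose2[of UNIV "flat_fun p"] continuous_intros)
next
  case (Suc k)
  let ?p = "[:0, 0, 1:] * (p - pderiv p)"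
  \<comment> \<open>The scalar factor of the chain rule is moved into the polynomial, so that each
    directional derivative is literally a member of the family and the induction hypothesis
    fits.\<close>
  have "((\<lambda>x. flat_fun p (a * (x \<bullet> b) + c)) has_derivative
      (\<lambda>v. flat_fun (smult (a * (v \<bullet> b)) ?p) (a * (x \<bullet> b) + c))) (at x)" for x
  proof -
    have 1: "((\<lambda>x. a * (x \<bullet> b) + c) has_derivative (\<lambda>v. a * (v \<bullet> b))) (at x)"
      by (auto intro!: derivative_eq_intros)
    have 2: "(flat_fun p has_derivative (*) (flat_fun ?p (a * (x \<bullet> b) + c))) (at (a * (x \<bullet> b) + c))"
      using flat_fun_has_derivative unfolding has_field_derivative_def .
    have "(\<lambda>v. flat_fun (smult (a * (v \<bullet> b)) ?p) (a * (x \<bullet> b) + c)) =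
        (\<lambda>v. flat_fun ?p (a * (x \<bullet> b) + c) * (a * (v \<bullet> b)))"
      by (auto simp: flat_fun_def fun_eq_iff)
    then show ?thesis using has_derivative_compose[OF 1 2] by simp
  qed
  then show ?case by (rule Ck_on_SucI) (rule Suc)
qed

text \<open>The parameter n is a steepness. Inside the box each face contributes a factor exp(-1 /
  (n r)), with r the distance to its hyperplane, which tends to 1 as n grows; so the bumps converge
  to the indicator of the open box while their support stays in the closed one.\<close>

definition box_bump :: "real \<Rightarrow> 'a::euclidean_space \<Rightarrow> 'a \<Rightarrow> 'a \<Rightarrow> real" where
  "box_bump n a b x = (\<Prod>i\<in>Basis. flat_fun 1 (n * (x \<bullet> i) + (- n * (a \<bullet> i))) * flat_fun 1 ((- n) * (x \<bullet> i) + n * (b \<bullet> i)))"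

lemma box_bump_eq:
  assumes "n > 0"
  shows "box_bump n a b x = (if x \<in> box a b then \<Prod>i\<in>Basis. exp (- 1 / (n * (x \<bullet> i - a \<bullet> i))) * exp (- 1 / (n * (b \<bullet> i - x \<bullet> i))) else 0)"
proof (cases "x \<in> box a b")
  case True
  have "n * (a \<bullet> i) < n * (x \<bullet> i)" "n * (x \<bullet> i) < n * (b \<bullet> i)" if "i \<in> Basis" for i
    using True that assms by (auto simp: mem_box)
  then show ?thesis
    using True unfolding box_bump_def
    by (auto simp: flat_fun_def algebra_simps intro!: prod.cong)
next
  case False
  then obtain i where i: "i \<in> Basis" "\<not> (a \<bullet> i < x \<bullet> i \<and> x \<bullet> i < b \<bullet> i)" by (auto simp: mem_box)
  then have "flat_fun 1 (n * (x \<bullet> i) + (- n * (a \<bullet> i))) * flat_fun 1 ((- n) * (x \<bullet> i) + n * (b \<bullet> i)) = 0"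
    using assms by (auto simp: flat_fun_def)
  then show ?thesis using False i unfolding box_bump_def by (auto intro!: prod_zero)
qed

lemma box_bump_test:
  assumes "n > 0" "cbox a b \<subseteq> W"
  shows "box_bump n a b \<in> test_functions W"
proof -
  have "closure {x. box_bump n a b x \<noteq> 0} \<subseteq> cbox a b"
    using box_bump_eq[OF assms(1), of a b] box_subset_cbox
    by (intro closure_minimal) (auto split: if_splits)
  moreover have "Ck_on k UNIV (box_bump n a b)" for k
    unfolding box_bump_def[abs_def] by (intro Ck_on_prod Ck_on_mult Ck_on_flat_fun) auto
  ultimately show ?thesis
    using assms compact_Int_closed[OF compact_cbox[of a b] closed_closure[of "{x. box_bump n a b x \<noteq> 0}"]]
    by (auto simp: test_functions_def inf.absorb2)
qed

lemma box_bump_bounds: "n > 0 \<Longrightarrow> 0 \<le> box_bump n a b x \<and> box_bump n a b x \<le> 1"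
  by (auto simp: box_bump_def flat_fun_def intro!: prod_nonneg prod_le_1 mult_le_one)

lemma box_bump_tendsto:
  "(\<lambda>n. box_bump (real (Suc n)) a b x) \<longlonglongrightarrow> indicat_real (box a b) x"
proof (cases "x \<in> box a b")
  case True
  have *: "(\<lambda>n. exp (- 1 / (real (Suc n) * c))) \<longlonglongrightarrow> 1" if "c > 0" for c :: real
  proof -
    have "(\<lambda>n. - (1 / c) * inverse (real (Suc n))) \<longlonglongrightarrow> - (1 / c) * 0"
      by (intro tendsto_intros LIMSEQ_inverse_real_of_nat)
    then have "(\<lambda>n. exp (- (1 / c) * inverse (real (Suc n)))) \<longlonglongrightarrow> exp (- (1 / c) * 0)"
      by (rule tendsto_exp)
    then show ?thesis by (simp add: field_simps del: of_nat_Suc)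
  qed
  have "(\<lambda>n. \<Prod>i\<in>Basis. exp (- 1 / (real (Suc n) * (x \<bullet> i - a \<bullet> i))) * exp (- 1 / (real (Suc n) * (b \<bullet> i - x \<bullet> i))))
      \<longlonglongrightarrow> (\<Prod>i\<in>(Basis::'a set). 1 * 1)"
    using True by (intro tendsto_intros *) (auto simp: mem_box)
  then show ?thesis using True by (simp add: box_bump_eq del: of_nat_Suc)
next
  case False
  then show ?thesis by (simp add: box_bump_eq del: of_nat_Suc)
qed

text \<open>A Dynkin argument: the sets with vanishing integral are closed under complements and
  countable disjoint unions, and open boxes are stable under intersection and generate the Borel
  sets.\<close>

lemma integral_boxes_zero_imp_AE_zero:
  fixes f :: "'a::euclidean_space \<Rightarrow> real"
  assumes f: "integrable lebesgue f"
    and z: "\<And>a b. (LINT x|lebesgue. indicator (box a b) x * f x) = 0"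
  shows "AE x in lebesgue. f x = 0"
proof -
  \<comment> \<open>Boxes generate only the Borel sets, not all Lebesgue measurable ones, so the
    argument runs for a Borel representative.\<close>
  obtain g where g [measurable]: "g \<in> borel_measurable lborel" and fg: "AE x in lborel. f x = g x"
    using completion_ex_borel_measurable_real[of f lborel] f by (auto simp: integrable_iff_bounded)
  have fg': "AE x in lebesgue. f x = g x" using fg by (rule AE_completion)
  have gm: "g \<in> borel_measurable lebesgue" using g by (rule measurable_completion)
  have "integrable lebesgue g"
    by (rule integrable_cong_AE_imp[OF f gm fg'])
  then have gi: "integrable lborel g" by (simp add: integrable_completion)
  have gb: "(LINT x:box a b|lborel. g x) = 0" for a b
  proof -
    have "(LINT x:box a b|lborel. g x) = (LINT x|lebesgue. indicator (box a b) x * g x)"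
      unfolding set_lebesgue_integral_def real_scaleR_def by (rule integral_completion[symmetric]) auto
    also have "\<dots> = (LINT x|lebesgue. indicator (box a b) x * f x)"
      using fg' f gm by (intro integral_cong_AE borel_measurable_times) (auto intro!: measurable_completion[OF borel_measurable_indicator])
    finally show ?thesis using z by simp
  qed
  have si: "set_integrable lborel A g" if "A \<in> sets borel" for A
    using that gi unfolding set_integrable_def by (intro integrable_mult_indicator) auto
  have UN: "(\<Union>n. box (- real n *\<^sub>R One) (real n *\<^sub>R One)) = (UNIV :: 'a set)"
    using UN_box_eq_UNIV by simp
  \<comment> \<open>Complements need the integral over the whole space, which is not a box; it is
    the limit over growing boxes.\<close>
  have g0: "(LINT x|lborel. g x) = 0"
  proof -
    let ?B = "\<lambda>n. box (- real n *\<^sub>R One) (real n *\<^sub>R One) :: 'a set"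
    have "(\<lambda>n. LINT x:?B n|lborel. g x) \<longlonglongrightarrow> (LINT x:(\<Union>n. ?B n)|lborel. g x)"
    proof (rule set_integral_cont_up)
      show "incseq ?B"
        unfolding incseq_def by (intro allI impI subset_box_imp) simp
    qed (simp_all add: UN si)
    then show ?thesis unfolding gb UN by (simp add: set_lebesgue_integral_def LIMSEQ_const_iff)
  qed
  have "(LINT x:A|lborel. g x) = 0" if "A \<in> sets lborel" for A
  proof -
    have "Int_stable (range (\<lambda>(a, b). box a b :: 'a set))"
      by (auto simp: Int_stable_def box_Int_box)
    moreover have "range (\<lambda>(a, b). box a b :: 'a set) \<subseteq> Pow UNIV" by simp
    moreover have "A \<in> sigma_sets UNIV (range (\<lambda>(a, b). box a b :: 'a set))"
      using that by (simp add: borel_eq_box)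
    ultimately show ?thesis
    proof (induction rule: sigma_sets_induct_disjoint)
      case (basic A)
      then show ?case using gb by auto
    next
      case empty
      then show ?case by (simp add: set_lebesgue_integral_def)
    next
      case (compl A)
      then have A [measurable]: "A \<in> sets borel" by (simp add: borel_eq_box)
      have "(LINT x:(UNIV - A)|lborel. g x) = (LINT x|lborel. g x) - (LINT x:A|lborel. g x)"
      proof -
        have "(LINT x|lborel. g x) - (LINT x:A|lborel. g x) = (LINT x|lborel. g x - indicator A x *\<^sub>R g x)"
          using si[OF A] gi unfolding set_lebesgue_integral_def set_integrable_def
          by (intro Bochner_Integration.integral_diff[symmetric])
        also have "\<dots> = (LINT x:(UNIV - A)|lborel. g x)"
          unfolding set_lebesgue_integral_def by (intro Bochner_Integration.integral_cong) (auto simp: indicator_def)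
        finally show ?thesis by simp
      qed
      then show ?case using compl g0 by simp
    next
      case (union A)
      then have A: "\<And>i. A i \<in> sets borel" by (auto simp: borel_eq_box)
      have "(LINT x:(\<Union>i. A i)|lborel. g x) = (\<Sum>i. LINT x:A i|lborel. g x)"
        using A union by (intro lebesgue_integral_countable_add si) (auto simp: disjoint_family_on_def)
      then show ?case using union by simp
    qed
  qed
  \<comment> \<open>Integrable densities with equal integrals over all measurable sets agree almost
    everywhere; the second density is 0.\<close>
  then have "AE x in lborel. g x = 0"
    using gi by (intro density_unique_real) (auto simp: set_lebesgue_integral_def)
  then have "AE x in lebesgue. g x = 0" by (rule AE_completion)
  with fg' show ?thesis by eventually_elim simp
qed

text \<open>Bumps approximate indicators of boxes, so g integrates to 0 over every open box whose
  closed box lies in W. As g is only locally integrable, closed boxes are treated one at a time, and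
  countably many of them cover W.\<close>

theorem fundamental_lemma_lebesgue:
  fixes g :: "'a::euclidean_space \<Rightarrow> real"
  assumes W: "open W"
    and g: "\<And>C. compact C \<Longrightarrow> C \<subseteq> W \<Longrightarrow> set_integrable lebesgue C g"
    and z: "\<And>\<phi>. \<phi> \<in> test_functions W \<Longrightarrow> (LINT x|lebesgue. g x * \<phi> x) = 0"
  shows "AE x in lebesgue. x \<in> W \<longrightarrow> g x = 0"
proof -
  have box0: "(LINT x|lebesgue. indicator (box a b) x * g x) = 0" if ab: "cbox a b \<subseteq> W" for a b
  proof -
    have gi: "integrable lebesgue (\<lambda>x. indicator (cbox a b) x * g x)"
      using g[OF compact_cbox ab] by (simp add: set_integrable_def)
    \<comment> \<open>The extra indicator of the closed box changes nothing in the product but makes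
      the second factor integrable on the whole space; this factor serves as dominating
      function.\<close>
    have eq: "indicator (box a b) x * g x = indicator (box a b) x * (indicator (cbox a b) x * g x)" for x
      using box_subset_cbox[of a b] by (auto simp: indicator_def)
    have eq2: "g x * box_bump (real (Suc n)) a b x = box_bump (real (Suc n)) a b x * (indicator (cbox a b) x * g x)" for x n
      using box_subset_cbox[of a b] by (auto simp: indicator_def box_bump_eq simp del: of_nat_Suc)
    have m: "box_bump (real (Suc n)) a b \<in> borel_measurable lebesgue" for n
    proof -
      have "Ck_on 0 UNIV (box_bump (real (Suc n)) a b)"
        using box_bump_test[OF _ ab, of "real (Suc n)"] unfolding test_functions_def by (auto simp del: Ck_on.simps)
      then have "continuous_on UNIV (box_bump (real (Suc n)) a b)" by (simp del: of_nat_Suc)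
      then have "box_bump (real (Suc n)) a b \<in> borel_measurable lborel"
        by (simp add: borel_measurable_continuous_onI del: of_nat_Suc)
      then show ?thesis by (rule measurable_completion)
    qed
    have "(\<lambda>n. LINT x|lebesgue. box_bump (real (Suc n)) a b x * (indicator (cbox a b) x * g x)) \<longlonglongrightarrow>
       (LINT x|lebesgue. indicator (box a b) x * (indicator (cbox a b) x * g x))"
    proof (rule integral_dominated_convergence[where w="\<lambda>x. norm (indicator (cbox a b) x * g x)"
          and s="\<lambda>n x. box_bump (real (Suc n)) a b x * (indicator (cbox a b) x * g x)"
          and f="\<lambda>x. indicator (box a b) x * (indicator (cbox a b) x * g x)"])
      show "AE x in lebesgue. norm (box_bump (real (Suc n)) a b x * (indicator (cbox a b) x * g x))
           \<le> norm (indicator (cbox a b) x * g x)" for n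
      proof (rule AE_I2)
        fix x
        have "\<bar>box_bump (real (Suc n)) a b x\<bar> \<le> 1"
          using box_bump_bounds[of "real (Suc n)" a b x] by (simp del: of_nat_Suc)
        then have "\<bar>box_bump (real (Suc n)) a b x\<bar> * \<bar>indicator (cbox a b) x * g x\<bar> \<le> 1 * \<bar>indicator (cbox a b) x * g x\<bar>"
          by (rule mult_right_mono) simp
        then show "norm (box_bump (real (Suc n)) a b x * (indicator (cbox a b) x * g x))
           \<le> norm (indicator (cbox a b) x * g x)"
          by (simp only: real_norm_def abs_mult mult_1)
      qed
      show "AE x in lebesgue. (\<lambda>n. box_bump (real (Suc n)) a b x * (indicator (cbox a b) x * g x))
           \<longlonglongrightarrow> indicator (box a b) x * (indicator (cbox a b) x * g x)"
        by (intro AE_I2 tendsto_intros box_bump_tendsto)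
      show "(\<lambda>x. indicator (box a b) x * (indicator (cbox a b) x * g x)) \<in> borel_measurable lebesgue"
        using gi by (intro borel_measurable_times measurable_completion[OF borel_measurable_indicator] borel_measurable_integrable, auto)
      show "(\<lambda>x. box_bump (real (Suc n)) a b x * (indicator (cbox a b) x * g x)) \<in> borel_measurable lebesgue" for n
        using gi m by (auto intro!: borel_measurable_times)
    qed (use gi in \<open>rule integrable_norm\<close>)
    moreover have "(LINT x|lebesgue. box_bump (real (Suc n)) a b x * (indicator (cbox a b) x * g x)) = 0" for n
      using z[OF box_bump_test[OF _ ab], of "real (Suc n)"] by (simp only: eq2 of_nat_0_less_iff zero_less_Suc)
    ultimately have "(LINT x|lebesgue. indicator (box a b) x * (indicator (cbox a b) x * g x)) = 0"
      by (simp only: LIMSEQ_const_iff)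
    then show ?thesis by (simp only: eq[symmetric])
  qed
  have *: "AE x in lebesgue. x \<in> cbox a b \<longrightarrow> g x = 0" if ab: "cbox a b \<subseteq> W" for a b
  proof -
    have gi: "integrable lebesgue (\<lambda>x. indicator (cbox a b) x * g x)"
      using g[OF compact_cbox ab] by (simp add: set_integrable_def)
    have nf: "AE x in lebesgue. x \<notin> cbox a b - box a b"
      using negligible_frontier_interval[of a b] unfolding negligible_iff_null_sets by (rule AE_not_in)
    have "AE x in lebesgue. indicator (cbox a b) x * g x = 0"
    proof (rule integral_boxes_zero_imp_AE_zero[OF gi])
      fix c d :: 'a
      \<comment> \<open>The criterion asks for all boxes, whereas g is controlled only in
        \<open>cbox a b\<close>. Intersecting the two yields the box with corners \<open>e\<close>
        and \<open>f\<close>, up to the boundary of \<open>cbox a b\<close>, which is a null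
        set.\<close>
      define e where "e = (\<Sum>i\<in>Basis. max (c \<bullet> i) (a \<bullet> i) *\<^sub>R i)"
      define f where "f = (\<Sum>i\<in>Basis. min (d \<bullet> i) (b \<bullet> i) *\<^sub>R i)"
      have ef: "box c d \<inter> box a b = box e f" "cbox c d \<inter> cbox a b = cbox e f"
        by (simp_all only: box_Int_box Int_interval e_def f_def)
      have "(LINT x|lebesgue. indicator (box c d) x * (indicator (cbox a b) x * g x)) =
         (LINT x|lebesgue. indicator (box e f) x * g x)"
      proof (rule integral_cong_AE)
        show 1: "(\<lambda>x. indicator (box c d) x * (indicator (cbox a b) x * g x)) \<in> borel_measurable lebesgue"
          using gi by (intro borel_measurable_times measurable_completion[OF borel_measurable_indicator] borel_measurable_integrable, auto)
        have "(\<lambda>x. indicator (box e f) x * (indicator (cbox a b) x * g x)) \<in> borel_measurable lebesgue"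
          using gi by (intro borel_measurable_times measurable_completion[OF borel_measurable_indicator] borel_measurable_integrable, auto)
        moreover have "(\<lambda>x. indicator (box e f) x * (indicator (cbox a b) x * g x)) = (\<lambda>x. indicator (box e f) x * g x)"
          using ef box_subset_cbox[of a b] by (auto simp: indicator_def fun_eq_iff)
        ultimately show "(\<lambda>x. indicator (box e f) x * g x) \<in> borel_measurable lebesgue" by simp
        show "AE x in lebesgue. indicator (box c d) x * (indicator (cbox a b) x * g x) = indicator (box e f) x * g x"
          using nf
        proof eventually_elim
          case (elim x)
          then show ?case using ef(1) box_subset_cbox[of a b] by (auto simp: indicator_def)
        qed
      qed
      also have "\<dots> = 0" using ef(2) ab by (intro box0) auto
      finally show "(LINT x|lebesgue. indicator (box c d) x * (indicator (cbox a b) x * g x)) = 0" .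
    qed
    then show ?thesis by eventually_elim (auto simp: indicator_def)
  qed
  obtain D where D: "countable D" "\<And>X. X \<in> D \<Longrightarrow> \<exists>a b. X = cbox a b" "\<Union>D = W"
    using open_countable_Union_open_cbox[OF W] by metis
  have "AE x in lebesgue. \<forall>X\<in>D. x \<in> X \<longrightarrow> g x = 0"
  proof (rule AE_ball_countable'[OF _ D(1)])
    fix X assume "X \<in> D"
    then show "AE x in lebesgue. x \<in> X \<longrightarrow> g x = 0"
    proof -
      obtain a b where X: "X = cbox a b" using D(2)[OF \<open>X \<in> D\<close>] by blast
      have "cbox a b \<subseteq> W" using \<open>X \<in> D\<close> D(3) X by blast
      then show ?thesis unfolding X by (rule *)
    qed
  qed
  then show ?thesis
    by (rule eventually_mono) (use D(3) in blast)
qed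

section \<open>Weak gradients along affine flows\<close>

lemma frechet_derivative_eqI: "(f has_derivative f') (at x) \<Longrightarrow> frechet_derivative f (at x) = f'"
  by (rule frechet_derivative_at[symmetric])


lemma test_functions_derivative:
  "\<phi> \<in> test_functions W \<Longrightarrow> (\<phi> has_derivative frechet_derivative \<phi> (at x)) (at x)"
proof -
  assume "\<phi> \<in> test_functions W"
  then have "Ck_on (Suc 0) UNIV \<phi>" unfolding test_functions_def by (simp del: Ck_on.simps)
  then show ?thesis by (rule Ck_on_Suc_has_derivative)
qed

lemma test_functions_Ck: "\<phi> \<in> test_functions W \<Longrightarrow> Ck_on k UNIV \<phi>"
  unfolding test_functions_def by (simp del: Ck_on.simps)

lemma test_functions_continuous: "\<phi> \<in> test_functions W \<Longrightarrow> continuous_on UNIV \<phi>"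
  using test_functions_Ck[of \<phi> W 0] by simp

lemma test_functions_deriv_continuous:
  assumes "\<phi> \<in> test_functions W"
  shows "continuous_on UNIV (\<lambda>x. frechet_derivative \<phi> (at x) v)"
  using test_functions_Ck[OF assms, of "Suc 0"] by simp

lemma test_functions_support:
  "\<phi> \<in> test_functions W \<Longrightarrow> compact (closure {x. \<phi> x \<noteq> 0}) \<and> closure {x. \<phi> x \<noteq> 0} \<subseteq> W"
  unfolding test_functions_def by (simp del: Ck_on.simps)

lemma test_functions_deriv_zero:
  assumes "x \<notin> closure {x. \<phi> x \<noteq> (0::real)}"
  shows "frechet_derivative \<phi> (at x) = (\<lambda>v. 0)"
proof -
  have "(\<phi> has_derivative (\<lambda>v. 0)) (at x)"
  proof (rule has_derivative_transform_within_open[of "\<lambda>x. 0" _ _ UNIV "- closure {x. \<phi> x \<noteq> 0}"])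
    show "0 = \<phi> y" if "y \<in> - closure {x. \<phi> x \<noteq> 0}" for y
      using that closure_subset[of "{x. \<phi> x \<noteq> 0}"] by auto
  qed (use assms in auto)
  then show ?thesis by (rule frechet_derivative_eqI)
qed

lemma test_functionsI:
  assumes "\<And>k. Ck_on k UNIV \<psi>" "compact C" "C \<subseteq> W" "\<And>x. x \<notin> C \<Longrightarrow> \<psi> x = 0"
  shows "\<psi> \<in> test_functions W"
proof -
  have "closure {x. \<psi> x \<noteq> 0} \<subseteq> C"
    using assms(4) compact_imp_closed[OF assms(2)] by (intro closure_minimal) auto
  then have "compact (closure {x. \<psi> x \<noteq> 0})" "closure {x. \<psi> x \<noteq> 0} \<subseteq> W"
    using compact_Int_closed[OF assms(2) closed_closure[of "{x. \<psi> x \<noteq> 0}"]] assms(3)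
    by (auto simp: inf.absorb2)
  then show ?thesis using assms(1) unfolding test_functions_def by blast
qed

lemma compact_support_bounded:
  fixes f :: "'a::euclidean_space \<Rightarrow> real"
  assumes "continuous_on UNIV f" "compact C" "\<And>x. x \<notin> C \<Longrightarrow> f x = 0"
  obtains B where "B \<ge> 0" "\<And>x. \<bar>f x\<bar> \<le> B"
proof -
  have "bounded (f ` C)"
    using assms by (intro compact_imp_bounded compact_continuous_image) (auto intro: continuous_on_subset)
  then obtain B where B: "\<And>x. x \<in> C \<Longrightarrow> \<bar>f x\<bar> \<le> B" by (auto simp: bounded_iff)
  have "\<bar>f x\<bar> \<le> max B 0" for x using B[of x] assms(3)[of x] by (cases "x \<in> C") auto
  then show ?thesis by (intro that[of "max B 0"]) auto
qed

lemma test_functions_bounded: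
  assumes "\<phi> \<in> test_functions W"
  obtains B where "B \<ge> 0" "\<And>x. \<bar>\<phi> x\<bar> \<le> B"
  using compact_support_bounded[OF test_functions_continuous[OF assms], of "closure {x. \<phi> x \<noteq> 0}"]
    test_functions_support[OF assms] closure_subset[of "{x. \<phi> x \<noteq> 0}"] by blast

lemma test_functions_deriv_bounded:
  assumes "\<phi> \<in> test_functions W"
  obtains B where "B \<ge> 0" "\<And>x. \<bar>frechet_derivative \<phi> (at x) v\<bar> \<le> B"
  using compact_support_bounded[OF test_functions_deriv_continuous[OF assms], of "closure {x. \<phi> x \<noteq> 0}" v]
    test_functions_support[OF assms] test_functions_deriv_zero[of _ \<phi>] by metis

lemma integrable_mult_bounded:
  fixes u g :: "'a \<Rightarrow> real"
  assumes "integrable M u" "g \<in> borel_measurable M" "\<And>x. \<bar>g x\<bar> \<le> B"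
  shows "integrable M (\<lambda>x. u x * g x)"
proof (rule Bochner_Integration.integrable_bound[where f="\<lambda>x. B * u x"])
  have "\<bar>g x\<bar> * \<bar>u x\<bar> \<le> \<bar>B\<bar> * \<bar>u x\<bar>" for x using assms(3)[of x] by (intro mult_right_mono) auto
  then show "AE x in M. norm (u x * g x) \<le> norm (B * u x)"
    by (auto simp: abs_mult mult.commute)
qed (use assms in auto)

section \<open>Affine substitutions in Lebesgue integrals\<close>

lemma nn_integral_lborel_affine:
  fixes f :: "'a::euclidean_space \<Rightarrow> ennreal"
  assumes [measurable]: "f \<in> borel_measurable borel" and c: "c \<noteq> 0"
  shows "(\<integral>\<^sup>+x. f x \<partial>lborel) = ennreal (\<bar>c\<bar> ^ DIM('a)) * (\<integral>\<^sup>+x. f (c *\<^sub>R x + t) \<partial>lborel)"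
proof -
  have "(\<integral>\<^sup>+x. f x \<partial>lborel) = (\<integral>\<^sup>+x. f x \<partial>density (distr lborel borel (\<lambda>x. t + c *\<^sub>R x)) (\<lambda>_. \<bar>c\<bar> ^ DIM('a)))"
    by (subst (1) lborel_affine[OF c, of t]) simp
  also have "\<dots> = (\<integral>\<^sup>+x. ennreal (\<bar>c\<bar> ^ DIM('a)) * f (t + c *\<^sub>R x) \<partial>lborel)"
    by (simp add: nn_integral_density nn_integral_distr)
  also have "\<dots> = ennreal (\<bar>c\<bar> ^ DIM('a)) * (\<integral>\<^sup>+x. f (t + c *\<^sub>R x) \<partial>lborel)"
    by (rule nn_integral_cmult) simp
  finally show ?thesis by (simp add: add.commute)
qed

lemma integrable_lborel_affine:
  fixes f :: "'a::euclidean_space \<Rightarrow> 'b::{banach, second_countable_topology}"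
  assumes "integrable lborel f" "c \<noteq> 0"
  shows "integrable lborel (\<lambda>x. f (c *\<^sub>R x + t))"
proof -
  have [measurable]: "f \<in> borel_measurable borel" using assms by auto
  have "ennreal (\<bar>c\<bar> ^ DIM('a)) * (\<integral>\<^sup>+x. norm (f (c *\<^sub>R x + t)) \<partial>lborel) < \<infinity>"
    using assms(1) nn_integral_lborel_affine[of "\<lambda>x. norm (f x)" c t] assms(2)
    by (simp add: integrable_iff_bounded)
  then have "(\<integral>\<^sup>+x. norm (f (c *\<^sub>R x + t)) \<partial>lborel) < \<infinity>"
  proof -
    have "ennreal (\<bar>c\<bar> ^ DIM('a)) \<noteq> 0"
      using zero_less_power[of "\<bar>c\<bar>" "DIM('a)"] assms(2) by (simp add: ennreal_eq_0_iff not_le del: zero_less_power)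
    then show ?thesis
      using \<open>ennreal (\<bar>c\<bar> ^ DIM('a)) * _ < \<infinity>\<close> by (auto simp: ennreal_mult_less_top)
  qed
  then show ?thesis by (simp add: integrable_iff_bounded)
qed

lemma integral_lborel_affine:
  fixes f :: "'a::euclidean_space \<Rightarrow> real"
  assumes [measurable]: "f \<in> borel_measurable borel" and c: "c \<noteq> 0"
  shows "(LINT x|lborel. f x) = \<bar>c\<bar> ^ DIM('a) * (LINT x|lborel. f (c *\<^sub>R x + t))"
proof -
  have "(LINT x|lborel. f x) = (LINT x|density (distr lborel borel (\<lambda>x. t + c *\<^sub>R x)) (\<lambda>_. \<bar>c\<bar> ^ DIM('a)). f x)"
    by (subst (1) lborel_affine[OF c, of t]) simp
  also have "\<dots> = (LINT x|lborel. \<bar>c\<bar> ^ DIM('a) * f (t + c *\<^sub>R x))"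
    by (simp add: integral_density integral_distr)
  finally show ?thesis by (simp add: add.commute)
qed

text \<open>The exceptional set is first enlarged to a Borel null set, to whose indicator the
  substitution formula applies.\<close>

lemma AE_lborel_affine:
  fixes P :: "'a::euclidean_space \<Rightarrow> bool"
  assumes "AE x in lborel. P x" "c \<noteq> 0"
  shows "AE x in lborel. P (c *\<^sub>R x + t)"
proof -
  obtain N where N: "N \<in> sets lborel" "emeasure lborel N = 0" "{x. \<not> P x} \<subseteq> N"
    using AE_E[OF assms(1)] by auto
  have [measurable]: "N \<in> sets borel" using N by simp
  have "(\<integral>\<^sup>+x. indicator N x \<partial>lborel) = 0" using N by simp
  then have "(\<integral>\<^sup>+x. indicator N (c *\<^sub>R x + t) \<partial>lborel) = 0"
    using nn_integral_lborel_affine[of "indicator N" c t] assms(2) by auto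
  then have "AE x in lborel. indicator N (c *\<^sub>R x + t) = (0::ennreal)"
    by (subst (asm) nn_integral_0_iff_AE) auto
  then show ?thesis
    by eventually_elim (use N(3) in \<open>auto simp: indicator_def split: if_splits\<close>)
qed

text \<open>Borel measurability on the whole space makes Fubini's theorem available, which fails for the
  completed measure \<open>lebesgue\<close>. Values outside \<open>\<Omega>\<close> are irrelevant since test functions vanish there.\<close>

definition borel_weak_gradient ::
    "'a::euclidean_space set \<Rightarrow> ('a \<Rightarrow> real) \<Rightarrow> ('a \<Rightarrow> 'a) \<Rightarrow> bool" where
  "borel_weak_gradient \<Omega> u G \<longleftrightarrow> integrable lborel u \<and> integrable lborel G \<and>
     (\<forall>\<phi>\<in>test_functions \<Omega>. \<forall>b\<in>Basis.
        (LINT x|lborel. u x * frechet_derivative \<phi> (at x) b) = - (LINT x|lborel. (G x \<bullet> b) * \<phi> x))"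

text \<open>The sign of \<alpha> gives \<open>\<sigma> s \<ge> 1\<close> for s \<ge> 0. Hence the
  maps are invertible at all these times, and as their Jacobians are at least 1, pulling a
  nonnegative function back does not increase its integral.\<close>

locale affine_flow =
  fixes \<alpha> :: real and e :: "'a::euclidean_space"
  assumes \<alpha>: "\<alpha> \<ge> 0"
begin

definition \<sigma> :: "real \<Rightarrow> real" where "\<sigma> s = 1 + s * \<alpha>"
definition \<theta> :: "real \<Rightarrow> 'a \<Rightarrow> 'a" where "\<theta> s x = \<sigma> s *\<^sub>R x + s *\<^sub>R e"
definition \<zeta> :: "real \<Rightarrow> 'a \<Rightarrow> 'a" where "\<zeta> s y = (1 / \<sigma> s) *\<^sub>R y + (- s / \<sigma> s) *\<^sub>R e"
text \<open>Orbits are straight lines: \<open>V x\<close> is the constant velocity of the curve that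
  sends s to \<open>\<theta> s x\<close>. The velocity at the point y reached at time s is therefore
  \<open>(1 / \<sigma> s) *\<^sub>R V y\<close>, which is the origin of the exponent
  \<open>DIM('a) + 1\<close> of \<open>\<sigma> s\<close> below.\<close>

definition V :: "'a \<Rightarrow> 'a" where "V x = \<alpha> *\<^sub>R x + e"

lemma \<sigma>_pos: "s \<ge> 0 \<Longrightarrow> \<sigma> s > 0" "s \<ge> 0 \<Longrightarrow> \<sigma> s \<ge> 1"
  using \<alpha> by (simp_all add: \<sigma>_def add_pos_nonneg)

lemma \<zeta>_\<theta>: "s \<ge> 0 \<Longrightarrow> \<zeta> s (\<theta> s x) = x" and \<theta>_\<zeta>: "s \<ge> 0 \<Longrightarrow> \<theta> s (\<zeta> s x) = x"
  using \<sigma>_pos[of s] by (simp_all add: \<zeta>_def \<theta>_def algebra_simps)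

lemma V_\<theta>: "V (\<theta> s x) = \<sigma> s *\<^sub>R V x"
  by (simp add: V_def \<theta>_def \<sigma>_def algebra_simps)

lemma measurable_flow [measurable]:
  "\<sigma> \<in> borel_measurable borel"
  "(\<lambda>(s, x). \<theta> s x) \<in> borel_measurable (borel \<Otimes>\<^sub>M borel)"
  "(\<lambda>(s, x). \<zeta> s x) \<in> borel_measurable (borel \<Otimes>\<^sub>M borel)"
  "V \<in> borel_measurable borel"
  unfolding \<sigma>_def[abs_def] \<theta>_def[abs_def] \<zeta>_def[abs_def] V_def[abs_def] case_prod_beta
  by measurable

lemma measurable_\<theta> [measurable]: "\<theta> s \<in> borel_measurable borel" "\<zeta> s \<in> borel_measurable borel"
  unfolding \<theta>_def[abs_def] \<zeta>_def[abs_def] by measurable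

text \<open>The density \<open>\<phi>\<close> transported by the flow \<open>\<theta>\<close>, whose inverse is \<open>\<zeta>\<close>. By the continuity equation its time
  derivative is minus the divergence of \<open>pushed \<phi> s\<close> times the velocity; evaluated at \<open>\<theta>\<^sub>s x\<close>, this
  divergence is \<open>flow_div \<phi> x\<close> up to a power of \<open>\<sigma> s\<close>.\<close>

definition pushed :: "('a \<Rightarrow> real) \<Rightarrow> real \<Rightarrow> 'a \<Rightarrow> real" where
  "pushed \<phi> s y = (1 / \<sigma> s ^ DIM('a)) * \<phi> (\<zeta> s y)"

definition flow_div :: "('a \<Rightarrow> real) \<Rightarrow> 'a \<Rightarrow> real" where
  "flow_div \<phi> x = real DIM('a) * \<alpha> * \<phi> x + frechet_derivative \<phi> (at x) (V x)"

text \<open>The support moves to its image under \<open>\<theta> s\<close>, which lies in \<Omega>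
  by the assumption on W, and the extra factor is affine in y, hence smooth.\<close>

lemma pushed_test:
  assumes \<phi>: "\<phi> \<in> test_functions W" and s: "s \<ge> 0" and W: "\<And>x. x \<in> W \<Longrightarrow> \<theta> s x \<in> \<Omega>"
  shows "(\<lambda>y. \<phi> (\<zeta> s y) * (c * (V y \<bullet> b))) \<in> test_functions \<Omega>"
proof (rule test_functionsI[where C="\<theta> s ` closure {x. \<phi> x \<noteq> 0}"])
  have "V y \<bullet> b = \<alpha> * (y \<bullet> b) + e \<bullet> b" for y by (simp add: V_def inner_add_left)
  moreover have "Ck_on k UNIV (\<lambda>y. \<phi> (\<zeta> s y))" for k
    unfolding \<zeta>_def by (rule Ck_on_affine[OF test_functions_Ck[OF \<phi>]])
  ultimately show "Ck_on k UNIV (\<lambda>y. \<phi> (\<zeta> s y) * (c * (V y \<bullet> b)))" for k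
    by (simp only:) (intro Ck_on_mult Ck_on_add Ck_on_const Ck_on_inner)
  show "compact (\<theta> s ` closure {x. \<phi> x \<noteq> 0})"
    using test_functions_support[OF \<phi>] unfolding \<theta>_def[abs_def]
    by (intro compact_continuous_image continuous_intros) auto
  show "\<theta> s ` closure {x. \<phi> x \<noteq> 0} \<subseteq> \<Omega>"
    using test_functions_support[OF \<phi>] W by auto
  fix y assume y: "y \<notin> \<theta> s ` closure {x. \<phi> x \<noteq> 0}"
  have "\<phi> (\<zeta> s y) = 0"
  proof (rule ccontr)
    assume "\<phi> (\<zeta> s y) \<noteq> 0"
    then have "\<zeta> s y \<in> closure {x. \<phi> x \<noteq> 0}" using closure_subset[of "{x. \<phi> x \<noteq> 0}"] by auto
    then have "\<theta> s (\<zeta> s y) \<in> \<theta> s ` closure {x. \<phi> x \<noteq> 0}" by blast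
    then show False using y \<theta>_\<zeta>[OF s] by simp
  qed
  then show "\<phi> (\<zeta> s y) * (c * (V y \<bullet> b)) = 0" by simp
qed

lemma flow_div_properties:
  assumes \<phi>: "\<phi> \<in> test_functions W"
  shows "continuous_on UNIV (flow_div \<phi>)"
    and "\<exists>B\<ge>0. \<forall>x. \<bar>flow_div \<phi> x\<bar> \<le> B"
proof -
  \<comment> \<open>Continuity is known for derivatives in a fixed direction, whereas
    \<open>V x\<close> varies with x; hence the expansion in the basis.\<close>
  have "frechet_derivative \<phi> (at x) (V x) = (\<Sum>b\<in>Basis. (V x \<bullet> b) * frechet_derivative \<phi> (at x) b)" for x
  proof -
    have "linear (frechet_derivative \<phi> (at x))"
      using test_functions_derivative[OF \<phi>] has_derivative_linear by blast
    then have "frechet_derivative \<phi> (at x) (\<Sum>b\<in>Basis. (V x \<bullet> b) *\<^sub>R b) =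
        (\<Sum>b\<in>Basis. (V x \<bullet> b) * frechet_derivative \<phi> (at x) b)"
      by (simp add: linear_sum linear_scale)
    then show ?thesis by (simp add: euclidean_representation)
  qed
  then show c: "continuous_on UNIV (flow_div \<phi>)"
    unfolding flow_div_def[abs_def] V_def
    by (auto intro!: continuous_intros test_functions_continuous[OF \<phi>] test_functions_deriv_continuous[OF \<phi>])
  show "\<exists>B\<ge>0. \<forall>x. \<bar>flow_div \<phi> x\<bar> \<le> B"
  proof (rule compact_support_bounded[OF c])
    show "compact (closure {x. \<phi> x \<noteq> 0})" using test_functions_support[OF \<phi>] by simp
    show "flow_div \<phi> x = 0" if "x \<notin> closure {x. \<phi> x \<noteq> 0}" for x
      using that closure_subset[of "{x. \<phi> x \<noteq> 0}"]
      by (auto simp: flow_div_def test_functions_deriv_zero)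
  qed blast
qed

text \<open>The weak gradient is tested with each component of the vector field
  \<open>pushed \<phi> s\<close> times velocity, and summing over the basis turns the partial
  derivatives into the divergence of that field.\<close>

lemma flow_weak_identity:
  assumes G: "borel_weak_gradient \<Omega> u G"
    and \<phi>: "\<phi> \<in> test_functions W" and s: "s \<ge> 0" and W: "\<And>x. x \<in> W \<Longrightarrow> \<theta> s x \<in> \<Omega>"
  shows "(LINT y|lborel. u y * (flow_div \<phi> (\<zeta> s y) / \<sigma> s ^ (DIM('a) + 1))) =
    - (LINT y|lborel. (G y \<bullet> V y) * (\<phi> (\<zeta> s y) / \<sigma> s ^ (DIM('a) + 1)))"
proof -
  define c where "c = 1 / \<sigma> s ^ (DIM('a) + 1)"
  define \<psi> where "\<psi> b y = \<phi> (\<zeta> s y) * (c * (V y \<bullet> b))" for b y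
  have \<psi>: "\<psi> b \<in> test_functions \<Omega>" for b
    unfolding \<psi>_def[abs_def] by (rule pushed_test[OF \<phi> s W])
  have d\<zeta>: "(\<zeta> s has_derivative (\<lambda>v. (1 / \<sigma> s) *\<^sub>R v)) (at y)" for y
    unfolding \<zeta>_def[abs_def] by (auto intro!: derivative_eq_intros)
  have lin: "linear (frechet_derivative \<phi> (at x))" for x
    using test_functions_derivative[OF \<phi>] has_derivative_linear by blast
  have d\<psi>: "frechet_derivative (\<psi> b) (at y) b =
      c * (\<phi> (\<zeta> s y) * \<alpha> + (V y \<bullet> b) * frechet_derivative \<phi> (at (\<zeta> s y)) b / \<sigma> s)"
    if b: "b \<in> Basis" for b y
  proof -
    have 1: "((\<lambda>y. \<phi> (\<zeta> s y)) has_derivative (\<lambda>v. frechet_derivative \<phi> (at (\<zeta> s y)) ((1 / \<sigma> s) *\<^sub>R v))) (at y)"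
      by (rule has_derivative_compose[OF d\<zeta> test_functions_derivative[OF \<phi>]])
    have 2: "((\<lambda>y. c * (V y \<bullet> b)) has_derivative (\<lambda>v. c * (\<alpha> * (v \<bullet> b)))) (at y)"
      unfolding V_def by (auto intro!: derivative_eq_intros simp: inner_add_left)
    show ?thesis
      unfolding \<psi>_def[abs_def] frechet_derivative_eqI[OF has_derivative_mult[OF 1 2]]
      using b by (simp add: linear_scale[OF lin] algebra_simps)
  qed
  \<comment> \<open>This factor cancels the \<open>1 / \<sigma> s\<close> that the chain rule
    produces for the inner map \<open>\<zeta> s\<close>.\<close>
  have V: "V y = \<sigma> s *\<^sub>R V (\<zeta> s y)" for y
    using V_\<theta>[of s "\<zeta> s y"] \<theta>_\<zeta>[OF s] by simp
  have sum_d: "(\<Sum>b\<in>Basis. frechet_derivative (\<psi> b) (at y) b) = flow_div \<phi> (\<zeta> s y) / \<sigma> s ^ (DIM('a) + 1)" for y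
  proof -
    have "(\<Sum>b\<in>Basis. (V y \<bullet> b) * frechet_derivative \<phi> (at (\<zeta> s y)) b) =
        frechet_derivative \<phi> (at (\<zeta> s y)) (\<Sum>b\<in>Basis. (V y \<bullet> b) *\<^sub>R b)"
      by (simp add: linear_sum[OF lin] linear_scale[OF lin])
    also have "\<dots> = \<sigma> s * frechet_derivative \<phi> (at (\<zeta> s y)) (V (\<zeta> s y))"
      unfolding euclidean_representation by (subst V) (simp add: linear_scale[OF lin])
    finally have *: "(\<Sum>b\<in>Basis. (V y \<bullet> b) * frechet_derivative \<phi> (at (\<zeta> s y)) b / \<sigma> s) =
        frechet_derivative \<phi> (at (\<zeta> s y)) (V (\<zeta> s y))"
      using \<sigma>_pos(1)[OF s] by (simp add: sum_divide_distrib[symmetric])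
    have "(\<Sum>b\<in>Basis. frechet_derivative (\<psi> b) (at y) b) =
        (\<Sum>b\<in>Basis. c * (\<phi> (\<zeta> s y) * \<alpha> + (V y \<bullet> b) * frechet_derivative \<phi> (at (\<zeta> s y)) b / \<sigma> s))"
      by (rule sum.cong[OF refl d\<psi>])
    also have "\<dots> = c * flow_div \<phi> (\<zeta> s y)"
      by (simp add: sum_distrib_left[symmetric] sum.distrib * flow_div_def)
    finally show ?thesis by (simp add: c_def)
  qed
  have sum_\<psi>: "(\<Sum>b\<in>Basis. (G y \<bullet> b) * \<psi> b y) = (G y \<bullet> V y) * (\<phi> (\<zeta> s y) / \<sigma> s ^ (DIM('a) + 1))" for y
  proof -
    have "(\<Sum>b\<in>Basis. (G y \<bullet> b) * \<psi> b y) = (\<Sum>b\<in>Basis. (G y \<bullet> b) * (V y \<bullet> b)) * (\<phi> (\<zeta> s y) * c)"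
      unfolding sum_distrib_right by (rule sum.cong) (auto simp: \<psi>_def)
    then show ?thesis by (simp add: c_def euclidean_inner[of "G y" "V y"])
  qed
  have ui: "integrable lborel u" and Gi: "integrable lborel G"
    using G by (auto simp: borel_weak_gradient_def)
  have i1: "integrable lborel (\<lambda>y. u y * frechet_derivative (\<psi> b) (at y) b)" for b
  proof -
    obtain B where "\<And>x. \<bar>frechet_derivative (\<psi> b) (at x) b\<bar> \<le> B"
      using test_functions_deriv_bounded[OF \<psi>] by metis
    then show ?thesis
      using test_functions_deriv_continuous[OF \<psi>, of b b]
      by (intro integrable_mult_bounded ui) (auto intro: borel_measurable_continuous_onI)
  qed
  have i2: "integrable lborel (\<lambda>y. (G y \<bullet> b) * \<psi> b y)" for b
  proof -
    obtain B where "\<And>x. \<bar>\<psi> b x\<bar> \<le> B"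
      using test_functions_bounded[OF \<psi>] by metis
    then show ?thesis
      using test_functions_continuous[OF \<psi>, of b] Gi
      by (intro integrable_mult_bounded) (auto intro: borel_measurable_continuous_onI)
  qed
  have "(LINT y|lborel. u y * (\<Sum>b\<in>Basis. frechet_derivative (\<psi> b) (at y) b)) =
      (\<Sum>b\<in>Basis. LINT y|lborel. u y * frechet_derivative (\<psi> b) (at y) b)"
    unfolding sum_distrib_left by (rule Bochner_Integration.integral_sum) (rule i1)
  also have "\<dots> = (\<Sum>b\<in>Basis. - (LINT y|lborel. (G y \<bullet> b) * \<psi> b y))"
    using G \<psi> by (intro sum.cong) (auto simp: borel_weak_gradient_def)
  also have "\<dots> = - (LINT y|lborel. (\<Sum>b\<in>Basis. (G y \<bullet> b) * \<psi> b y))"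
    by (subst Bochner_Integration.integral_sum[OF i2]) (simp add: sum_negf)
  finally show ?thesis unfolding sum_d sum_\<psi> .
qed

lemma pushed_has_derivative:
  assumes \<phi>: "\<phi> \<in> test_functions W" and s: "s \<ge> 0"
  shows "((\<lambda>s. pushed \<phi> s y) has_real_derivative - (flow_div \<phi> (\<zeta> s y) / \<sigma> s ^ (DIM('a) + 1))) (at s)"
proof -
  have \<sigma>: "\<sigma> s > 0" "\<sigma> s \<noteq> 0" using \<sigma>_pos[OF s] by auto
  have lin: "linear (frechet_derivative \<phi> (at x))" for x
    using test_functions_derivative[OF \<phi>] has_derivative_linear by blast
  have V: "V y = \<sigma> s *\<^sub>R V (\<zeta> s y)"
    using V_\<theta>[of s "\<zeta> s y"] \<theta>_\<zeta>[OF s] by simp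
  have d\<sigma>: "(\<sigma> has_real_derivative \<alpha>) (at s)"
    unfolding \<sigma>_def[abs_def] by (auto intro!: derivative_eq_intros)
  have inv: "((\<lambda>s. 1 / \<sigma> s) has_real_derivative - \<alpha> / (\<sigma> s)\<^sup>2) (at s)"
    using \<sigma> by (auto intro!: derivative_eq_intros d\<sigma> simp: power2_eq_square)
  have "((\<lambda>s. - s / \<sigma> s) has_real_derivative - 1 / (\<sigma> s)\<^sup>2) (at s)"
    using \<sigma> by (auto intro!: derivative_eq_intros d\<sigma> simp: power2_eq_square divide_simps) (simp add: \<sigma>_def algebra_simps)
  then have "((\<lambda>s. \<zeta> s y) has_vector_derivative (- \<alpha> / (\<sigma> s)\<^sup>2) *\<^sub>R y + (- 1 / (\<sigma> s)\<^sup>2) *\<^sub>R e) (at s)"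
    unfolding \<zeta>_def using inv
    by (intro has_vector_derivative_add has_vector_derivative_scaleR[where g'=0, simplified])
      (auto simp: has_real_derivative_iff_has_vector_derivative)
  \<comment> \<open>The preimage \<open>\<zeta> s y\<close> of a fixed point y moves against
    \<open>V\<close>, with the speed reduced by the factor \<open>1 / \<sigma> s\<close>.\<close>
  moreover have "(- \<alpha> / (\<sigma> s)\<^sup>2) *\<^sub>R y + (- 1 / (\<sigma> s)\<^sup>2) *\<^sub>R e = (- 1 / \<sigma> s) *\<^sub>R V (\<zeta> s y)"
  proof -
    have "(- \<alpha> / (\<sigma> s)\<^sup>2) *\<^sub>R y + (- 1 / (\<sigma> s)\<^sup>2) *\<^sub>R e = (- 1 / (\<sigma> s)\<^sup>2) *\<^sub>R V y"
      by (simp add: V_def scaleR_add_right)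
    also have "\<dots> = (- 1 / \<sigma> s) *\<^sub>R V (\<zeta> s y)"
      using \<sigma> by (subst V) (simp add: power2_eq_square)
    finally show ?thesis .
  qed
  ultimately have "((\<lambda>s. \<zeta> s y) has_derivative (\<lambda>h. h *\<^sub>R ((- 1 / \<sigma> s) *\<^sub>R V (\<zeta> s y)))) (at s)"
    by (simp add: has_vector_derivative_def)
  from has_derivative_compose[OF this test_functions_derivative[OF \<phi>]]
  have "((\<lambda>s. \<phi> (\<zeta> s y)) has_derivative (\<lambda>h. (- frechet_derivative \<phi> (at (\<zeta> s y)) (V (\<zeta> s y)) / \<sigma> s) * h)) (at s)"
    by (simp add: linear_scale[OF lin] linear_neg[OF lin] mult.commute del: scaleR_minus_left)
  then have d1: "((\<lambda>s. \<phi> (\<zeta> s y)) has_real_derivative - frechet_derivative \<phi> (at (\<zeta> s y)) (V (\<zeta> s y)) / \<sigma> s) (at s)"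
    by (simp only: has_field_derivative_def)
  have d2: "((\<lambda>s. 1 / \<sigma> s ^ DIM('a)) has_real_derivative - real DIM('a) * \<alpha> / \<sigma> s ^ (DIM('a) + 1)) (at s)"
  proof -
    have "((\<lambda>s. 1 / \<sigma> s ^ DIM('a)) has_real_derivative - (real DIM('a) * \<sigma> s ^ (DIM('a) - 1) * \<alpha>) / (\<sigma> s ^ DIM('a) * \<sigma> s ^ DIM('a))) (at s)"
      using \<sigma> by (auto intro!: derivative_eq_intros d\<sigma>)
    moreover have "\<sigma> s ^ DIM('a) = \<sigma> s * \<sigma> s ^ (DIM('a) - 1)"
      using DIM_positive[where 'a='a] by (simp add: power_eq_if)
    ultimately show ?thesis using \<sigma> by (simp add: field_simps)
  qed
  show ?thesis
    unfolding pushed_def flow_div_def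
    by (rule DERIV_cong[OF DERIV_mult[OF d2 d1]]) (use \<sigma> in \<open>simp add: field_simps\<close>)
qed

lemma pushed_diff:
  assumes \<phi>: "\<phi> \<in> test_functions W" and t: "t \<ge> 0"
  shows "pushed \<phi> t y - \<phi> y =
    - (LINT s|lborel. indicator {0..t} s * (flow_div \<phi> (\<zeta> s y) / \<sigma> s ^ (DIM('a) + 1)))"
proof -
  have "(LINT s|lborel. (- (flow_div \<phi> (\<zeta> s y) / \<sigma> s ^ (DIM('a) + 1))) * indicator {0..t} s) =
      pushed \<phi> t y - pushed \<phi> 0 y"
  proof (rule integral_FTC_Icc_real[OF t])
    fix s assume s: "0 \<le> s" "s \<le> t"
    then show "((\<lambda>s. pushed \<phi> s y) has_real_derivative - (flow_div \<phi> (\<zeta> s y) / \<sigma> s ^ (DIM('a) + 1))) (at s)"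
      by (intro pushed_has_derivative[OF \<phi>])
    have \<sigma>: "\<sigma> s \<noteq> 0" using \<sigma>_pos[OF s(1)] by simp
    have c1: "isCont \<sigma> s" unfolding \<sigma>_def[abs_def] by (intro continuous_intros)
    have c2: "isCont (\<lambda>s. \<zeta> s y) s" unfolding \<zeta>_def using \<sigma> c1 by (intro continuous_intros) auto
    have "isCont (flow_div \<phi>) (\<zeta> s y)"
      using flow_div_properties(1)[OF \<phi>] by (simp add: continuous_on_eq_continuous_at)
    then have "isCont (\<lambda>s. flow_div \<phi> (\<zeta> s y)) s"
      using c2 isCont_o2 by blast
    then show "isCont (\<lambda>s. - (flow_div \<phi> (\<zeta> s y) / \<sigma> s ^ (DIM('a) + 1))) s"
      using \<sigma> c1 by (intro continuous_intros) auto
  qed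
  moreover have "pushed \<phi> 0 y = \<phi> y" by (simp add: pushed_def \<zeta>_def \<sigma>_def)
  ultimately show ?thesis by (simp add: mult.commute)
qed

lemma flow_nn_bound:
  assumes [measurable]: "g \<in> borel_measurable borel" and s: "s \<ge> 0"
  shows "(\<integral>\<^sup>+x. g (\<theta> s x) \<partial>lborel) \<le> (\<integral>\<^sup>+x. g x \<partial>lborel)"
proof -
  have "1 * (\<integral>\<^sup>+x. g (\<theta> s x) \<partial>lborel) \<le> ennreal (\<bar>\<sigma> s\<bar> ^ DIM('a)) * (\<integral>\<^sup>+x. g (\<theta> s x) \<partial>lborel)"
    using \<sigma>_pos[OF s] by (intro mult_right_mono) (auto simp: one_le_power simp flip: ennreal_1 intro!: ennreal_leI)
  also have "\<dots> = (\<integral>\<^sup>+x. g x \<partial>lborel)"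
    unfolding \<theta>_def using \<sigma>_pos[OF s] by (intro nn_integral_lborel_affine[symmetric]) auto
  finally show ?thesis by simp
qed

text \<open>Prepares Fubini's theorem. The velocity of a dilation is unbounded, so a weight \<psi>
  has to cut it off; for translations the constant weight 1 will do.\<close>

lemma flow_integrable:
  assumes Gi: "integrable lborel G" and t: "t \<ge> 0"
    and [measurable]: "\<psi> \<in> borel_measurable borel" and B: "\<And>x. norm (V x) * \<bar>\<psi> x\<bar> \<le> B"
  shows "integrable (lborel \<Otimes>\<^sub>M lborel) (\<lambda>(s, x). indicator {0..t} s * ((G (\<theta> s x) \<bullet> V x) * \<psi> x))"
proof -
  have [measurable]: "G \<in> borel_measurable borel" using Gi by auto
  have B0: "B \<ge> 0" using B[of 0] by (smt (verit) mult_nonneg_nonneg norm_ge_zero abs_ge_zero)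
  have "(\<integral>\<^sup>+z. norm (case z of (s, x) \<Rightarrow> indicator {0..t} s * ((G (\<theta> s x) \<bullet> V x) * \<psi> x)) \<partial>(lborel \<Otimes>\<^sub>M lborel)) =
      (\<integral>\<^sup>+s. \<integral>\<^sup>+x. norm (indicator {0..t} s * ((G (\<theta> s x) \<bullet> V x) * \<psi> x)) \<partial>lborel \<partial>lborel)"
    by (subst lborel.nn_integral_fst[symmetric]) auto
  also have "\<dots> \<le> (\<integral>\<^sup>+s. indicator {0..t} s * (B * (\<integral>\<^sup>+x. norm (G x) \<partial>lborel)) \<partial>lborel)"
  proof (rule nn_integral_mono)
    fix s :: real
    show "(\<integral>\<^sup>+x. norm (indicator {0..t} s * ((G (\<theta> s x) \<bullet> V x) * \<psi> x)) \<partial>lborel) \<le>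
        indicator {0..t} s * (B * (\<integral>\<^sup>+x. norm (G x) \<partial>lborel))"
    proof (cases "s \<in> {0..t}")
      case True
      have "(\<integral>\<^sup>+x. norm (indicator {0..t} s * ((G (\<theta> s x) \<bullet> V x) * \<psi> x)) \<partial>lborel) \<le>
          (\<integral>\<^sup>+x. ennreal B * ennreal (norm (G (\<theta> s x))) \<partial>lborel)"
      proof (rule nn_integral_mono)
        fix x
        have "\<bar>G (\<theta> s x) \<bullet> V x\<bar> * \<bar>\<psi> x\<bar> \<le> (norm (G (\<theta> s x)) * norm (V x)) * \<bar>\<psi> x\<bar>"
          by (intro mult_right_mono Cauchy_Schwarz_ineq2) auto
        also have "\<dots> = norm (G (\<theta> s x)) * (norm (V x) * \<bar>\<psi> x\<bar>)" by simp
        also have "\<dots> \<le> norm (G (\<theta> s x)) * B" by (intro mult_left_mono B) auto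
        finally show "ennreal (norm (indicator {0..t} s * ((G (\<theta> s x) \<bullet> V x) * \<psi> x))) \<le>
            ennreal B * ennreal (norm (G (\<theta> s x)))"
          using True B0 by (simp add: abs_mult mult.commute flip: ennreal_mult)
      qed
      also have "\<dots> = B * (\<integral>\<^sup>+x. norm (G (\<theta> s x)) \<partial>lborel)"
        by (rule nn_integral_cmult) simp
      also have "\<dots> \<le> B * (\<integral>\<^sup>+x. norm (G x) \<partial>lborel)"
        using True by (intro mult_left_mono flow_nn_bound) auto
      finally show ?thesis using True by simp
    qed simp
  qed
  also have "\<dots> = (B * (\<integral>\<^sup>+x. norm (G x) \<partial>lborel)) * emeasure lborel {0..t}"
    by (subst mult.commute) (rule nn_integral_cmult_indicator, simp)
  also have "\<dots> < \<infinity>"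
    using Gi t by (auto simp: integrable_iff_bounded ennreal_mult_less_top)
  finally show ?thesis by (simp add: integrable_iff_bounded)
qed

text \<open>Substitution moves the increment in time from u to the test function, where the
  evolution is smooth. The increment becomes a time integral of a divergence, the weak gradient
  absorbs the divergence at each fixed time, and the substitution is undone.\<close>

lemma flow_test_identity:
  assumes G: "borel_weak_gradient \<Omega> u G" and t: "t \<ge> 0"
    and \<phi>: "\<phi> \<in> test_functions {x. \<forall>s\<in>{0..t}. \<theta> s x \<in> \<Omega>}"
  shows "(LINT x|lborel. (u (\<theta> t x) - u x) * \<phi> x) =
    (LINT x|lborel. (LINT s|lborel. indicator {0..t} s * (G (\<theta> s x) \<bullet> V x)) * \<phi> x)"
proof -
  let ?n = "DIM('a)"
  have ui: "integrable lborel u" and Gi: "integrable lborel G"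
    using G by (auto simp: borel_weak_gradient_def)
  have [measurable]: "u \<in> borel_measurable borel" "G \<in> borel_measurable borel" using ui Gi by auto
  have [measurable]: "\<phi> \<in> borel_measurable borel" "flow_div \<phi> \<in> borel_measurable borel"
    using test_functions_continuous[OF \<phi>] flow_div_properties(1)[OF \<phi>]
    by (auto intro: borel_measurable_continuous_onI)
  obtain B where B: "B \<ge> 0" "\<And>x. \<bar>flow_div \<phi> x\<bar> \<le> B" using flow_div_properties(2)[OF \<phi>] by blast
  obtain C where C: "C \<ge> 0" "\<And>x. \<bar>\<phi> x\<bar> \<le> C" using test_functions_bounded[OF \<phi>] by blast
  obtain C' where C': "C' \<ge> 0" "\<And>x. \<bar>norm (V x) * \<phi> x\<bar> \<le> C'"
  proof (rule compact_support_bounded[of "\<lambda>x. norm (V x) * \<phi> x" "closure {x. \<phi> x \<noteq> 0}"])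
    show "continuous_on UNIV (\<lambda>x. norm (V x) * \<phi> x)"
      unfolding V_def by (intro continuous_intros test_functions_continuous[OF \<phi>])
    show "norm (V x) * \<phi> x = 0" if "x \<notin> closure {x. \<phi> x \<noteq> 0}" for x
      using that closure_subset[of "{x. \<phi> x \<noteq> 0}"] by auto
  qed (use test_functions_support[OF \<phi>] in auto)
  have shift: "(LINT x|lborel. u (\<theta> t x) * \<phi> x) = (LINT y|lborel. u y * pushed \<phi> t y)"
  proof -
    have "(LINT y|lborel. u y * pushed \<phi> t y) =
        \<bar>\<sigma> t\<bar> ^ ?n * (LINT x|lborel. u (\<sigma> t *\<^sub>R x + t *\<^sub>R e) * pushed \<phi> t (\<sigma> t *\<^sub>R x + t *\<^sub>R e))"
      using \<sigma>_pos[OF t] unfolding pushed_def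
      by (intro integral_lborel_affine) auto
    also have "\<dots> = (LINT x|lborel. \<bar>\<sigma> t\<bar> ^ ?n * (u (\<theta> t x) * pushed \<phi> t (\<theta> t x)))"
      by (simp add: \<theta>_def)
    also have "\<dots> = (LINT x|lborel. u (\<theta> t x) * \<phi> x)"
      using \<sigma>_pos[OF t] by (intro Bochner_Integration.integral_cong) (auto simp: pushed_def \<zeta>_\<theta>[OF t])
    finally show ?thesis by simp
  qed
  have i\<theta>: "integrable lborel (\<lambda>x. u (\<theta> t x))"
    unfolding \<theta>_def using \<sigma>_pos[OF t] ui by (intro integrable_lborel_affine) auto
  have ip: "integrable lborel (\<lambda>y. u y * pushed \<phi> t y)"
  proof (rule integrable_mult_bounded[OF ui])
    show "pushed \<phi> t \<in> borel_measurable lborel" unfolding pushed_def[abs_def] by measurable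
    show "\<bar>pushed \<phi> t y\<bar> \<le> C" for y
    proof -
      have "\<bar>\<phi> (\<zeta> t y)\<bar> / \<sigma> t ^ ?n \<le> \<bar>\<phi> (\<zeta> t y)\<bar> / 1"
        using \<sigma>_pos[OF t] by (intro divide_left_mono) (auto simp: one_le_power)
      then show ?thesis using C(2)[of "\<zeta> t y"] \<sigma>_pos[OF t] by (simp add: pushed_def abs_mult)
    qed
  qed
  have iu: "integrable lborel (\<lambda>x. u x * \<phi> x)" "integrable lborel (\<lambda>x. u (\<theta> t x) * \<phi> x)"
    using ui i\<theta> C(2) by (auto intro!: integrable_mult_bounded)
  let ?D = "\<lambda>s y. flow_div \<phi> (\<zeta> s y) / \<sigma> s ^ (?n + 1)"
  have D: "\<bar>?D s y\<bar> \<le> B" if "s \<ge> 0" for s y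
  proof -
    have "\<bar>flow_div \<phi> (\<zeta> s y)\<bar> / \<sigma> s ^ (?n + 1) \<le> B / 1"
      using \<sigma>_pos[OF that] B one_le_power[of "\<sigma> s" "?n + 1"] by (intro frac_le) auto
    then show ?thesis using \<sigma>_pos[OF that] by simp
  qed
  have fub1: "integrable (lborel \<Otimes>\<^sub>M lborel) (\<lambda>(s, y). indicator {0..t} s * (u y * ?D s y))"
  proof -
    have "(\<integral>\<^sup>+z. norm (case z of (s, y) \<Rightarrow> indicator {0..t} s * (u y * ?D s y)) \<partial>(lborel \<Otimes>\<^sub>M lborel)) =
        (\<integral>\<^sup>+s. \<integral>\<^sup>+y. norm (indicator {0..t} s * (u y * ?D s y)) \<partial>lborel \<partial>lborel)"
      by (subst lborel.nn_integral_fst[symmetric]) auto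
    also have "\<dots> \<le> (\<integral>\<^sup>+s. (\<integral>\<^sup>+y. B * norm (u y) \<partial>lborel) * indicator {0..t} s \<partial>lborel)"
    proof (rule nn_integral_mono)
      fix s :: real
      show "(\<integral>\<^sup>+y. norm (indicator {0..t} s * (u y * ?D s y)) \<partial>lborel) \<le> (\<integral>\<^sup>+y. B * norm (u y) \<partial>lborel) * indicator {0..t} s"
      proof (cases "s \<in> {0..t}")
        case True
        have "\<bar>u y\<bar> * \<bar>?D s y\<bar> \<le> \<bar>u y\<bar> * B" for y using D True by (intro mult_left_mono) auto
        then have "norm (indicator {0..t} s * (u y * ?D s y)) \<le> B * norm (u y)" for y
          using True by (simp only: abs_mult real_norm_def indicator_simps mult_1 abs_one) (simp add: mult.commute)
        then show ?thesis using True by (auto intro!: nn_integral_mono ennreal_leI)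
      qed simp
    qed
    also have "\<dots> = (\<integral>\<^sup>+y. B * norm (u y) \<partial>lborel) * emeasure lborel {0..t}"
      by (rule nn_integral_cmult_indicator) simp
    also have "\<dots> < \<infinity>"
    proof -
      have "integrable lborel (\<lambda>y. B * u y)" using ui by simp
      then have "(\<integral>\<^sup>+y. B * norm (u y) \<partial>lborel) < \<infinity>" using B by (simp only: integrable_iff_bounded real_norm_def abs_mult abs_of_nonneg)
      then show ?thesis using t by (auto simp: ennreal_mult_less_top)
    qed
    finally show ?thesis by (simp add: integrable_iff_bounded)
  qed
  have fub2: "integrable (lborel \<Otimes>\<^sub>M lborel) (\<lambda>(s, x). indicator {0..t} s * ((G (\<theta> s x) \<bullet> V x) * \<phi> x))"
    using C'(2) by (intro flow_integrable[OF Gi t]) (auto simp: abs_mult)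
  have "(LINT x|lborel. (u (\<theta> t x) - u x) * \<phi> x) = (LINT x|lborel. u x * pushed \<phi> t x) - (LINT x|lborel. u x * \<phi> x)"
    using iu shift by (simp add: left_diff_distrib)
  also have "\<dots> = (LINT y|lborel. u y * (pushed \<phi> t y - \<phi> y))"
    using iu ip by (simp add: right_diff_distrib)
  also have "\<dots> = - (LINT y|lborel. LINT s|lborel. indicator {0..t} s * (u y * ?D s y))"
  proof -
    have "u y * (pushed \<phi> t y - \<phi> y) = - (LINT s|lborel. indicator {0..t} s * (u y * ?D s y))" for y
      unfolding pushed_diff[OF \<phi> t] mult.left_commute[of _ "u y"] integral_mult_right_zero by simp
    then show ?thesis by simp
  qed
  also have "(LINT y|lborel. LINT s|lborel. indicator {0..t} s * (u y * ?D s y)) =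
      (LINT s|lborel. LINT y|lborel. indicator {0..t} s * (u y * ?D s y))"
    using lborel_pair.Fubini_integral[OF fub1] by simp
  also have "\<dots> = (LINT s|lborel. - (LINT x|lborel. indicator {0..t} s * ((G (\<theta> s x) \<bullet> V x) * \<phi> x)))"
  proof (rule Bochner_Integration.integral_cong[OF refl])
    fix s :: real
    show "(LINT y|lborel. indicator {0..t} s * (u y * ?D s y)) =
        - (LINT x|lborel. indicator {0..t} s * ((G (\<theta> s x) \<bullet> V x) * \<phi> x))"
    proof (cases "s \<in> {0..t}")
      case True
      then have s: "s \<ge> 0" by simp
      let ?g = "\<lambda>y. (G y \<bullet> V y) * (\<phi> (\<zeta> s y) / \<sigma> s ^ (?n + 1))"
      have "(LINT y|lborel. u y * ?D s y) = - (LINT y|lborel. ?g y)"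
        using True by (intro flow_weak_identity[OF G \<phi> s]) auto
      also have "(LINT y|lborel. ?g y) = \<bar>\<sigma> s\<bar> ^ ?n * (LINT x|lborel. ?g (\<sigma> s *\<^sub>R x + s *\<^sub>R e))"
        using \<sigma>_pos[OF s] by (intro integral_lborel_affine) auto
      also have "\<dots> = (LINT x|lborel. \<bar>\<sigma> s\<bar> ^ ?n * ?g (\<theta> s x))"
        by (simp add: \<theta>_def)
      \<comment> \<open>The Jacobian contributes \<open>\<sigma> s ^ DIM('a)\<close> and
        \<open>V (\<theta> s x)\<close> one more factor \<open>\<sigma> s\<close>, which together
        cancel the denominator.\<close>
      also have "\<dots> = (LINT x|lborel. (G (\<theta> s x) \<bullet> V x) * \<phi> x)"
        using \<sigma>_pos[OF s] by (intro Bochner_Integration.integral_cong) (auto simp: \<zeta>_\<theta>[OF s] V_\<theta>)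
      finally show ?thesis using True by simp
    qed simp
  qed
  also have "\<dots> = - (LINT x|lborel. LINT s|lborel. indicator {0..t} s * ((G (\<theta> s x) \<bullet> V x) * \<phi> x))"
    using lborel_pair.Fubini_integral[OF fub2] by simp
  finally show ?thesis by (simp add: mult.assoc[symmetric])
qed

end

text \<open>The complement is the projection of a closed set along a compact time interval, hence
  closed.\<close>

lemma (in affine_flow) open_flow_domain:
  assumes "open \<Omega>"
  shows "open {x. \<forall>s\<in>{0..t}. \<theta> s x \<in> \<Omega>}"
proof -
  let ?U = "({0..t} \<times> UNIV) \<inter> (\<lambda>z. \<theta> (fst z) (snd z)) -` (- \<Omega>)"
  have "closed ((\<lambda>z. \<theta> (fst z) (snd z)) -` (- \<Omega>))"
    using assms unfolding \<theta>_def \<sigma>_def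
    by (intro continuous_closed_vimage) (auto intro!: continuous_intros simp: closed_def)
  then have "closedin (top_of_set ({0..t} \<times> UNIV)) ?U"
    by (rule closedin_closed_Int)
  then have "closedin (top_of_set UNIV) {x. \<exists>s. s \<in> {0..t} \<and> (s, x) \<in> ?U}"
    by (rule closedin_compact_projection[OF compact_Icc])
  then have "closed {x. \<exists>s. s \<in> {0..t} \<and> (s, x) \<in> ?U}" by simp
  moreover have "{x. \<exists>s. s \<in> {0..t} \<and> (s, x) \<in> ?U} = - {x. \<forall>s\<in>{0..t}. \<theta> s x \<in> \<Omega>}"
    by auto
  ultimately show ?thesis by (simp add: open_closed)
qed

text \<open>The fundamental theorem of calculus along an orbit, for a function that has only a weak
  gradient. The two sides agree when tested on the open set of points whose orbit stays in \<Omega>,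
  and the fundamental lemma removes the test function. The exceptional null set depends on
  t.\<close>

theorem (in affine_flow) flow_formula:
  assumes G: "borel_weak_gradient \<Omega> u G" and t: "t \<ge> 0" and \<Omega>: "open \<Omega>"
  shows "AE x in lborel. (\<forall>s\<in>{0..t}. \<theta> s x \<in> \<Omega>) \<longrightarrow>
    u (\<theta> t x) - u x = (LINT s|lborel. indicator {0..t} s * (G (\<theta> s x) \<bullet> V x))"
proof -
  let ?W = "{x. \<forall>s\<in>{0..t}. \<theta> s x \<in> \<Omega>}"
  let ?I = "\<lambda>x. LINT s|lborel. indicator {0..t} s * (G (\<theta> s x) \<bullet> V x)"
  have ui: "integrable lborel u" and Gi: "integrable lborel G"
    using G by (auto simp: borel_weak_gradient_def)
  have [measurable]: "u \<in> borel_measurable borel" "G \<in> borel_measurable borel" using ui Gi by auto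
  have i\<theta>: "integrable lborel (\<lambda>x. u (\<theta> t x))"
    unfolding \<theta>_def using \<sigma>_pos[OF t] ui by (intro integrable_lborel_affine) auto
  have Im [measurable]: "?I \<in> borel_measurable borel" by measurable
  have gm: "(\<lambda>x. u (\<theta> t x) - u x - ?I x) \<in> borel_measurable borel" by measurable
  \<comment> \<open>On a compact set the velocity is bounded; this gives the local integrability
    that the fundamental lemma asks for.\<close>
  have Ii: "integrable lborel (\<lambda>x. ?I x * indicator C x)" if C: "compact C" for C
  proof -
    have [measurable]: "C \<in> sets borel" using C by (simp add: borel_compact)
    have "bounded (V ` C)"
      unfolding V_def[abs_def] using C by (intro compact_imp_bounded compact_continuous_image continuous_intros)
    then obtain B where B: "\<And>x. x \<in> C \<Longrightarrow> norm (V x) \<le> B" by (auto simp: bounded_iff)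
    have "norm (V x) * \<bar>indicator C x\<bar> \<le> max B 0" for x :: 'a
      using B[of x] by (auto simp: indicator_def)
    then have "integrable (lborel \<Otimes>\<^sub>M lborel) (\<lambda>(s, x). indicator {0..t} s * ((G (\<theta> s x) \<bullet> V x) * indicator C x))"
      by (intro flow_integrable[OF Gi t]) auto
    from lborel_pair.integrable_snd[OF this]
    show ?thesis by (simp add: mult.assoc[symmetric])
  qed
  have "AE x in lebesgue. x \<in> ?W \<longrightarrow> u (\<theta> t x) - u x - ?I x = 0"
  proof (rule fundamental_lemma_lebesgue[OF open_flow_domain[OF \<Omega>]])
    fix C :: "'a set" assume C: "compact C"
    then have [measurable]: "C \<in> sets borel" by (simp add: borel_compact)
    have "integrable lborel (\<lambda>x. indicator C x *\<^sub>R (u (\<theta> t x) - u x - ?I x))"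
      using Bochner_Integration.integrable_diff[OF integrable_mult_indicator[of C lborel, OF _ Bochner_Integration.integrable_diff[OF i\<theta> ui]] Ii[OF C]]
      by (simp add: algebra_simps)
    then show "set_integrable lebesgue C (\<lambda>x. u (\<theta> t x) - u x - ?I x)"
      unfolding set_integrable_def by (subst integrable_completion) auto
  next
    fix \<phi> assume \<phi>: "\<phi> \<in> test_functions ?W"
    have [measurable]: "\<phi> \<in> borel_measurable borel"
      using test_functions_continuous[OF \<phi>] by (rule borel_measurable_continuous_onI)
    obtain B where B: "\<And>x. \<bar>\<phi> x\<bar> \<le> B" using test_functions_bounded[OF \<phi>] by metis
    let ?C = "closure {x. \<phi> x \<noteq> 0}"
    have C: "compact ?C" using test_functions_support[OF \<phi>] by simp
    have [measurable]: "?C \<in> sets borel" using C by (simp add: borel_compact)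
    have ic: "indicator ?C x * \<phi> x = \<phi> x" for x
      using closure_subset[of "{x. \<phi> x \<noteq> 0}"] by (auto simp: indicator_def)
    have "integrable lborel (\<lambda>x. (?I x * indicator ?C x) * \<phi> x)"
      by (rule integrable_mult_bounded[OF Ii[OF C] _ B]) simp
    then have i2: "integrable lborel (\<lambda>x. ?I x * \<phi> x)"
      by (simp only: mult.assoc ic)
    have i1: "integrable lborel (\<lambda>x. (u (\<theta> t x) - u x) * \<phi> x)"
      using i\<theta> ui B by (intro integrable_mult_bounded) auto
    have "(LINT x|lebesgue. (u (\<theta> t x) - u x - ?I x) * \<phi> x) = (LINT x|lborel. (u (\<theta> t x) - u x - ?I x) * \<phi> x)"
      by (rule integral_completion) measurable
    also have "\<dots> = (LINT x|lborel. (u (\<theta> t x) - u x) * \<phi> x - ?I x * \<phi> x)"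
      by (simp add: algebra_simps)
    also have "\<dots> = 0"
      using i1 i2 flow_test_identity[OF G t \<phi>] by simp
    finally show "(LINT x|lebesgue. (u (\<theta> t x) - u x - ?I x) * \<phi> x) = 0" .
  qed
  then have "AE x in lborel. x \<in> ?W \<longrightarrow> u (\<theta> t x) - u x - ?I x = 0"
    by (subst (asm) AE_completion_iff) 
  then show ?thesis by eventually_elim auto
qed

section \<open>Continuity of translations in L^1\<close>

lemma L1_translation_approx:
  fixes f :: "'a::euclidean_space \<Rightarrow> real"
  assumes f: "integrable lborel f"
    and ex: "\<And>\<epsilon>. \<epsilon> > 0 \<Longrightarrow> \<exists>g. integrable lborel g \<and> (LINT x|lborel. \<bar>f x - g x\<bar>) < \<epsilon> \<and>
      (\<lambda>n. LINT x|lborel. \<bar>g (x + h n) - g x\<bar>) \<longlonglongrightarrow> 0"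
  shows "(\<lambda>n. LINT x|lborel. \<bar>f (x + h n) - f x\<bar>) \<longlonglongrightarrow> 0"
proof (rule LIMSEQ_I)
  fix r :: real assume r: "r > 0"
  obtain g where g: "integrable lborel g" "(LINT x|lborel. \<bar>f x - g x\<bar>) < r / 3"
    and lim: "(\<lambda>n. LINT x|lborel. \<bar>g (x + h n) - g x\<bar>) \<longlonglongrightarrow> 0" using ex[of "r / 3"] r by auto
  obtain n0 where n0: "\<And>n. n \<ge> n0 \<Longrightarrow> \<bar>LINT x|lborel. \<bar>g (x + h n) - g x\<bar>\<bar> < r / 3"
    using LIMSEQ_D[OF lim, of "r / 3"] r by auto
  have "\<bar>LINT x|lborel. \<bar>f (x + h n) - f x\<bar>\<bar> < r" if "n \<ge> n0" for n
  proof -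
    have fh: "integrable lborel (\<lambda>x. f (x + h n))" and gh: "integrable lborel (\<lambda>x. g (x + h n))"
      using integrable_lborel_affine[OF f, of 1 "h n"] integrable_lborel_affine[OF g(1), of 1 "h n"] by auto
    have "(LINT x|lborel. \<bar>f (x + h n) - f x\<bar>) \<le>
        (LINT x|lborel. \<bar>f (x + h n) - g (x + h n)\<bar> + \<bar>g (x + h n) - g x\<bar> + \<bar>f x - g x\<bar>)"
      using f g(1) fh gh by (intro integral_mono) auto
    also have "\<dots> = (LINT x|lborel. \<bar>f (x + h n) - g (x + h n)\<bar>) + (LINT x|lborel. \<bar>g (x + h n) - g x\<bar>) + (LINT x|lborel. \<bar>f x - g x\<bar>)"
      using f g(1) fh gh by simp
    also have "(LINT x|lborel. \<bar>f (x + h n) - g (x + h n)\<bar>) = (LINT x|lborel. \<bar>f x - g x\<bar>)"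
      using integral_lborel_affine[of "\<lambda>x. \<bar>f x - g x\<bar>" 1 "h n"] f g(1) by simp
    finally show ?thesis using n0[OF that] g(2) by simp
  qed
  then show "\<exists>no. \<forall>n\<ge>no. norm ((LINT x|lborel. \<bar>f (x + h n) - f x\<bar>) - 0) < r" by auto
qed

text \<open>For x in U the shifted point is eventually in U as well. This one-sided information
  suffices: by translation invariance the symmetric difference has measure 2 |U| - 2 |U \<inter> (U
  - h)|, so points outside U, and the possibly large boundary, need not be followed.\<close>

lemma L1_translation_open:
  fixes U :: "'a::euclidean_space set"
  assumes U: "open U" "emeasure lborel U < \<infinity>" and h: "h \<longlonglongrightarrow> 0"
  shows "(\<lambda>n. LINT x|lborel. \<bar>indicator U (x + h n) - indicator U x :: real\<bar>) \<longlonglongrightarrow> 0"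
proof -
  have [measurable]: "U \<in> sets borel" using U by simp
  have i: "integrable lborel (indicator U :: _ \<Rightarrow> real)" using U by (simp add: integrable_indicator_iff)
  have ih: "integrable lborel (\<lambda>x. indicator U (x + h n) :: real)" for n
    using integrable_lborel_affine[OF i, of 1 "h n"] by simp
  have ip: "integrable lborel (\<lambda>x. indicator U x * indicator U (x + h n) :: real)" for n
    by (rule integrable_mult_bounded[OF i, where B=1]) (auto split: split_indicator)
  have "(\<lambda>n. LINT x|lborel. indicator U x * indicator U (x + h n) :: real) \<longlonglongrightarrow> (LINT x|lborel. indicator U x)"
  proof (rule integral_dominated_convergence[where w="indicator U"])
    show "AE x in lborel. (\<lambda>n. indicator U x * indicator U (x + h n) :: real) \<longlonglongrightarrow> indicator U x"
    proof (rule AE_I2)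
      fix x
      show "(\<lambda>n. indicator U x * indicator U (x + h n) :: real) \<longlonglongrightarrow> indicator U x"
      proof (cases "x \<in> U")
        case True
        have "(\<lambda>n. x + h n) \<longlonglongrightarrow> x" using tendsto_add[OF tendsto_const h] by simp
        then have "eventually (\<lambda>n. x + h n \<in> U) sequentially"
          using U(1) True topological_tendstoD by blast
        then have "eventually (\<lambda>n. 1 = (indicator U x * indicator U (x + h n) :: real)) sequentially"
          by eventually_elim (use True in auto)
        then show ?thesis using True by (auto intro: Lim_transform_eventually[OF tendsto_const])
      qed simp
    qed
  qed (use i in \<open>auto simp: indicator_def\<close>)
  then have "(\<lambda>n. 2 * (LINT x|lborel. indicator U x) - 2 * (LINT x|lborel. indicator U x * indicator U (x + h n))) \<longlonglongrightarrow>
      2 * (LINT x|lborel. indicator U x :: real) - 2 * (LINT x|lborel. indicator U x :: real)"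
    by (intro tendsto_intros)
  moreover have "(LINT x|lborel. \<bar>indicator U (x + h n) - indicator U x :: real\<bar>) =
      2 * (LINT x|lborel. indicator U x) - 2 * (LINT x|lborel. indicator U x * indicator U (x + h n))" for n
  proof -
    have "(LINT x|lborel. \<bar>indicator U (x + h n) - indicator U x :: real\<bar>) =
        (LINT x|lborel. indicator U (x + h n) + indicator U x - 2 * (indicator U x * indicator U (x + h n)))"
      by (intro Bochner_Integration.integral_cong) (auto simp: indicator_def)
    also have "\<dots> = (LINT x|lborel. indicator U (x + h n)) + (LINT x|lborel. indicator U x) -
        2 * (LINT x|lborel. indicator U x * indicator U (x + h n))"
      using i ih[of n] ip[of n] by simp
    also have "(LINT x|lborel. indicator U (x + h n)) = (LINT x|lborel. indicator U x :: real)"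
      using integral_lborel_affine[of "indicator U" 1 "h n"] by simp
    finally show ?thesis by simp
  qed
  ultimately show ?thesis by simp
qed

text \<open>Outer regularity reduces indicators of measurable sets to open sets; sums follow by the
  triangle inequality, and L^1 limits because translations are isometries, so that approximation
  errors do not grow.\<close>

lemma L1_translation:
  fixes f :: "'a::euclidean_space \<Rightarrow> real"
  assumes f: "integrable lborel f" and h: "h \<longlonglongrightarrow> 0"
  shows "(\<lambda>n. LINT x|lborel. \<bar>f (x + h n) - f x\<bar>) \<longlonglongrightarrow> 0"
  using f
proof (induction rule: integrable_induct)
  case (base A c)
  have [measurable]: "A \<in> sets borel" using base by simp
  have iA: "integrable lborel (indicator A :: _ \<Rightarrow> real)" using base by (simp add: integrable_indicator_iff)
  have "(\<lambda>n. LINT x|lborel. \<bar>indicator A (x + h n) - indicator A x :: real\<bar>) \<longlonglongrightarrow> 0"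
  proof (rule L1_translation_approx[OF iA])
    fix \<epsilon> :: real assume \<epsilon>: "\<epsilon> > 0"
    obtain U where U: "open U" "A \<subseteq> U" "emeasure lborel (U - A) < ennreal \<epsilon>"
      using outer_regular_lborel[of A \<epsilon>] \<epsilon> by auto
    have [measurable]: "U \<in> sets borel" using U by simp
    have "emeasure lborel U = emeasure lborel A + emeasure lborel (U - A)"
      using plus_emeasure[of A lborel "U - A"] U(2) by (simp add: Un_absorb1)
    then have Uf: "emeasure lborel U < \<infinity>"
      using base U(3) by (auto simp: less_top[symmetric] intro: less_trans)
    have "(LINT x|lborel. \<bar>indicator A x - indicator U x :: real\<bar>) = (LINT x|lborel. indicator (U - A) x)"
      using U(2) by (intro Bochner_Integration.integral_cong) (auto simp: indicator_def)
    also have "\<dots> < \<epsilon>"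
    proof -
      have "enn2real (emeasure lborel (U - A)) < \<epsilon>"
        using U(3) \<epsilon> by (cases "emeasure lborel (U - A)" rule: ennreal_cases) (auto simp: ennreal_less_iff)
      then show ?thesis by (simp add: measure_def)
    qed
    finally show "\<exists>g. integrable lborel g \<and> (LINT x|lborel. \<bar>indicator A x - g x\<bar>) < \<epsilon> \<and>
      (\<lambda>n. LINT x|lborel. \<bar>g (x + h n) - g x\<bar>) \<longlonglongrightarrow> 0"
      using L1_translation_open[OF U(1) Uf h] Uf by (intro exI[of _ "indicator U"]) (auto simp: integrable_indicator_iff)
  qed
  then have "(\<lambda>n. \<bar>c\<bar> * (LINT x|lborel. \<bar>indicator A (x + h n) - indicator A x :: real\<bar>)) \<longlonglongrightarrow> \<bar>c\<bar> * 0"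
    by (rule tendsto_mult_left)
  moreover have "\<bar>c\<bar> * (LINT x|lborel. \<bar>indicator A (x + h n) - indicator A x :: real\<bar>) =
      (LINT x|lborel. \<bar>indicator A (x + h n) *\<^sub>R c - indicator A x *\<^sub>R c\<bar>)" for n
    unfolding integral_mult_right_zero[symmetric]
    by (intro Bochner_Integration.integral_cong) (auto simp: indicator_def)
  ultimately show ?case by simp
next
  case (add f g)
  have "(\<lambda>n. (LINT x|lborel. \<bar>f (x + h n) - f x\<bar>) + (LINT x|lborel. \<bar>g (x + h n) - g x\<bar>)) \<longlonglongrightarrow> 0 + 0"
    using add by (intro tendsto_add)
  then have lim: "(\<lambda>n. (LINT x|lborel. \<bar>f (x + h n) - f x\<bar>) + (LINT x|lborel. \<bar>g (x + h n) - g x\<bar>)) \<longlonglongrightarrow> 0" by simp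
  show ?case
  proof (rule Lim_null_comparison[OF _ lim], rule always_eventually, rule allI)
    fix n
    have fh: "integrable lborel (\<lambda>x. f (x + h n))" and gh: "integrable lborel (\<lambda>x. g (x + h n))"
      using integrable_lborel_affine[OF add(1), of 1 "h n"] integrable_lborel_affine[OF add(2), of 1 "h n"] by auto
    have "(LINT x|lborel. \<bar>f (x + h n) + g (x + h n) - (f x + g x)\<bar>) \<le>
        (LINT x|lborel. \<bar>f (x + h n) - f x\<bar> + \<bar>g (x + h n) - g x\<bar>)"
      using add(1,2) fh gh by (intro integral_mono) auto
    then show "norm (LINT x|lborel. \<bar>f (x + h n) + g (x + h n) - (f x + g x)\<bar>) \<le>
        (LINT x|lborel. \<bar>f (x + h n) - f x\<bar>) + (LINT x|lborel. \<bar>g (x + h n) - g x\<bar>)"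
      using add(1,2) fh gh by simp
  qed
next
  case (lim f s)
  show ?case
  proof (rule L1_translation_approx[OF lim(4)])
    fix \<epsilon> :: real assume \<epsilon>: "\<epsilon> > 0"
    have "(\<lambda>i. LINT x|lborel. \<bar>f x - s i x\<bar>) \<longlonglongrightarrow> (LINT x|(lborel :: 'a measure). 0)"
    proof (rule integral_dominated_convergence[where w="\<lambda>x. 3 * \<bar>f x\<bar>"])
      show "AE x in lborel. (\<lambda>i. \<bar>f x - s i x\<bar>) \<longlonglongrightarrow> 0"
      proof (rule AE_I2)
        fix x :: 'a
        have "(\<lambda>i. \<bar>f x - s i x\<bar>) \<longlonglongrightarrow> \<bar>f x - f x\<bar>"
          using lim(2)[of x] by (intro tendsto_intros) auto
        then show "(\<lambda>i. \<bar>f x - s i x\<bar>) \<longlonglongrightarrow> 0" by simp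
      qed
      show "AE x in lborel. norm \<bar>f x - s i x\<bar> \<le> 3 * \<bar>f x\<bar>" for i
      proof (rule AE_I2)
        fix x :: 'a
        have "\<bar>s i x\<bar> \<le> 2 * \<bar>f x\<bar>" using lim(3)[of x i] by simp
        then show "norm \<bar>f x - s i x\<bar> \<le> 3 * \<bar>f x\<bar>" by simp
      qed
    qed (use lim in auto)
    then obtain i where "(LINT x|lborel. \<bar>f x - s i x\<bar>) < \<epsilon>"
      using LIMSEQ_D[of _ 0 \<epsilon>] \<epsilon> by fastforce
    then show "\<exists>g. integrable lborel g \<and> (LINT x|lborel. \<bar>f x - g x\<bar>) < \<epsilon> \<and>
      (\<lambda>n. LINT x|lborel. \<bar>g (x + h n) - g x\<bar>) \<longlonglongrightarrow> 0"
      using lim by blast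
  qed
qed

text \<open>Later a whole interval of shifts is averaged at once, so smallness along a single
  sequence would not be enough.\<close>

lemma L1_translation_uniform:
  fixes f :: "'a::euclidean_space \<Rightarrow> real"
  assumes f: "integrable lborel f" and \<epsilon>: "\<epsilon> > 0"
  obtains \<delta> where "\<delta> > 0" "\<And>h. norm h < \<delta> \<Longrightarrow> (LINT x|lborel. \<bar>f (x + h) - f x\<bar>) < \<epsilon>"
proof (rule ccontr)
  assume "\<not> thesis"
  then have "\<forall>\<delta>>0. \<exists>h. norm h < \<delta> \<and> \<not> (LINT x|lborel. \<bar>f (x + h) - f x\<bar>) < \<epsilon>"
    using that by blast
  then have "\<forall>n. \<exists>h. norm h < inverse (real (Suc n)) \<and> \<not> (LINT x|lborel. \<bar>f (x + h) - f x\<bar>) < \<epsilon>"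
    by simp
  then obtain h where h: "\<And>n. norm (h n) < inverse (real (Suc n))"
    "\<And>n. \<not> (LINT x|lborel. \<bar>f (x + h n) - f x\<bar>) < \<epsilon>" by metis
  have "h \<longlonglongrightarrow> 0"
    by (rule Lim_null_comparison[OF _ LIMSEQ_inverse_real_of_nat]) (use h(1) in \<open>auto intro: less_imp_le always_eventually\<close>)
  then have "(\<lambda>n. LINT x|lborel. \<bar>f (x + h n) - f x\<bar>) \<longlonglongrightarrow> 0" by (rule L1_translation[OF f])
  then show False using h(2) LIMSEQ_D[of _ 0 \<epsilon>] \<epsilon> by fastforce
qed

section \<open>The chain rule\<close>

text \<open>The value \<phi>' a at y = a keeps the factorization valid where both values coincide
  and makes the quotient continuous there; the mean value theorem gives the bound.\<close>

lemma difference_quotient_function: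
  fixes \<phi> :: "real \<Rightarrow> real"
  assumes d: "\<And>x. (\<phi> has_real_derivative \<phi>' x) (at x)" and M: "\<And>x. \<bar>\<phi>' x\<bar> \<le> M"
  defines "q a y \<equiv> if y = a then \<phi>' a else (\<phi> y - \<phi> a) / (y - a)"
  shows "\<phi> y - \<phi> a = q a y * (y - a)" and "\<bar>q a y\<bar> \<le> M" and "isCont (q a) a"
proof -
  show "\<phi> y - \<phi> a = q a y * (y - a)" by (simp add: q_def)
  show "\<bar>q a y\<bar> \<le> M"
  proof (cases "y = a")
    case False
    have "\<bar>\<phi> y - \<phi> a\<bar> \<le> M * \<bar>y - a\<bar>"
      using field_differentiable_bound[of UNIV \<phi> \<phi>' M y a] d M by (auto simp: has_field_derivative_at_within)
    then show ?thesis using False by (simp add: q_def abs_divide divide_le_eq)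
  qed (use M in \<open>simp add: q_def\<close>)
  have "((\<lambda>y. (\<phi> y - \<phi> a) / (y - a)) \<longlongrightarrow> \<phi>' a) (at a)"
    using d[of a] by (simp add: has_field_derivative_iff)
  then have "(q a \<longlongrightarrow> \<phi>' a) (at a)"
    by (rule Lim_transform_eventually) (auto simp: eventually_at_filter q_def)
  then show "isCont (q a) a" by (simp add: isCont_def q_def)
qed

lemma lipschitz_from_derivative:
  fixes \<phi> :: "real \<Rightarrow> real"
  assumes "\<And>x. (\<phi> has_real_derivative \<phi>' x) (at x)" "\<And>x. \<bar>\<phi>' x\<bar> \<le> M"
  shows "\<bar>\<phi> y - \<phi> a\<bar> \<le> M * \<bar>y - a\<bar>"
  using field_differentiable_bound[of UNIV \<phi> \<phi>' M y a] assms by (auto simp: has_field_derivative_at_within)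

lemma directional_derivative:
  assumes "\<psi> \<in> test_functions W"
  shows "((\<lambda>s. \<psi> (x + s *\<^sub>R b)) has_real_derivative frechet_derivative \<psi> (at (x + s *\<^sub>R b)) b) (at s)"
proof -
  have "((\<lambda>s. x + s *\<^sub>R b) has_derivative (\<lambda>h. h *\<^sub>R b)) (at s)"
    by (auto intro!: derivative_eq_intros)
  from has_derivative_compose[OF this test_functions_derivative[OF assms]]
  have "((\<lambda>s. \<psi> (x + s *\<^sub>R b)) has_derivative (\<lambda>h. frechet_derivative \<psi> (at (x + s *\<^sub>R b)) (h *\<^sub>R b))) (at s)" .
  moreover have "linear (frechet_derivative \<psi> (at (x + s *\<^sub>R b)))"
    using test_functions_derivative[OF assms] has_derivative_linear by blast
  then have "(\<lambda>h. frechet_derivative \<psi> (at (x + s *\<^sub>R b)) (h *\<^sub>R b)) = (*) (frechet_derivative \<psi> (at (x + s *\<^sub>R b)) b)"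
    by (simp add: fun_eq_iff linear_scale)
  ultimately show ?thesis
    by (simp only: has_field_derivative_def)
qed

text \<open>By the flow formula for translations the difference quotients \<open>D n\<close> of \<open>u\<close> converge to the weak derivative
  in \<open>L\<^sup>1\<close>, whereas the difference quotients \<open>q n\<close> of \<open>\<phi>\<close> stay bounded and converge almost everywhere along
  a subsequence; so their product converges weakly.\<close>

theorem borel_weak_gradient_chain:
  fixes \<Omega> :: "'a::euclidean_space set" and \<phi> \<phi>' :: "real \<Rightarrow> real"
  assumes G: "borel_weak_gradient \<Omega> u G" and \<Omega>: "open \<Omega>"
    and d: "\<And>x. (\<phi> has_real_derivative \<phi>' x) (at x)" and M: "\<And>x. \<bar>\<phi>' x\<bar> \<le> M"
    and c: "continuous_on UNIV \<phi>'" and \<phi>0: "\<phi> 0 = 0"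
  shows "borel_weak_gradient \<Omega> (\<lambda>x. \<phi> (u x)) (\<lambda>x. \<phi>' (u x) *\<^sub>R G x)"
proof -
  have ui: "integrable lborel u" and Gi: "integrable lborel G"
    using G by (auto simp: borel_weak_gradient_def)
  have [measurable]: "u \<in> borel_measurable borel" "G \<in> borel_measurable borel" using ui Gi by auto
  have [measurable]: "\<phi>' \<in> borel_measurable borel" using c by (rule borel_measurable_continuous_onI)
  have "continuous_on UNIV \<phi>"
    using d DERIV_isCont by (auto simp: continuous_on_eq_continuous_at)
  then have [measurable]: "\<phi> \<in> borel_measurable borel" by (rule borel_measurable_continuous_onI)
  have M0: "M \<ge> 0" using M[of 0] by linarith
  have vi: "integrable lborel (\<lambda>x. \<phi> (u x))"
  proof (rule Bochner_Integration.integrable_bound[of lborel "\<lambda>x. M * u x"])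
    show "AE x in lborel. norm (\<phi> (u x)) \<le> norm (M * u x)"
      using lipschitz_from_derivative[OF d M, of _ 0] \<phi>0 M0 by (intro AE_I2) (simp add: abs_mult)
  qed (use ui in simp_all)
  have Gi': "integrable lborel (\<lambda>x. \<phi>' (u x) *\<^sub>R G x)"
  proof (rule Bochner_Integration.integrable_bound[of lborel "\<lambda>x. M *\<^sub>R G x"])
    show "AE x in lborel. norm (\<phi>' (u x) *\<^sub>R G x) \<le> norm (M *\<^sub>R G x)"
      using M M0 by (intro AE_I2) (simp add: mult_right_mono)
  qed (use Gi in simp_all)
  have "(LINT x|lborel. \<phi> (u x) * frechet_derivative \<psi> (at x) b) =
      - (LINT x|lborel. ((\<phi>' (u x) *\<^sub>R G x) \<bullet> b) * \<psi> x)"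
    if \<psi>: "\<psi> \<in> test_functions \<Omega>" and b: "b \<in> Basis" for \<psi> b
  proof -
    let ?Gb = "\<lambda>x. G x \<bullet> b"
    let ?K = "closure {x. \<psi> x \<noteq> 0}"
    have K: "compact ?K" "?K \<subseteq> \<Omega>" using test_functions_support[OF \<psi>] by auto
    have \<psi>K: "\<psi> x = 0" if "x \<notin> ?K" for x using that closure_subset[of "{x. \<psi> x \<noteq> 0}"] by auto
    have [measurable]: "\<psi> \<in> borel_measurable borel"
      using test_functions_continuous[OF \<psi>] by (rule borel_measurable_continuous_onI)
    have [measurable]: "(\<lambda>x. frechet_derivative \<psi> (at x) b) \<in> borel_measurable borel"
      using test_functions_deriv_continuous[OF \<psi>] by (rule borel_measurable_continuous_onI)
    obtain C where C: "C \<ge> 0" "\<And>x. \<bar>\<psi> x\<bar> \<le> C" using test_functions_bounded[OF \<psi>] by blast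
    obtain B where B: "B \<ge> 0" "\<And>x. \<bar>frechet_derivative \<psi> (at x) b\<bar> \<le> B"
      using test_functions_deriv_bounded[OF \<psi>] by blast
    have Gbi: "integrable lborel ?Gb" using Gi by simp
    \<comment> \<open>Shifts shorter than the distance from the support to the complement of
      \<Omega> keep the segments used below inside \<Omega>, as the flow formula requires.\<close>
    obtain \<delta> where \<delta>: "\<delta> > 0" "\<And>x y. x \<in> ?K \<Longrightarrow> y \<in> - \<Omega> \<Longrightarrow> \<delta> \<le> dist x y"
    proof -
      have "?K \<inter> - \<Omega> = {}" "closed (- \<Omega>)" using K(2) \<Omega> by (blast, simp add: closed_Compl)
      then show ?thesis using separate_compact_closed[OF K(1), of "- \<Omega>"] that by blast
    qed
    define h where "h n = \<delta> / (2 * real (Suc n))" for n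
    have h: "h n > 0" "h n < \<delta>" for n
    proof -
      show "h n > 0" using \<delta>(1) by (simp add: h_def)
      have "\<delta> * 1 < \<delta> * (2 * real (Suc n))" using \<delta>(1) by (intro mult_strict_left_mono) auto
      then show "h n < \<delta>" by (simp add: h_def divide_less_eq)
    qed
    have h0: "h \<longlonglongrightarrow> 0"
    proof -
      have "(\<lambda>n. (\<delta> / 2) * inverse (real (Suc n))) \<longlonglongrightarrow> (\<delta> / 2) * 0"
        by (intro tendsto_intros LIMSEQ_inverse_real_of_nat)
      then show ?thesis by (simp add: h_def[abs_def] field_simps)
    qed
    have inK: "x + s *\<^sub>R b \<in> \<Omega>" if "x \<in> ?K" "0 \<le> s" "s \<le> h n" for x s n
    proof (rule ccontr)
      assume "x + s *\<^sub>R b \<notin> \<Omega>"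
      then have "\<delta> \<le> dist x (x + s *\<^sub>R b)" using \<delta>(2) that(1) by auto
      also have "\<dots> = s" using that b by (simp add: dist_norm)
      finally show False using h(2)[of n] that by simp
    qed
    interpret flow: affine_flow 0 b by unfold_locales simp
    have \<theta>: "flow.\<theta> s x = x + s *\<^sub>R b" and V: "flow.V x = b" for s x
      by (simp_all add: flow.\<theta>_def flow.\<sigma>_def flow.V_def)
    define D where "D n x = (u (x + h n *\<^sub>R b) - u x) / h n" for n x
    define q where "q n x = (if u (x + h n *\<^sub>R b) = u x then \<phi>' (u x)
      else (\<phi> (u (x + h n *\<^sub>R b)) - \<phi> (u x)) / (u (x + h n *\<^sub>R b) - u x))" for n x
    have q_eq: "(\<phi> (u (x + h n *\<^sub>R b)) - \<phi> (u x)) / h n = q n x * D n x" for n x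
      using difference_quotient_function(1)[OF d M, of "u (x + h n *\<^sub>R b)" "u x"]
      by (simp add: q_def D_def)
    have qM: "\<bar>q n x\<bar> \<le> M" for n x
      using difference_quotient_function(2)[OF d M, of "u (x + h n *\<^sub>R b)" "u x"] by (simp add: q_def)
    have [measurable]: "q n \<in> borel_measurable borel" for n unfolding q_def[abs_def] by measurable
    have uh: "integrable lborel (\<lambda>x. u (x + c))" for c
      using integrable_lborel_affine[OF ui, of 1 c] by simp
    have Di: "integrable lborel (D n)" for n unfolding D_def[abs_def] using ui uh by simp
    have [measurable]: "D n \<in> borel_measurable borel" for n using Di[of n] by auto
    \<comment> \<open>The difference quotient is first put on the smooth function \<psi>, where its
      limit is dominated; a shift of variables then moves it to the composition with u.\<close>
    have sumlim: "(\<lambda>n. LINT x|lborel. \<phi> (u x) * ((\<psi> x - \<psi> (x - h n *\<^sub>R b)) / h n)) \<longlonglongrightarrow>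
        (LINT x|lborel. \<phi> (u x) * frechet_derivative \<psi> (at x) b)"
    proof (rule integral_dominated_convergence[where w="\<lambda>x. B * \<bar>\<phi> (u x)\<bar>"])
      show "AE x in lborel. (\<lambda>n. \<phi> (u x) * ((\<psi> x - \<psi> (x - h n *\<^sub>R b)) / h n)) \<longlonglongrightarrow> \<phi> (u x) * frechet_derivative \<psi> (at x) b"
      proof (intro AE_I2 tendsto_mult tendsto_const)
        fix x
        have "((\<lambda>y. (\<psi> (x + y *\<^sub>R b) - \<psi> x) / y) \<longlongrightarrow> frechet_derivative \<psi> (at x) b) (at 0)"
          using directional_derivative[OF \<psi>, of x b 0] by (simp add: has_field_derivative_iff)
        moreover have "filterlim (\<lambda>n. - h n) (at 0) sequentially"
          using tendsto_minus[OF h0] h(1) by (auto simp: filterlim_at less_imp_neq[symmetric] intro!: always_eventually)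
        ultimately have "(\<lambda>n. (\<psi> (x + (- h n) *\<^sub>R b) - \<psi> x) / (- h n)) \<longlonglongrightarrow> frechet_derivative \<psi> (at x) b"
          by (rule filterlim_compose)
        then show "(\<lambda>n. (\<psi> x - \<psi> (x - h n *\<^sub>R b)) / h n) \<longlonglongrightarrow> frechet_derivative \<psi> (at x) b"
          by (simp add: minus_divide_left)
      qed
      show "AE x in lborel. norm (\<phi> (u x) * ((\<psi> x - \<psi> (x - h n *\<^sub>R b)) / h n)) \<le> B * \<bar>\<phi> (u x)\<bar>" for n
      proof (rule AE_I2)
        fix x
        have "\<bar>\<psi> (x + 0 *\<^sub>R b) - \<psi> (x + (- h n) *\<^sub>R b)\<bar> \<le> B * \<bar>0 - (- h n)\<bar>"
          by (rule lipschitz_from_derivative[OF directional_derivative[OF \<psi>] B(2)])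
        then have "\<bar>(\<psi> x - \<psi> (x - h n *\<^sub>R b)) / h n\<bar> \<le> B"
          using h(1)[of n] by (simp add: abs_divide divide_le_eq)
        then have "\<bar>\<phi> (u x)\<bar> * \<bar>(\<psi> x - \<psi> (x - h n *\<^sub>R b)) / h n\<bar> \<le> \<bar>\<phi> (u x)\<bar> * B"
          by (rule mult_left_mono) simp
        then show "norm (\<phi> (u x) * ((\<psi> x - \<psi> (x - h n *\<^sub>R b)) / h n)) \<le> B * \<bar>\<phi> (u x)\<bar>"
          by (simp only: real_norm_def abs_mult mult.commute)
      qed
    qed (use vi in auto)
    have parts: "(LINT x|lborel. \<phi> (u x) * ((\<psi> x - \<psi> (x - h n *\<^sub>R b)) / h n)) =
        - (LINT x|lborel. (q n x * D n x) * \<psi> x)" for n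
    proof -
      have i1: "integrable lborel (\<lambda>x. \<phi> (u x) * \<psi> x)"
        by (rule integrable_mult_bounded[OF vi _ C(2)]) simp
      have i2: "integrable lborel (\<lambda>x. \<phi> (u x) * \<psi> (x - h n *\<^sub>R b))"
        by (rule integrable_mult_bounded[OF vi _ C(2)]) simp
      have i3: "integrable lborel (\<lambda>x. \<phi> (u (x + h n *\<^sub>R b)) * \<psi> x)"
        using integrable_lborel_affine[OF i2, of 1 "h n *\<^sub>R b"] by simp
      have "(LINT x|lborel. \<phi> (u x) * ((\<psi> x - \<psi> (x - h n *\<^sub>R b)) / h n)) =
          (LINT x|lborel. (\<phi> (u x) * \<psi> x - \<phi> (u x) * \<psi> (x - h n *\<^sub>R b)) / h n)"
        by (simp add: algebra_simps)
      also have "\<dots> = ((LINT x|lborel. \<phi> (u x) * \<psi> x) - (LINT x|lborel. \<phi> (u x) * \<psi> (x - h n *\<^sub>R b))) / h n"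
        using i1 i2 by simp
      also have "(LINT x|lborel. \<phi> (u x) * \<psi> (x - h n *\<^sub>R b)) = (LINT x|lborel. \<phi> (u (x + h n *\<^sub>R b)) * \<psi> x)"
        using integral_lborel_affine[of "\<lambda>x. \<phi> (u x) * \<psi> (x - h n *\<^sub>R b)" 1 "h n *\<^sub>R b"] by simp
      also have "((LINT x|lborel. \<phi> (u x) * \<psi> x) - (LINT x|lborel. \<phi> (u (x + h n *\<^sub>R b)) * \<psi> x)) / h n =
          (LINT x|lborel. (\<phi> (u x) * \<psi> x - \<phi> (u (x + h n *\<^sub>R b)) * \<psi> x) / h n)"
        using i1 i3 by simp
      also have "\<dots> = (LINT x|lborel. - ((q n x * D n x) * \<psi> x))"
        unfolding q_eq[symmetric] by (intro Bochner_Integration.integral_cong) (simp_all add: divide_simps algebra_simps)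
      finally show ?thesis by simp
    qed
    \<comment> \<open>By the flow formula, \<open>D n\<close> minus the weak derivative is the mean
      over 0 \<le> s \<le> h n of differences between the derivative and its translates, which are
      uniformly small in L^1.\<close>
    have Dlim: "(\<lambda>n. LINT x|lborel. \<bar>D n x - ?Gb x\<bar> * \<bar>\<psi> x\<bar>) \<longlonglongrightarrow> 0"
    proof (rule LIMSEQ_I)
      fix r :: real assume r: "r > 0"
      \<comment> \<open>The bound C on \<psi> may be 0, hence the denominator C + 1.\<close>
      obtain \<eta> where \<eta>: "\<eta> > 0" "\<And>k. norm k < \<eta> \<Longrightarrow> (LINT x|lborel. \<bar>?Gb (x + k) - ?Gb x\<bar>) < r / (C + 1)"
        using L1_translation_uniform[OF Gbi, of "r / (C + 1)"] r C(1) by auto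
      obtain n0 where n0: "\<And>n. n \<ge> n0 \<Longrightarrow> h n < \<eta>"
        using LIMSEQ_D[OF h0 \<eta>(1)] h(1) by (auto simp: abs_of_pos)
      have "(LINT x|lborel. \<bar>D n x - ?Gb x\<bar> * \<bar>\<psi> x\<bar>) < r" if n: "n \<ge> n0" for n
      proof -
        let ?F = "\<lambda>s x. indicator {0..h n} s * \<bar>?Gb (x + s *\<^sub>R b) - ?Gb x\<bar>"
        have fl: "integrable (lborel \<Otimes>\<^sub>M lborel) (\<lambda>(s, x). indicator {0..h n} s * ?Gb (x + s *\<^sub>R b))"
          using flow.flow_integrable[OF Gi less_imp_le[OF h(1)], of "\<lambda>_. 1" "norm b" n] by (simp add: \<theta> V)
        have fl0: "integrable (lborel \<Otimes>\<^sub>M lborel) (\<lambda>(s, x). indicator {0..h n} s * ?Gb x)"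
        proof (rule lborel_pair.Fubini_integrable)
          show "integrable lborel (\<lambda>s. LINT x|lborel. norm (case (s, x) of (s, x) \<Rightarrow> indicator {0..h n} s * ?Gb x))"
            using h(1)[of n] by (simp add: abs_mult integrable_indicator_iff)
          show "AE s in lborel. integrable lborel (\<lambda>x. case (s, x) of (s, x) \<Rightarrow> indicator {0..h n} s * ?Gb x)"
            using Gbi by simp
        qed measurable
        have flF: "integrable (lborel \<Otimes>\<^sub>M lborel) (\<lambda>(s, x). ?F s x)"
        proof -
          have "integrable (lborel \<Otimes>\<^sub>M lborel) (\<lambda>z. \<bar>(case z of (s, x) \<Rightarrow> indicator {0..h n} s * ?Gb (x + s *\<^sub>R b)) -
             (case z of (s, x) \<Rightarrow> indicator {0..h n} s * ?Gb x)\<bar>)"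
            using fl fl0 by (intro integrable_abs Bochner_Integration.integrable_diff)
          moreover have "(\<lambda>z. \<bar>(case z of (s, x) \<Rightarrow> indicator {0..h n} s * ?Gb (x + s *\<^sub>R b)) -
             (case z of (s, x) \<Rightarrow> indicator {0..h n} s * ?Gb x)\<bar>) = (\<lambda>(s, x). ?F s x)"
            by (auto simp: fun_eq_iff indicator_def)
          ultimately show ?thesis by simp
        qed
        have form: "AE x in lborel. (\<forall>s\<in>{0..h n}. x + s *\<^sub>R b \<in> \<Omega>) \<longrightarrow>
            u (x + h n *\<^sub>R b) - u x = (LINT s|lborel. indicator {0..h n} s * ?Gb (x + s *\<^sub>R b))"
          using flow.flow_formula[OF G less_imp_le[OF h(1)] \<Omega>, of n] by (simp only: \<theta> V)
        have ai: "AE x in lborel. integrable lborel (\<lambda>s. indicator {0..h n} s * ?Gb (x + s *\<^sub>R b))"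
          using lborel_pair.AE_integrable_snd[OF fl] by simp
        have pt: "AE x in lborel. \<bar>D n x - ?Gb x\<bar> * \<bar>\<psi> x\<bar> \<le> (C / h n) * (LINT s|lborel. ?F s x)"
          using form ai
        proof eventually_elim
          case (elim x)
          have F0: "(LINT s|lborel. ?F s x) \<ge> 0" by (intro Bochner_Integration.integral_nonneg) simp
          show ?case
          proof (cases "x \<in> ?K")
            case True
            have ic: "integrable lborel (\<lambda>s. indicator {0..h n} s * ?Gb x)"
              using h(1)[of n] by (simp add: integrable_indicator_iff)
            have "D n x - ?Gb x = ((LINT s|lborel. indicator {0..h n} s * ?Gb (x + s *\<^sub>R b)) - (LINT s|lborel. indicator {0..h n} s * ?Gb x)) / h n"
              using elim(1) inK[OF True, of _ n] h(1)[of n] by (simp add: D_def diff_divide_distrib)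
            also have "\<dots> = (LINT s|lborel. indicator {0..h n} s * (?Gb (x + s *\<^sub>R b) - ?Gb x)) / h n"
              using elim(2) ic by (simp add: right_diff_distrib)
            finally have eq: "D n x - ?Gb x = (LINT s|lborel. indicator {0..h n} s * (?Gb (x + s *\<^sub>R b) - ?Gb x)) / h n" .
            have "\<bar>LINT s|lborel. indicator {0..h n} s * (?Gb (x + s *\<^sub>R b) - ?Gb x)\<bar> \<le> (LINT s|lborel. ?F s x)"
              using integral_norm_bound[of lborel "\<lambda>s. indicator {0..h n} s * (?Gb (x + s *\<^sub>R b) - ?Gb x)"]
              by (simp add: abs_mult)
            then have "\<bar>D n x - ?Gb x\<bar> \<le> (LINT s|lborel. ?F s x) / h n"
              unfolding eq using h(1)[of n] by (simp add: abs_divide divide_right_mono)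
            then have "\<bar>D n x - ?Gb x\<bar> * \<bar>\<psi> x\<bar> \<le> (LINT s|lborel. ?F s x) / h n * C"
              using C F0 h(1)[of n] by (intro mult_mono) auto
            then show ?thesis by (simp add: mult.commute)
          next
            case False
            have "0 \<le> C / h n * (LINT s|lborel. ?F s x)"
              by (intro mult_nonneg_nonneg F0) (use C h(1)[of n] in auto)
            then show ?thesis using \<psi>K[OF False] by simp
          qed
        qed
        have "(LINT x|lborel. \<bar>D n x - ?Gb x\<bar> * \<bar>\<psi> x\<bar>) \<le> (LINT x|lborel. (C / h n) * (LINT s|lborel. ?F s x))"
        proof (rule integral_mono_AE[OF _ _ pt])
          show "integrable lborel (\<lambda>x. \<bar>D n x - ?Gb x\<bar> * \<bar>\<psi> x\<bar>)"
            using Di Gbi C(2) by (intro integrable_mult_bounded) auto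
          show "integrable lborel (\<lambda>x. (C / h n) * (LINT s|lborel. ?F s x))"
            using lborel_pair.integrable_snd[OF flF] by simp
        qed
        also have "\<dots> = (C / h n) * (LINT x|lborel. LINT s|lborel. ?F s x)" by simp
        also have "(LINT x|lborel. LINT s|lborel. ?F s x) = (LINT s|lborel. LINT x|lborel. ?F s x)"
          using lborel_pair.Fubini_integral[OF flF] by simp
        also have "(LINT s|lborel. LINT x|lborel. ?F s x) \<le> (LINT s|lborel. indicator {0..h n} s * (r / (C + 1)))"
        proof (rule integral_mono)
          show "integrable lborel (\<lambda>s. LINT x|lborel. ?F s x)"
            using lborel_pair.integrable_fst[OF flF] by simp
          show "integrable lborel (\<lambda>s. indicator {0..h n} s * (r / (C + 1)))"
            using h(1)[of n] by (intro integrable_mult_left) (simp add: integrable_indicator_iff)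
          fix s :: real
          show "(LINT x|lborel. ?F s x) \<le> indicator {0..h n} s * (r / (C + 1))"
            using \<eta>(2)[of "s *\<^sub>R b"] n0[OF n] b by (cases "s \<in> {0..h n}") (auto intro: less_imp_le)
        qed
        also have "\<dots> = h n * (r / (C + 1))" using h(1)[of n] by simp
        finally have "(LINT x|lborel. \<bar>D n x - ?Gb x\<bar> * \<bar>\<psi> x\<bar>) \<le> (C / h n) * (h n * (r / (C + 1)))"
          using C(1) h(1)[of n] by (simp add: mult_left_mono divide_right_mono)
        also have "\<dots> = r * (C / (C + 1))" using h(1)[of n] by simp
        also have "\<dots> < r * 1" using r C(1) by (intro mult_strict_left_mono) auto
        finally show ?thesis by simp
      qed
      moreover have "(LINT x|lborel. \<bar>D n x - ?Gb x\<bar> * \<bar>\<psi> x\<bar>) \<ge> 0" for n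
        by (intro Bochner_Integration.integral_nonneg) simp
      ultimately show "\<exists>no. \<forall>n\<ge>no. norm ((LINT x|lborel. \<bar>D n x - ?Gb x\<bar> * \<bar>\<psi> x\<bar>) - 0) < r"
        by (auto simp: abs_of_nonneg)
    qed
    \<comment> \<open>L^1 convergence of the translates gives pointwise convergence only along a
      subsequence. That is enough, since the full sequence is already known to converge and only its
      limit has to be identified.\<close>
    obtain \<rho> where \<rho>: "strict_mono \<rho>" "AE x in lborel. (\<lambda>n. u (x + h (\<rho> n) *\<^sub>R b) - u x) \<longlonglongrightarrow> 0"
    proof -
      have "(\<lambda>n. h n *\<^sub>R b) \<longlonglongrightarrow> 0" using tendsto_scaleR[OF h0 tendsto_const[of b]] by simp
      from L1_translation[OF ui this]
      have "\<exists>r. strict_mono r \<and> (AE x in lborel. (\<lambda>n. u (x + h (r n) *\<^sub>R b) - u x) \<longlonglongrightarrow> 0)"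
        using ui uh by (intro tendsto_L1_AE_subseq) auto
      then show ?thesis using that by blast
    qed
    have iD: "integrable lborel (\<lambda>x. (D n x - ?Gb x) * \<psi> x)" for n
      using Di Gbi C(2) by (intro integrable_mult_bounded) auto
    have iG: "integrable lborel (\<lambda>x. ?Gb x * \<psi> x)"
      using Gbi C(2) by (intro integrable_mult_bounded) auto
    have iqD: "integrable lborel (\<lambda>x. (D n x - ?Gb x) * \<psi> x * q m x)" and iqG: "integrable lborel (\<lambda>x. ?Gb x * \<psi> x * q m x)" for n m
      by (rule integrable_mult_bounded[OF iD _ qM], simp) (rule integrable_mult_bounded[OF iG _ qM], simp)
    have lim1: "(\<lambda>n. LINT x|lborel. (D n x - ?Gb x) * \<psi> x * q n x) \<longlonglongrightarrow> 0"
    proof (rule Lim_null_comparison)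
      show "(\<lambda>n. M * (LINT x|lborel. \<bar>D n x - ?Gb x\<bar> * \<bar>\<psi> x\<bar>)) \<longlonglongrightarrow> 0"
        using tendsto_mult_left[OF Dlim, of M] by simp
      show "\<forall>\<^sub>F n in sequentially. norm (LINT x|lborel. (D n x - ?Gb x) * \<psi> x * q n x) \<le> M * (LINT x|lborel. \<bar>D n x - ?Gb x\<bar> * \<bar>\<psi> x\<bar>)"
      proof (rule always_eventually, rule allI)
        fix n
        have "norm (LINT x|lborel. (D n x - ?Gb x) * \<psi> x * q n x) \<le> (LINT x|lborel. norm ((D n x - ?Gb x) * \<psi> x * q n x))"
          by (rule integral_norm_bound)
        also have "\<dots> \<le> (LINT x|lborel. M * (\<bar>D n x - ?Gb x\<bar> * \<bar>\<psi> x\<bar>))"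
        proof (rule integral_mono)
          show "integrable lborel (\<lambda>x. norm ((D n x - ?Gb x) * \<psi> x * q n x))" using iqD by (rule integrable_norm)
          show "integrable lborel (\<lambda>x. M * (\<bar>D n x - ?Gb x\<bar> * \<bar>\<psi> x\<bar>))"
            using integrable_norm[OF iD[of n]] by (simp add: abs_mult)
          show "norm ((D n x - ?Gb x) * \<psi> x * q n x) \<le> M * (\<bar>D n x - ?Gb x\<bar> * \<bar>\<psi> x\<bar>)" for x
            using mult_left_mono[OF qM[of n x], of "\<bar>D n x - ?Gb x\<bar> * \<bar>\<psi> x\<bar>"] by (simp add: abs_mult mult.commute)
        qed
        finally show "norm (LINT x|lborel. (D n x - ?Gb x) * \<psi> x * q n x) \<le> M * (LINT x|lborel. \<bar>D n x - ?Gb x\<bar> * \<bar>\<psi> x\<bar>)" by simp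
      qed
    qed
    \<comment> \<open>Against a fixed integrable function the bounded quotients need nothing more
      than pointwise convergence.\<close>
    have lim2: "(\<lambda>n. LINT x|lborel. ?Gb x * \<psi> x * q (\<rho> n) x) \<longlonglongrightarrow> (LINT x|lborel. ?Gb x * \<psi> x * \<phi>' (u x))"
    proof (rule integral_dominated_convergence[where w="\<lambda>x. M * \<bar>?Gb x * \<psi> x\<bar>"])
      show "AE x in lborel. (\<lambda>n. ?Gb x * \<psi> x * q (\<rho> n) x) \<longlonglongrightarrow> ?Gb x * \<psi> x * \<phi>' (u x)"
        using \<rho>(2)
      proof eventually_elim
        case (elim x)
        have "(\<lambda>n. u (x + h (\<rho> n) *\<^sub>R b)) \<longlonglongrightarrow> u x" using Lim_transform[OF tendsto_const elim] by (simp add: LIM_zero_iff)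
        from isCont_tendsto_compose[OF difference_quotient_function(3)[OF d M, of "u x"] this]
        have "(\<lambda>n. q (\<rho> n) x) \<longlonglongrightarrow> \<phi>' (u x)" by (simp add: q_def)
        then show ?case by (intro tendsto_intros)
      qed
      show "AE x in lborel. norm (?Gb x * \<psi> x * q (\<rho> n) x) \<le> M * \<bar>?Gb x * \<psi> x\<bar>" for n
      proof (rule AE_I2)
        fix x
        show "norm (?Gb x * \<psi> x * q (\<rho> n) x) \<le> M * \<bar>?Gb x * \<psi> x\<bar>"
          using mult_left_mono[OF qM[of "\<rho> n" x], of "\<bar>?Gb x * \<psi> x\<bar>"] by (simp add: abs_mult mult.commute)
      qed
      show "integrable lborel (\<lambda>x. M * \<bar>?Gb x * \<psi> x\<bar>)" using iG by simp
    qed measurable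
    have "(\<lambda>n. - ((LINT x|lborel. (D (\<rho> n) x - ?Gb x) * \<psi> x * q (\<rho> n) x) + (LINT x|lborel. ?Gb x * \<psi> x * q (\<rho> n) x)))
        \<longlonglongrightarrow> - (0 + (LINT x|lborel. ?Gb x * \<psi> x * \<phi>' (u x)))"
      using LIMSEQ_subseq_LIMSEQ[OF lim1 \<rho>(1)] by (intro tendsto_intros lim2) (simp add: o_def)
    moreover have "- ((LINT x|lborel. (D n x - ?Gb x) * \<psi> x * q n x) + (LINT x|lborel. ?Gb x * \<psi> x * q n x)) =
        (LINT x|lborel. \<phi> (u x) * ((\<psi> x - \<psi> (x - h n *\<^sub>R b)) / h n))" for n
      unfolding parts Bochner_Integration.integral_add[OF iqD iqG, symmetric]
      by (simp add: algebra_simps)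
    ultimately have "(\<lambda>n. LINT x|lborel. \<phi> (u x) * ((\<psi> x - \<psi> (x - h (\<rho> n) *\<^sub>R b)) / h (\<rho> n)))
        \<longlonglongrightarrow> - (LINT x|lborel. ?Gb x * \<psi> x * \<phi>' (u x))" by simp
    moreover have "(\<lambda>n. LINT x|lborel. \<phi> (u x) * ((\<psi> x - \<psi> (x - h (\<rho> n) *\<^sub>R b)) / h (\<rho> n))) \<longlonglongrightarrow>
        (LINT x|lborel. \<phi> (u x) * frechet_derivative \<psi> (at x) b)"
      using LIMSEQ_subseq_LIMSEQ[OF sumlim \<rho>(1)] by (simp add: o_def)
    ultimately have "(LINT x|lborel. \<phi> (u x) * frechet_derivative \<psi> (at x) b) = - (LINT x|lborel. ?Gb x * \<psi> x * \<phi>' (u x))"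
      using LIMSEQ_unique by blast
    then show ?thesis by (simp add: mult_ac)
  qed
  then show ?thesis using vi Gi' unfolding borel_weak_gradient_def by blast
qed

section \<open>Weak gradients in Sobolev spaces\<close>

text \<open>Difference quotients have integral 0 by translation invariance, and their limit is
  dominated. The result serves to show that constants have weak gradient 0.\<close>

lemma integral_test_derivative_eq_0:
  fixes \<phi> :: "'a::euclidean_space \<Rightarrow> real"
  assumes \<phi>: "\<phi> \<in> test_functions W" and b: "b \<in> Basis"
  shows "(LINT x|lborel. frechet_derivative \<phi> (at x) b) = 0"
proof -
  let ?K = "closure {x. \<phi> x \<noteq> 0}"
  have K: "compact ?K" using test_functions_support[OF \<phi>] by auto
  obtain R where R: "?K \<subseteq> cball 0 R" using compact_imp_bounded[OF K] unfolding bounded_iff by (auto simp: subset_eq)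
  have \<phi>K: "\<phi> x = 0" if "x \<notin> ?K" for x using that closure_subset[of "{x. \<phi> x \<noteq> 0}"] by auto
  have [measurable]: "\<phi> \<in> borel_measurable borel"
    using test_functions_continuous[OF \<phi>] by (rule borel_measurable_continuous_onI)
  have [measurable]: "(\<lambda>x. frechet_derivative \<phi> (at x) b) \<in> borel_measurable borel"
    using test_functions_deriv_continuous[OF \<phi>] by (rule borel_measurable_continuous_onI)
  obtain C where C: "C \<ge> 0" "\<And>x. \<bar>\<phi> x\<bar> \<le> C" using test_functions_bounded[OF \<phi>] by blast
  obtain B where B: "B \<ge> 0" "\<And>x. \<bar>frechet_derivative \<phi> (at x) b\<bar> \<le> B"
    using test_functions_deriv_bounded[OF \<phi>] by blast
  have ball: "integrable lborel (\<lambda>x. indicator (cball (0::'a) r) x :: real)" for r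
    using emeasure_lborel_cball_finite[of 0 r] by (simp add: integrable_indicator_iff)
  have \<phi>i: "integrable lborel \<phi>"
  proof -
    have "integrable lborel (\<lambda>x. indicator (cball 0 R) x * \<phi> x)"
      by (rule integrable_mult_bounded[OF ball _ C(2)]) simp
    moreover have "indicator (cball 0 R) x * \<phi> x = \<phi> x" for x
    proof (cases "x \<in> cball 0 R")
      case False
      then have "x \<notin> ?K" using R by blast
      from \<phi>K[OF this] show ?thesis by simp
    qed simp
    ultimately show ?thesis by (simp only:)
  qed
  have sh: "integrable lborel (\<lambda>x. \<phi> (x + c))" for c
    using integrable_lborel_affine[OF \<phi>i, of 1 c] by simp
  have "(\<lambda>n. LINT x|lborel. (\<phi> (x + inverse (real (Suc n)) *\<^sub>R b) - \<phi> x) / inverse (real (Suc n))) \<longlonglongrightarrow>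
      (LINT x|lborel. frechet_derivative \<phi> (at x) b)"
  proof (rule integral_dominated_convergence[where w="\<lambda>x. indicator (cball 0 (R + 1)) x * B"])
    show "integrable lborel (\<lambda>x::'a. indicator (cball 0 (R + 1)) x * B)" using ball by simp
    show "AE x in lborel. (\<lambda>n. (\<phi> (x + inverse (real (Suc n)) *\<^sub>R b) - \<phi> x) / inverse (real (Suc n))) \<longlonglongrightarrow> frechet_derivative \<phi> (at x) b"
    proof (rule AE_I2)
      fix x
      have "((\<lambda>y. (\<phi> (x + y *\<^sub>R b) - \<phi> x) / y) \<longlongrightarrow> frechet_derivative \<phi> (at x) b) (at 0)"
        using directional_derivative[OF \<phi>, of x b 0] by (simp add: has_field_derivative_iff)
      moreover have "filterlim (\<lambda>n. inverse (real (Suc n))) (at 0) sequentially"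
        using LIMSEQ_inverse_real_of_nat by (auto simp: filterlim_at intro!: always_eventually)
      ultimately show "(\<lambda>n. (\<phi> (x + inverse (real (Suc n)) *\<^sub>R b) - \<phi> x) / inverse (real (Suc n))) \<longlonglongrightarrow> frechet_derivative \<phi> (at x) b"
        by (rule filterlim_compose)
    qed
    \<comment> \<open>The shifts have length at most 1, so all difference quotients vanish outside
      the ball of radius R + 1.\<close>
    show "AE x in lborel. norm ((\<phi> (x + inverse (real (Suc n)) *\<^sub>R b) - \<phi> x) / inverse (real (Suc n))) \<le> indicator (cball 0 (R + 1)) x * B" for n
    proof (rule AE_I2)
      fix x :: 'a
      let ?h = "inverse (real (Suc n))"
      have h: "0 < ?h" "?h \<le> 1" by (simp_all add: inverse_le_1_iff)
      show "norm ((\<phi> (x + ?h *\<^sub>R b) - \<phi> x) / ?h) \<le> indicator (cball 0 (R + 1)) x * B"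
      proof (cases "x \<in> cball 0 (R + 1)")
        case True
        have "\<bar>\<phi> (x + ?h *\<^sub>R b) - \<phi> (x + 0 *\<^sub>R b)\<bar> \<le> B * \<bar>?h - 0\<bar>"
          by (rule lipschitz_from_derivative[OF directional_derivative[OF \<phi>] B(2)])
        then have "\<bar>(\<phi> (x + ?h *\<^sub>R b) - \<phi> x) / ?h\<bar> \<le> B"
          using h by (simp only: abs_divide divide_le_eq) (simp del: of_nat_Suc)
        then show ?thesis using True by simp
      next
        case False
        have nb: "norm (?h *\<^sub>R b) \<le> 1"
          unfolding norm_scaleR norm_Basis[OF b] using h by (simp only: abs_of_pos mult_1_right)
        have "x \<notin> cball 0 R" using False by simp
        then have 1: "x \<notin> ?K" using R by blast
        have 2: "x + ?h *\<^sub>R b \<notin> ?K"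
        proof
          assume "x + ?h *\<^sub>R b \<in> ?K"
          then have "x + ?h *\<^sub>R b \<in> cball 0 R" using R by blast
          then have "norm (x + ?h *\<^sub>R b) \<le> R" by simp
          moreover have "norm x \<le> norm (x + ?h *\<^sub>R b) + norm (?h *\<^sub>R b)"
            using norm_triangle_ineq4[of "x + ?h *\<^sub>R b" "?h *\<^sub>R b"] by (simp only: add_diff_cancel)
          moreover have "norm x > R + 1" using False by simp
          ultimately show False using nb by linarith
        qed
        show ?thesis unfolding \<phi>K[OF 1] \<phi>K[OF 2] using False by (simp del: of_nat_Suc)
      qed
    qed
  qed simp_all
  moreover have "(LINT x|lborel. (\<phi> (x + c) - \<phi> x) / r) = 0" for c r
  proof -
    have "(LINT x|lborel. \<phi> (x + c)) = (LINT x|lborel. \<phi> x)"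
      using integral_lborel_affine[of \<phi> 1 c] by simp
    then show ?thesis using \<phi>i sh by simp
  qed
  ultimately have "(\<lambda>n. 0) \<longlonglongrightarrow> (LINT x|lborel. frechet_derivative \<phi> (at x) b)" by (simp only:)
  then show ?thesis by (rule LIMSEQ_unique[OF _ tendsto_const])
qed

lemma norm_powr_one_bound: "p \<ge> 1 \<Longrightarrow> t \<ge> 0 \<Longrightarrow> t \<le> 1 + t powr p" for t p :: real
proof (cases "t \<le> 1")
  case False
  assume "p \<ge> 1" "t \<ge> 0"
  then have "t powr 1 \<le> t powr p" using False by (intro powr_mono) auto
  then show ?thesis using False by simp
qed (use powr_ge_zero[of t p] in linarith)

lemma powr_add_bound:
  fixes a b p :: real
  assumes "a \<ge> 0" "b \<ge> 0" "p \<ge> 0"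
  shows "(a + b) powr p \<le> 2 powr p * (a powr p + b powr p)"
proof -
  have "(a + b) powr p \<le> (2 * max a b) powr p" using assms by (intro powr_mono2) auto
  also have "\<dots> = 2 powr p * max a b powr p" using assms by (simp add: powr_mult)
  also have "\<dots> \<le> 2 powr p * (a powr p + b powr p)" by (intro mult_left_mono) (auto simp: max_def)
  finally show ?thesis .
qed

section \<open>Lebesgue spaces on open sets and Borel representatives\<close>

lemma lebesgue_on_open_Int: "open \<Omega> \<Longrightarrow> \<Omega> \<inter> space lebesgue \<in> sets lebesgue"
  by auto

lemma measurable_lebesgue_on: "f \<in> borel_measurable borel \<Longrightarrow> f \<in> borel_measurable (lebesgue_on \<Omega>)"
  by (rule measurable_restrict_space1) (rule measurable_completion, simp)

lemma finite_measure_lebesgue_on: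
  fixes \<Omega> :: "'a::euclidean_space set"
  assumes "open \<Omega>" "bounded \<Omega>"
  shows "finite_measure (lebesgue_on \<Omega>)"
proof
  have "\<Omega> \<in> lmeasurable" using assms by (simp add: lmeasurable_open)
  then show "emeasure (lebesgue_on \<Omega>) (space (lebesgue_on \<Omega>)) \<noteq> \<infinity>"
    using assms by (auto simp: emeasure_restrict_space fmeasurable_def space_restrict_space)
qed

lemma Lp_space_imp_integrable:
  fixes f :: "'a::euclidean_space \<Rightarrow> 'b::euclidean_space"
  assumes \<Omega>: "open \<Omega>" "bounded \<Omega>" and p: "p \<ge> 1" and f: "f \<in> Lp_space p \<Omega>"
  shows "integrable (lebesgue_on \<Omega>) f"
proof -
  interpret finite_measure "lebesgue_on \<Omega>" by (rule finite_measure_lebesgue_on[OF \<Omega>])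
  show ?thesis
  proof (rule Bochner_Integration.integrable_bound[of _ "\<lambda>x. 1 + norm (f x) powr p"])
    show "integrable (lebesgue_on \<Omega>) (\<lambda>x. 1 + norm (f x) powr p)"
      using f by (auto simp: Lp_space_def)
    show "AE x in lebesgue_on \<Omega>. norm (f x) \<le> norm (1 + norm (f x) powr p)"
      using norm_powr_one_bound[OF p, of "norm (f _)"] by (auto intro!: AE_I2)
  qed (use f in \<open>auto simp: Lp_space_def\<close>)
qed

lemma Lp_space_1_iff: "f \<in> Lp_space 1 \<Omega> \<longleftrightarrow> integrable (lebesgue_on \<Omega>) f"
  for f :: "'a::euclidean_space \<Rightarrow> 'b::euclidean_space"
  by (auto simp: Lp_space_def integrable_norm_iff)

lemma Lp_norm_1: "Lp_norm 1 \<Omega> f = (LINT x|lebesgue_on \<Omega>. norm (f x))"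
  by (simp add: Lp_norm_def)

text \<open>Lebesgue measure is complete, so changing a function on a null set preserves
  measurability.\<close>

lemma AE_measurable_lebesgue_on:
  fixes f g :: "'a::euclidean_space \<Rightarrow> 'b::euclidean_space"
  assumes \<Omega>: "open \<Omega>" and f: "f \<in> borel_measurable (lebesgue_on \<Omega>)" and ae: "AE x in lebesgue_on \<Omega>. f x = g x"
  shows "g \<in> borel_measurable (lebesgue_on \<Omega>)"
proof -
  have "AE x in lebesgue. indicator \<Omega> x *\<^sub>R f x = indicator \<Omega> x *\<^sub>R g x"
    using ae unfolding AE_restrict_space_iff[OF lebesgue_on_open_Int[OF \<Omega>]]
    by eventually_elim (auto simp: indicator_def)
  then show ?thesis
    using f unfolding borel_measurable_restrict_space_iff[OF lebesgue_on_open_Int[OF \<Omega>]]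
    by (rule borel_measurable_AE[rotated])
qed

lemma Lp_space_cong_AE:
  fixes f g :: "'a::euclidean_space \<Rightarrow> 'b::euclidean_space"
  assumes \<Omega>: "open \<Omega>" and f: "f \<in> Lp_space p \<Omega>" and ae: "AE x in lebesgue_on \<Omega>. f x = g x"
  shows "g \<in> Lp_space p \<Omega>"
proof -
  have fm: "f \<in> borel_measurable (lebesgue_on \<Omega>)" and fi: "integrable (lebesgue_on \<Omega>) (\<lambda>x. norm (f x) powr p)"
    using f by (auto simp: Lp_space_def)
  have gm: "g \<in> borel_measurable (lebesgue_on \<Omega>)" by (rule AE_measurable_lebesgue_on[OF \<Omega> fm ae])
  have "integrable (lebesgue_on \<Omega>) (\<lambda>x. norm (g x) powr p)"
    by (rule integrable_cong_AE_imp[OF fi]) (use gm ae in auto)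
  then show ?thesis using gm by (simp add: Lp_space_def)
qed

text \<open>Multiplication with the indicator of \<Omega> turns f into a function integrable on the
  whole space, whose components then have Borel versions.\<close>

lemma borel_representative:
  fixes f :: "'a::euclidean_space \<Rightarrow> 'b::euclidean_space"
  assumes \<Omega>: "open \<Omega>" and f: "integrable (lebesgue_on \<Omega>) f"
  obtains g where "integrable lborel g" "AE x in lebesgue_on \<Omega>. f x = g x"
proof -
  have fi: "integrable lebesgue (\<lambda>x. indicator \<Omega> x *\<^sub>R f x)"
    using f unfolding integrable_restrict_space[OF lebesgue_on_open_Int[OF \<Omega>]] .
  have "\<exists>g\<in>borel_measurable lborel. AE x in lborel. (indicator \<Omega> x *\<^sub>R f x) \<bullet> b = g x" for b
    by (rule completion_ex_borel_measurable_real)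
      (rule borel_measurable_inner[OF borel_measurable_integrable[OF fi] borel_measurable_const])
  then obtain g where g: "\<And>b. g b \<in> borel_measurable lborel" "\<And>b. AE x in lborel. (indicator \<Omega> x *\<^sub>R f x) \<bullet> b = g b x"
    by metis
  define G where "G x = (\<Sum>b\<in>Basis. g b x *\<^sub>R b)" for x
  have Gm: "G \<in> borel_measurable lborel" unfolding G_def[abs_def] using g(1) by measurable
  have "AE x in lborel. \<forall>b\<in>Basis. (indicator \<Omega> x *\<^sub>R f x) \<bullet> b = g b x"
    by (rule AE_finite_allI) (use g(2) in auto)
  then have "AE x in lborel. indicator \<Omega> x *\<^sub>R f x = G x"
  proof eventually_elim
    case (elim x)
    then have "G x = (\<Sum>b\<in>Basis. ((indicator \<Omega> x *\<^sub>R f x) \<bullet> b) *\<^sub>R b)" by (simp add: G_def)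
    then show ?case by (simp only: euclidean_representation)
  qed
  then have ae: "AE x in lebesgue. indicator \<Omega> x *\<^sub>R f x = G x" by (rule AE_completion)
  have "integrable lebesgue G"
    by (rule integrable_cong_AE_imp[OF fi measurable_completion[OF Gm]]) (use ae in \<open>auto elim: eventually_mono\<close>)
  then have "integrable lborel G" using Gm by (simp add: integrable_completion)
  moreover have "AE x in lebesgue_on \<Omega>. f x = G x"
    unfolding AE_restrict_space_iff[OF lebesgue_on_open_Int[OF \<Omega>]]
    using ae by eventually_elim (auto simp: indicator_def)
  ultimately show ?thesis by (rule that)
qed

lemma integral_lebesgue_on_eq_lborel:
  fixes f f' g :: "'a::euclidean_space \<Rightarrow> real"
  assumes \<Omega>: "open \<Omega>" and f: "f \<in> borel_measurable (lebesgue_on \<Omega>)"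
    and [measurable]: "f' \<in> borel_measurable borel" "g \<in> borel_measurable borel"
    and ae: "AE x in lebesgue_on \<Omega>. f x = f' x" and g: "\<And>x. x \<notin> \<Omega> \<Longrightarrow> g x = 0"
  shows "(LINT x|lebesgue_on \<Omega>. f x * g x) = (LINT x|lborel. f' x * g x)"
proof -
  have "(LINT x|lebesgue_on \<Omega>. f x * g x) = (LINT x|lebesgue_on \<Omega>. f' x * g x)"
    using f ae measurable_lebesgue_on[of f'] measurable_lebesgue_on[of g]
    by (intro integral_cong_AE) (auto elim: eventually_mono)
  also have "\<dots> = (LINT x|lebesgue. indicator \<Omega> x *\<^sub>R (f' x * g x))"
    by (rule integral_restrict_space[OF lebesgue_on_open_Int[OF \<Omega>]])
  also have "\<dots> = (LINT x|lebesgue. f' x * g x)"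
    using g by (intro Bochner_Integration.integral_cong) (auto simp: indicator_def)
  also have "\<dots> = (LINT x|lborel. f' x * g x)"
    by (rule integral_completion) measurable
  finally show ?thesis .
qed

lemma test_functions_zero_outside:
  assumes "\<phi> \<in> test_functions W" "x \<notin> W"
  shows "\<phi> x = 0" "frechet_derivative \<phi> (at x) b = 0"
proof -
  have "x \<notin> closure {x. \<phi> x \<noteq> 0}" using assms test_functions_support by blast
  then show "\<phi> x = 0" "frechet_derivative \<phi> (at x) b = 0"
    using closure_subset[of "{x. \<phi> x \<noteq> 0}"] test_functions_deriv_zero[of x \<phi>] by auto
qed

lemma test_functions_borel:
  assumes "\<phi> \<in> test_functions W"
  shows "\<phi> \<in> borel_measurable borel" "(\<lambda>x. frechet_derivative \<phi> (at x) b) \<in> borel_measurable borel"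
  using test_functions_continuous[OF assms] test_functions_deriv_continuous[OF assms]
  by (auto intro: borel_measurable_continuous_onI)

lemma weak_gradient_test_iff:
  fixes u u' :: "'a::euclidean_space \<Rightarrow> real"
  assumes \<Omega>: "open \<Omega>"
    and u: "u \<in> borel_measurable (lebesgue_on \<Omega>)" "u' \<in> borel_measurable borel" "AE x in lebesgue_on \<Omega>. u x = u' x"
    and G: "G \<in> borel_measurable (lebesgue_on \<Omega>)" "G' \<in> borel_measurable borel" "AE x in lebesgue_on \<Omega>. G x = G' x"
    and \<phi>: "\<phi> \<in> test_functions \<Omega>"
  shows "(LINT x|lebesgue_on \<Omega>. u x * frechet_derivative \<phi> (at x) b) = (LINT x|lborel. u' x * frechet_derivative \<phi> (at x) b)"
    and "(LINT x|lebesgue_on \<Omega>. (G x \<bullet> b) * \<phi> x) = (LINT x|lborel. (G' x \<bullet> b) * \<phi> x)"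
  using u G test_functions_zero_outside[OF \<phi>] test_functions_borel[OF \<phi>]
  by (auto intro!: integral_lebesgue_on_eq_lborel[OF \<Omega>] elim: eventually_mono)

lemma has_weak_gradientI:
  fixes u u' :: "'a::euclidean_space \<Rightarrow> real"
  assumes \<Omega>: "open \<Omega>" and B: "borel_weak_gradient \<Omega> u' G'"
    and u: "AE x in lebesgue_on \<Omega>. u x = u' x" and G: "AE x in lebesgue_on \<Omega>. G x = G' x"
  shows "has_weak_gradient \<Omega> u G"
proof -
  have u'i: "integrable lborel u'" and G'i: "integrable lborel G'"
    using B by (auto simp: borel_weak_gradient_def)
  have ri: "integrable (lebesgue_on \<Omega>) h" if "integrable lborel h" for h :: "'a \<Rightarrow> 'c::euclidean_space"
  proof -
    have "integrable lebesgue h" using that by (subst integrable_completion) auto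
    then have "integrable lebesgue (\<lambda>x. indicator \<Omega> x *\<^sub>R h x)"
      using \<Omega> by (intro integrable_mult_indicator) auto
    then show ?thesis unfolding integrable_restrict_space[OF lebesgue_on_open_Int[OF \<Omega>]] .
  qed
  have u_sym: "AE x in lebesgue_on \<Omega>. u' x = u x" using u by eventually_elim simp
  have G_sym: "AE x in lebesgue_on \<Omega>. G' x = G x" using G by eventually_elim simp
  have um: "u \<in> borel_measurable (lebesgue_on \<Omega>)"
    by (rule AE_measurable_lebesgue_on[OF \<Omega> borel_measurable_integrable[OF ri[OF u'i]] u_sym])
  have Gm: "G \<in> borel_measurable (lebesgue_on \<Omega>)"
    by (rule AE_measurable_lebesgue_on[OF \<Omega> borel_measurable_integrable[OF ri[OF G'i]] G_sym])
  have si: "set_integrable lebesgue C f" if "compact C" "C \<subseteq> \<Omega>" "integrable lborel h" "AE x in lebesgue_on \<Omega>. h x = f x"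
      "f \<in> borel_measurable (lebesgue_on \<Omega>)" for C and f h :: "'a \<Rightarrow> 'c::euclidean_space"
  proof -
    have "integrable (lebesgue_on \<Omega>) f"
      by (rule integrable_cong_AE_imp[OF ri[OF that(3)] that(5)]) (use that(4) in eventually_elim, simp)
    then have "set_integrable lebesgue \<Omega> f"
      unfolding integrable_restrict_space[OF lebesgue_on_open_Int[OF \<Omega>]] set_integrable_def .
    moreover have "C \<in> sets lebesgue" using that(1) by (simp add: compact_imp_closed)
    ultimately show ?thesis
      using that(2) by (rule set_integrable_subset)
  qed
  have u'm: "u' \<in> borel_measurable borel" "G' \<in> borel_measurable borel" using u'i G'i by auto
  show ?thesis
    unfolding has_weak_gradient_def
  proof (intro conjI allI impI ballI)
    fix C :: "'a set" assume C: "compact C \<and> C \<subseteq> \<Omega>"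
    show "set_integrable lebesgue C u" using C by (intro si[OF _ _ u'i u_sym um]) auto
    show "set_integrable lebesgue C G" using C by (intro si[OF _ _ G'i G_sym Gm]) auto
  next
    fix \<phi> b assume \<phi>: "\<phi> \<in> test_functions \<Omega>" and b: "b \<in> (Basis :: 'a set)"
    show "(LINT x|lebesgue_on \<Omega>. u x * frechet_derivative \<phi> (at x) b) = - (LINT x|lebesgue_on \<Omega>. (G x \<bullet> b) * \<phi> x)"
      unfolding weak_gradient_test_iff[OF \<Omega> um u'm(1) u Gm u'm(2) G \<phi>]
      using B \<phi> b by (simp add: borel_weak_gradient_def)
  qed
qed

text \<open>Each component of the difference integrates to 0 against every test function, so the
  fundamental lemma applies.\<close>

lemma weak_gradient_unique:
  fixes u :: "'a::euclidean_space \<Rightarrow> real"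
  assumes \<Omega>: "open \<Omega>" and G1: "has_weak_gradient \<Omega> u G1" and G2: "has_weak_gradient \<Omega> u G2"
  shows "AE x in lebesgue_on \<Omega>. G1 x = G2 x"
proof -
  have si: "set_integrable lebesgue C (\<lambda>x. G1 x \<bullet> b)" "set_integrable lebesgue C (\<lambda>x. G2 x \<bullet> b)"
    if "compact C" "C \<subseteq> \<Omega>" for C b
    using that G1 G2 unfolding has_weak_gradient_def set_integrable_def
    by (auto simp flip: inner_scaleR_left)
  have "AE x in lebesgue. x \<in> \<Omega> \<longrightarrow> (G1 x - G2 x) \<bullet> b = 0" if b: "b \<in> Basis" for b
  proof (rule fundamental_lemma_lebesgue[OF \<Omega>])
    show "set_integrable lebesgue C (\<lambda>x. (G1 x - G2 x) \<bullet> b)" if "compact C" "C \<subseteq> \<Omega>" for C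
      unfolding inner_diff_left by (rule set_integral_diff(1)[OF si[OF that]])
    fix \<phi> assume \<phi>: "\<phi> \<in> test_functions \<Omega>"
    let ?K = "closure {x. \<phi> x \<noteq> 0}"
    have K: "compact ?K" "?K \<subseteq> \<Omega>" using test_functions_support[OF \<phi>] by auto
    obtain B where B: "\<And>x. \<bar>\<phi> x\<bar> \<le> B" using test_functions_bounded[OF \<phi>] by metis
    have \<phi>m: "\<phi> \<in> borel_measurable lebesgue"
      using test_functions_borel(1)[OF \<phi>] by (intro measurable_completion) simp
    have eq: "indicator ?K x *\<^sub>R r * \<phi> x = r * \<phi> x" for r x
      using closure_subset[of "{x. \<phi> x \<noteq> 0}"] by (auto simp: indicator_def)
    have eq2: "indicator \<Omega> x *\<^sub>R (r * \<phi> x) = r * \<phi> x" for r x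
      using test_functions_zero_outside(1)[OF \<phi>] by (auto simp: indicator_def)
    have i: "integrable lebesgue (\<lambda>x. (G1 x \<bullet> b) * \<phi> x)" "integrable lebesgue (\<lambda>x. (G2 x \<bullet> b) * \<phi> x)"
      using integrable_mult_bounded[OF si(1)[OF K, of b, unfolded set_integrable_def] \<phi>m B]
        integrable_mult_bounded[OF si(2)[OF K, of b, unfolded set_integrable_def] \<phi>m B]
      by (simp_all only: eq)
    have "(LINT x|lebesgue_on \<Omega>. (G1 x \<bullet> b) * \<phi> x) = (LINT x|lebesgue_on \<Omega>. (G2 x \<bullet> b) * \<phi> x)"
    proof -
      have "(LINT x|lebesgue_on \<Omega>. u x * frechet_derivative \<phi> (at x) b) = - (LINT x|lebesgue_on \<Omega>. (G1 x \<bullet> b) * \<phi> x)"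
        by (rule conjunct2[OF G1[unfolded has_weak_gradient_def], rule_format, OF \<phi> b])
      moreover have "(LINT x|lebesgue_on \<Omega>. u x * frechet_derivative \<phi> (at x) b) = - (LINT x|lebesgue_on \<Omega>. (G2 x \<bullet> b) * \<phi> x)"
        by (rule conjunct2[OF G2[unfolded has_weak_gradient_def], rule_format, OF \<phi> b])
      ultimately show ?thesis by simp
    qed
    then have "(LINT x|lebesgue. (G1 x \<bullet> b) * \<phi> x) = (LINT x|lebesgue. (G2 x \<bullet> b) * \<phi> x)"
      unfolding integral_restrict_space[OF lebesgue_on_open_Int[OF \<Omega>]] eq2 .
    then show "(LINT x|lebesgue. ((G1 x - G2 x) \<bullet> b) * \<phi> x) = 0"
      using i by (simp add: inner_diff_left left_diff_distrib)
  qed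
  then have "AE x in lebesgue. \<forall>b\<in>Basis. x \<in> \<Omega> \<longrightarrow> (G1 x - G2 x) \<bullet> b = 0"
    by (intro AE_finite_allI) auto
  then have "AE x in lebesgue. x \<in> \<Omega> \<longrightarrow> G1 x = G2 x"
    by eventually_elim (simp add: euclidean_eq_iff[of "G1 _"] inner_diff_left)
  then show ?thesis unfolding AE_restrict_space_iff[OF lebesgue_on_open_Int[OF \<Omega>]] .
qed

text \<open>Together with \<open>sobolev_spaceI\<close> this is the bridge between functions with a
  chosen weak gradient on \<Omega> and Borel functions on the whole space, for which the flow
  calculus is available.\<close>

lemma sobolev_representative:
  assumes \<Omega>: "open \<Omega>" "bounded \<Omega>" and p: "p \<ge> 1" and u: "u \<in> sobolev_space p \<Omega>"
  obtains u' G' where "borel_weak_gradient \<Omega> u' G'" "AE x in lebesgue_on \<Omega>. u x = u' x"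
    "AE x in lebesgue_on \<Omega>. weak_grad \<Omega> u x = G' x" "u' \<in> Lp_space p \<Omega>" "G' \<in> Lp_space p \<Omega>"
proof -
  have uL: "u \<in> Lp_space p \<Omega>" and GL: "weak_grad \<Omega> u \<in> Lp_space p \<Omega>" and ex: "\<exists>G. has_weak_gradient \<Omega> u G"
    using u by (auto simp: sobolev_space_def)
  have wg: "has_weak_gradient \<Omega> u (weak_grad \<Omega> u)"
    unfolding weak_grad_def using ex by (rule someI_ex)
  obtain u' where u': "integrable lborel u'" "AE x in lebesgue_on \<Omega>. u x = u' x"
    using borel_representative[OF \<Omega>(1) Lp_space_imp_integrable[OF \<Omega> p uL]] by metis
  obtain G' where G': "integrable lborel G'" "AE x in lebesgue_on \<Omega>. weak_grad \<Omega> u x = G' x"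
    using borel_representative[OF \<Omega>(1) Lp_space_imp_integrable[OF \<Omega> p GL]] by metis
  have "borel_weak_gradient \<Omega> u' G'"
  proof -
    have "u \<in> borel_measurable (lebesgue_on \<Omega>)" "weak_grad \<Omega> u \<in> borel_measurable (lebesgue_on \<Omega>)"
      using uL GL by (auto simp: Lp_space_def)
    from weak_gradient_test_iff[OF \<Omega>(1) this(1) _ u'(2) this(2) _ G'(2)] u'(1) G'(1) wg
    show ?thesis by (auto simp: borel_weak_gradient_def has_weak_gradient_def)
  qed
  then show ?thesis
    using that u'(2) G'(2) Lp_space_cong_AE[OF \<Omega>(1) uL u'(2)] Lp_space_cong_AE[OF \<Omega>(1) GL G'(2)] by blast
qed

lemma sobolev_spaceI:
  assumes \<Omega>: "open \<Omega>" and B: "borel_weak_gradient \<Omega> u' G'"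
    and u: "AE x in lebesgue_on \<Omega>. u x = u' x" and L: "u' \<in> Lp_space p \<Omega>" "G' \<in> Lp_space p \<Omega>"
  shows "u \<in> sobolev_space p \<Omega>" and "AE x in lebesgue_on \<Omega>. weak_grad \<Omega> u x = G' x"
proof -
  have G: "has_weak_gradient \<Omega> u G'" by (rule has_weak_gradientI[OF \<Omega> B u]) simp
  then have wg: "has_weak_gradient \<Omega> u (weak_grad \<Omega> u)"
    unfolding weak_grad_def by (rule someI[where P="has_weak_gradient \<Omega> u"])
  show ae: "AE x in lebesgue_on \<Omega>. weak_grad \<Omega> u x = G' x"
    by (rule weak_gradient_unique[OF \<Omega> wg G])
  have "u \<in> Lp_space p \<Omega>"
    by (rule Lp_space_cong_AE[OF \<Omega> L(1)]) (use u in \<open>auto elim: eventually_mono\<close>)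
  moreover have "weak_grad \<Omega> u \<in> Lp_space p \<Omega>"
    by (rule Lp_space_cong_AE[OF \<Omega> L(2)]) (use ae in \<open>auto elim: eventually_mono\<close>)
  ultimately show "u \<in> sobolev_space p \<Omega>" using G by (auto simp: sobolev_space_def)
qed

section \<open>Differences and compositions of Sobolev functions\<close>

lemma Lp_space_diff:
  fixes f g :: "'a::euclidean_space \<Rightarrow> 'b::euclidean_space"
  assumes "f \<in> Lp_space p \<Omega>" "g \<in> Lp_space p \<Omega>" "p \<ge> 0"
  shows "(\<lambda>x. f x - g x) \<in> Lp_space p \<Omega>"
proof -
  have [measurable]: "f \<in> borel_measurable (lebesgue_on \<Omega>)" "g \<in> borel_measurable (lebesgue_on \<Omega>)"
    using assms by (auto simp: Lp_space_def)
  have "integrable (lebesgue_on \<Omega>) (\<lambda>x. norm (f x - g x) powr p)"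
  proof (rule Bochner_Integration.integrable_bound)
    show "integrable (lebesgue_on \<Omega>) (\<lambda>x. 2 powr p * (norm (f x) powr p + norm (g x) powr p))"
      using assms by (auto simp: Lp_space_def)
    show "AE x in lebesgue_on \<Omega>. norm (norm (f x - g x) powr p) \<le> norm (2 powr p * (norm (f x) powr p + norm (g x) powr p))"
    proof (rule AE_I2)
      fix x
      have "norm (f x - g x) powr p \<le> (norm (f x) + norm (g x)) powr p"
        using assms(3) by (intro powr_mono2 norm_triangle_ineq4) auto
      also have "\<dots> \<le> 2 powr p * (norm (f x) powr p + norm (g x) powr p)"
        using assms(3) by (intro powr_add_bound) auto
      finally show "norm (norm (f x - g x) powr p) \<le> norm (2 powr p * (norm (f x) powr p + norm (g x) powr p))"
        by (simp add: abs_of_nonneg)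
    qed
  qed measurable
  then show ?thesis by (auto simp: Lp_space_def)
qed

lemma Lp_space_bounded_multiple:
  fixes f g :: "'a::euclidean_space \<Rightarrow> 'b::euclidean_space"
  assumes f: "f \<in> Lp_space p \<Omega>" and g: "g \<in> borel_measurable (lebesgue_on \<Omega>)"
    and M: "\<And>x. norm (g x) \<le> M * norm (f x)" "M \<ge> 0" and p: "p \<ge> 0"
  shows "g \<in> Lp_space p \<Omega>"
proof -
  have "integrable (lebesgue_on \<Omega>) (\<lambda>x. norm (g x) powr p)"
  proof (rule Bochner_Integration.integrable_bound)
    show "integrable (lebesgue_on \<Omega>) (\<lambda>x. M powr p * norm (f x) powr p)"
      using f by (auto simp: Lp_space_def)
    show "AE x in lebesgue_on \<Omega>. norm (norm (g x) powr p) \<le> norm (M powr p * norm (f x) powr p)"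
      using M p by (intro AE_I2) (simp add: powr_mult[symmetric] powr_mono2)
  qed (use g in measurable)
  then show ?thesis using g by (simp add: Lp_space_def)
qed

lemma borel_weak_gradient_diff:
  assumes "borel_weak_gradient \<Omega> u G" "borel_weak_gradient \<Omega> v H"
  shows "borel_weak_gradient \<Omega> (\<lambda>x. u x - v x) (\<lambda>x. G x - H x)"
proof -
  have i: "integrable lborel u" "integrable lborel v" "integrable lborel G" "integrable lborel H"
    using assms by (auto simp: borel_weak_gradient_def)
  have "(LINT x|lborel. (u x - v x) * frechet_derivative \<phi> (at x) b) = - (LINT x|lborel. ((G x - H x) \<bullet> b) * \<phi> x)"
    if \<phi>: "\<phi> \<in> test_functions \<Omega>" and b: "b \<in> Basis" for \<phi> b
  proof -
    obtain B where B: "\<And>x. \<bar>\<phi> x\<bar> \<le> B" using test_functions_bounded[OF \<phi>] by metis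
    obtain C where C: "\<And>x. \<bar>frechet_derivative \<phi> (at x) b\<bar> \<le> C" using test_functions_deriv_bounded[OF \<phi>] by metis
    have m: "\<phi> \<in> borel_measurable lborel" "(\<lambda>x. frechet_derivative \<phi> (at x) b) \<in> borel_measurable lborel"
      using test_functions_borel[OF \<phi>] by auto
    have Gi: "integrable lborel (\<lambda>x. G x \<bullet> b)" "integrable lborel (\<lambda>x. H x \<bullet> b)" using i by auto
    show ?thesis
      using integrable_mult_bounded[OF i(1) m(2) C] integrable_mult_bounded[OF i(2) m(2) C]
        integrable_mult_bounded[OF Gi(1) m(1) B] integrable_mult_bounded[OF Gi(2) m(1) B] assms \<phi> b
      by (simp add: inner_diff_left left_diff_distrib borel_weak_gradient_def)
  qed
  then show ?thesis using i by (simp add: borel_weak_gradient_def)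
qed

lemma sobolev_space_diff:
  assumes \<Omega>: "open \<Omega>" "bounded \<Omega>" and p: "p \<ge> 1"
    and u: "u \<in> sobolev_space p \<Omega>" and v: "v \<in> sobolev_space p \<Omega>"
  shows "(\<lambda>x. u x - v x) \<in> sobolev_space p \<Omega>"
    and "AE x in lebesgue_on \<Omega>. weak_grad \<Omega> (\<lambda>x. u x - v x) x = weak_grad \<Omega> u x - weak_grad \<Omega> v x"
proof -
  obtain u' G' where u': "borel_weak_gradient \<Omega> u' G'" "AE x in lebesgue_on \<Omega>. u x = u' x"
    "AE x in lebesgue_on \<Omega>. weak_grad \<Omega> u x = G' x" "u' \<in> Lp_space p \<Omega>" "G' \<in> Lp_space p \<Omega>"
    by (rule sobolev_representative[OF \<Omega> p u])
  obtain v' H' where v': "borel_weak_gradient \<Omega> v' H'" "AE x in lebesgue_on \<Omega>. v x = v' x"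
    "AE x in lebesgue_on \<Omega>. weak_grad \<Omega> v x = H' x" "v' \<in> Lp_space p \<Omega>" "H' \<in> Lp_space p \<Omega>"
    by (rule sobolev_representative[OF \<Omega> p v])
  have ae: "AE x in lebesgue_on \<Omega>. u x - v x = u' x - v' x"
    using u'(2) v'(2) by eventually_elim simp
  have L: "(\<lambda>x. u' x - v' x) \<in> Lp_space p \<Omega>" "(\<lambda>x. G' x - H' x) \<in> Lp_space p \<Omega>"
    using u' v' p by (auto intro!: Lp_space_diff)
  note * = sobolev_spaceI[OF \<Omega>(1) borel_weak_gradient_diff[OF u'(1) v'(1)] ae L]
  show "(\<lambda>x. u x - v x) \<in> sobolev_space p \<Omega>" by (rule *(1))
  show "AE x in lebesgue_on \<Omega>. weak_grad \<Omega> (\<lambda>x. u x - v x) x = weak_grad \<Omega> u x - weak_grad \<Omega> v x"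
    using *(2) u'(3) v'(3) by eventually_elim simp
qed

lemma sobolev_space_chain:
  assumes \<Omega>: "open \<Omega>" "bounded \<Omega>" and p: "p \<ge> 1" and u: "u \<in> sobolev_space p \<Omega>"
    and d: "\<And>x. (\<phi> has_real_derivative \<phi>' x) (at x)" and M: "\<And>x. \<bar>\<phi>' x\<bar> \<le> M"
    and c: "continuous_on UNIV \<phi>'" and \<phi>0: "\<phi> 0 = 0"
  shows "(\<lambda>x. \<phi> (u x)) \<in> sobolev_space p \<Omega>"
    and "AE x in lebesgue_on \<Omega>. weak_grad \<Omega> (\<lambda>x. \<phi> (u x)) x = \<phi>' (u x) *\<^sub>R weak_grad \<Omega> u x"
proof -
  obtain u' G' where u': "borel_weak_gradient \<Omega> u' G'" "AE x in lebesgue_on \<Omega>. u x = u' x"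
    "AE x in lebesgue_on \<Omega>. weak_grad \<Omega> u x = G' x" "u' \<in> Lp_space p \<Omega>" "G' \<in> Lp_space p \<Omega>"
    by (rule sobolev_representative[OF \<Omega> p u])
  have M0: "M \<ge> 0" using M[of 0] by linarith
  have [measurable]: "\<phi>' \<in> borel_measurable borel" using c by (rule borel_measurable_continuous_onI)
  have "continuous_on UNIV \<phi>"
    using d DERIV_isCont by (auto simp: continuous_on_eq_continuous_at)
  then have [measurable]: "\<phi> \<in> borel_measurable borel" by (rule borel_measurable_continuous_onI)
  have [measurable]: "u' \<in> borel_measurable (lebesgue_on \<Omega>)" "G' \<in> borel_measurable (lebesgue_on \<Omega>)"
    using u' by (auto simp: Lp_space_def)
  have ae: "AE x in lebesgue_on \<Omega>. \<phi> (u x) = \<phi> (u' x)"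
    using u'(2) by eventually_elim simp
  have 1: "(\<lambda>x. \<phi> (u' x)) \<in> Lp_space p \<Omega>"
    using lipschitz_from_derivative[OF d M, of _ 0] \<phi>0 p M0
    by (intro Lp_space_bounded_multiple[OF u'(4), of _ M]) auto
  have 2: "(\<lambda>x. \<phi>' (u' x) *\<^sub>R G' x) \<in> Lp_space p \<Omega>"
    using p M M0
    by (intro Lp_space_bounded_multiple[OF u'(5), of _ M]) (auto intro: mult_right_mono)
  note * = sobolev_spaceI[OF \<Omega>(1) borel_weak_gradient_chain[OF u'(1) \<Omega>(1) d M c \<phi>0] ae 1 2]
  show "(\<lambda>x. \<phi> (u x)) \<in> sobolev_space p \<Omega>" by (rule *(1))
  show "AE x in lebesgue_on \<Omega>. weak_grad \<Omega> (\<lambda>x. \<phi> (u x)) x = \<phi>' (u x) *\<^sub>R weak_grad \<Omega> u x"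
    using *(2) u'(2,3) by eventually_elim simp
qed

lemma sobolev_space_mono_1:
  assumes \<Omega>: "open \<Omega>" "bounded \<Omega>" and p: "p \<ge> 1" and u: "u \<in> sobolev_space p \<Omega>"
  shows "u \<in> sobolev_space 1 \<Omega>"
  using u Lp_space_imp_integrable[OF \<Omega> p, of u] Lp_space_imp_integrable[OF \<Omega> p, of "weak_grad \<Omega> u"]
  by (auto simp: sobolev_space_def Lp_space_1_iff)

text \<open>Serves the positivity of the Sobolev constant. The representative is the indicator of
  \<Omega>, because a nonzero constant is not integrable on the whole space.\<close>

lemma const_sobolev_space:
  assumes \<Omega>: "open \<Omega>" "bounded \<Omega>"
  shows "(\<lambda>x. 1) \<in> sobolev_space 1 \<Omega>" and "AE x in lebesgue_on \<Omega>. weak_grad \<Omega> (\<lambda>x. 1) x = 0"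
proof -
  interpret finite_measure "lebesgue_on \<Omega>" by (rule finite_measure_lebesgue_on[OF \<Omega>])
  have fin: "emeasure lborel \<Omega> < \<infinity>"
    using emeasure_bounded_finite[OF \<Omega>(2)] .
  have ind: "indicator \<Omega> x * frechet_derivative \<phi> (at x) b = frechet_derivative \<phi> (at x) b"
    if "\<phi> \<in> test_functions \<Omega>" for \<phi> x b
    using test_functions_zero_outside(2)[OF that] by (auto simp: indicator_def)
  have B: "borel_weak_gradient \<Omega> (indicator \<Omega>) (\<lambda>x. 0)"
    unfolding borel_weak_gradient_def
  proof (intro conjI ballI)
    fix \<phi> :: "'a \<Rightarrow> real" and b :: 'a assume \<phi>: "\<phi> \<in> test_functions \<Omega>" "b \<in> Basis"
    show "(LINT x|lborel. indicator \<Omega> x * frechet_derivative \<phi> (at x) b) = - (LINT x|lborel. (0 \<bullet> b) * \<phi> x)"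
      unfolding ind[OF \<phi>(1)] integral_test_derivative_eq_0[OF \<phi>] by simp
  qed (use \<Omega> fin in \<open>auto simp: integrable_indicator_iff\<close>)
  have ae: "AE x in lebesgue_on \<Omega>. 1 = indicator \<Omega> x"
    by (intro AE_I2) (simp add: space_restrict_space)
  have ii: "(indicator \<Omega> :: _ \<Rightarrow> real) \<in> Lp_space 1 \<Omega>"
  proof (rule Lp_space_cong_AE[OF \<Omega>(1) _ ae])
    show "(\<lambda>x. 1::real) \<in> Lp_space 1 \<Omega>" by (simp add: Lp_space_1_iff)
  qed
  note * = sobolev_spaceI[OF \<Omega>(1) B ae ii]
  have "(\<lambda>x. 0::'a) \<in> Lp_space 1 \<Omega>" by (simp add: Lp_space_1_iff)
  then show "(\<lambda>x. 1) \<in> sobolev_space 1 \<Omega>" "AE x in lebesgue_on \<Omega>. weak_grad \<Omega> (\<lambda>x. 1) x = 0"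
    using * by auto
qed

section \<open>The radial Poincare inequality\<close>

lemma norm_radial_directions: "\<omega> \<in> radial_directions \<Omega> P \<Longrightarrow> norm \<omega> = 1"
  by (auto simp: radial_directions_def norm_sgn)

lemma sgn_in_radial_directions: "x \<in> \<Omega> \<Longrightarrow> x \<noteq> P \<Longrightarrow> sgn (x - P) \<in> radial_directions \<Omega> P"
  by (auto simp: radial_directions_def)

locale radial_domain =
  fixes \<Omega> :: "'a::euclidean_space set" and P :: 'a and K lo hi
  assumes radial: "radial_property \<Omega> P K lo hi"
    and open_\<Omega>: "open \<Omega>" and bounded_\<Omega>: "bounded \<Omega>" and nonempty_\<Omega>: "\<Omega> \<noteq> {}"
begin

lemma radial_facts:
  assumes "\<omega> \<in> radial_directions \<Omega> P"
  shows "1 \<le> K \<omega>" "0 \<le> lo \<omega> 1" "\<And>k. k \<in> {1..K \<omega>} \<Longrightarrow> lo \<omega> k \<le> hi \<omega> k"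
    "\<And>k. k \<in> {1..<K \<omega>} \<Longrightarrow> hi \<omega> k < lo \<omega> (k + 1)"
    "{P + r *\<^sub>R \<omega> | r. 0 \<le> r} \<inter> (frontier \<Omega> \<union> ({P} \<inter> \<Omega>)) =
          (\<Union>k\<in>{1..K \<omega>}. {P + hi \<omega> k *\<^sub>R \<omega>, P + lo \<omega> k *\<^sub>R \<omega>})"
  using radial assms unfolding radial_property_def by (blast, blast, blast, blast, blast)

lemma hi_less_lo:
  assumes \<omega>: "\<omega> \<in> radial_directions \<Omega> P" and "i \<in> {1..K \<omega>}" "j \<in> {1..K \<omega>}" "i < j"
  shows "hi \<omega> i < lo \<omega> j"
  using assms(4,3)
proof (induction j)
  case (Suc j)
  show ?case
  proof (cases "i = j")
    case True
    then show ?thesis using radial_facts(4)[OF \<omega>, of j] Suc assms(2) by simp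
  next
    case False
    then have "hi \<omega> i < lo \<omega> j" "j \<in> {1..K \<omega>}" using Suc assms(2) by auto
    then show ?thesis using radial_facts(3)[OF \<omega>, of j] radial_facts(4)[OF \<omega>, of j] Suc by fastforce
  qed
qed simp

lemma lo_nonneg:
  assumes \<omega>: "\<omega> \<in> radial_directions \<Omega> P" and k: "k \<in> {1..K \<omega>}"
  shows "0 \<le> lo \<omega> k"
proof (cases "k = 1")
  case False
  then have "hi \<omega> 1 < lo \<omega> k" using hi_less_lo[OF \<omega>, of 1 k] k by auto
  moreover have "lo \<omega> 1 \<le> hi \<omega> 1" using radial_facts(1,3)[OF \<omega>] by simp
  ultimately show ?thesis using radial_facts(2)[OF \<omega>] by linarith
qed (use radial_facts(2)[OF \<omega>] in simp)

lemma end_points: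
  assumes \<omega>: "\<omega> \<in> radial_directions \<Omega> P" and k: "k \<in> {1..K \<omega>}"
  shows "P + hi \<omega> k *\<^sub>R \<omega> \<in> frontier \<Omega> \<union> ({P} \<inter> \<Omega>)" "P + lo \<omega> k *\<^sub>R \<omega> \<in> frontier \<Omega> \<union> ({P} \<inter> \<Omega>)"
  using radial_facts(5)[OF \<omega>] k by blast+

text \<open>End points lie on the bounded frontier or coincide with P. This makes the supremum in
  \<open>radial_width\<close> one over a set bounded above; otherwise its value would be
  unspecified.\<close>

lemma hi_bounded: "\<exists>R. \<forall>\<omega>\<in>radial_directions \<Omega> P. \<forall>k\<in>{1..K \<omega>}. hi \<omega> k \<le> R"
proof -
  have "bounded (frontier \<Omega> \<union> {P})"
    using bounded_subset[OF bounded_closure[OF bounded_\<Omega>], of "frontier \<Omega>"] by (auto simp: frontier_def)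
  then obtain R where "\<forall>x\<in>frontier \<Omega> \<union> {P}. dist P x \<le> R"
    unfolding bounded_any_center[where a=P] by blast
  then have R: "norm (x - P) \<le> R" if "x \<in> frontier \<Omega> \<union> {P}" for x
    using that by (metis dist_commute dist_norm)
  have "hi \<omega> k \<le> R" if \<omega>: "\<omega> \<in> radial_directions \<Omega> P" and k: "k \<in> {1..K \<omega>}" for \<omega> k
  proof -
    have "P + hi \<omega> k *\<^sub>R \<omega> \<in> frontier \<Omega> \<union> {P}" using end_points(1)[OF \<omega> k] by blast
    from R[OF this] show ?thesis using norm_radial_directions[OF \<omega>] by simp
  qed
  then show ?thesis by blast
qed

lemma width_bound:
  assumes \<omega>: "\<omega> \<in> radial_directions \<Omega> P" and k: "k \<in> {1..K \<omega>}"
  shows "hi \<omega> k - lo \<omega> k \<le> radial_width \<Omega> P K lo hi"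
proof -
  let ?M = "\<lambda>\<omega>. Max ((\<lambda>k. hi \<omega> k - lo \<omega> k) ` {1..K \<omega>})"
  obtain R where R: "\<And>\<omega> k. \<omega> \<in> radial_directions \<Omega> P \<Longrightarrow> k \<in> {1..K \<omega>} \<Longrightarrow> hi \<omega> k \<le> R"
    using hi_bounded by blast
  have "bdd_above (?M ` radial_directions \<Omega> P)"
  proof (rule bdd_aboveI2[where M=R])
    fix \<omega> assume \<omega>: "\<omega> \<in> radial_directions \<Omega> P"
    have "{1..K \<omega>} \<noteq> {}" using radial_facts(1)[OF \<omega>] by simp
    moreover have "hi \<omega> k - lo \<omega> k \<le> R" if "k \<in> {1..K \<omega>}" for k
      using R[OF \<omega> that] lo_nonneg[OF \<omega> that] by linarith
    ultimately show "?M \<omega> \<le> R" by (subst Max_le_iff) auto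
  qed
  then have "?M \<omega> \<le> radial_width \<Omega> P K lo hi"
    unfolding radial_width_def by (rule cSUP_upper[OF \<omega>])
  moreover have "hi \<omega> k - lo \<omega> k \<le> ?M \<omega>" using k by (intro Max_ge) auto
  ultimately show ?thesis by linarith
qed

text \<open>A nonempty open set is not the single point P, so at least one direction exists and
  bounds the supremum from below.\<close>

lemma width_nonneg: "0 \<le> radial_width \<Omega> P K lo hi"
proof -
  have "\<exists>x\<in>\<Omega>. x \<noteq> P"
  proof (rule ccontr)
    assume "\<not> (\<exists>x\<in>\<Omega>. x \<noteq> P)"
    then have "\<Omega> = {P}" using nonempty_\<Omega> by auto
    then show False using open_\<Omega> not_open_singleton[of P] by simp
  qed
  then obtain x where x: "x \<in> \<Omega>" "x \<noteq> P" by blast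
  let ?w = "sgn (x - P)"
  have w: "?w \<in> radial_directions \<Omega> P" using sgn_in_radial_directions x by blast
  have "1 \<in> {1..K ?w}" using radial_facts(1)[OF w] by simp
  then show ?thesis using width_bound[OF w] radial_facts(3)[OF w] by (smt (verit))
qed

text \<open>A point of the open set \<Omega> other than P is no end point, so it lies strictly
  between the two ends of its pair. There the ray meets no boundary point, and by connectedness it
  cannot leave \<Omega> before the back end.\<close>

lemma radial_segment:
  assumes x: "x \<in> \<Omega>" "x \<noteq> P" and k: "k \<in> {1..K (sgn (x - P))}"
    and r: "lo (sgn (x - P)) k \<le> dist P x" "dist P x \<le> hi (sgn (x - P)) k"
  shows "dist P x < hi (sgn (x - P)) k"
    and "hi (sgn (x - P)) k - dist P x \<le> radial_width \<Omega> P K lo hi"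
    and "P + hi (sgn (x - P)) k *\<^sub>R sgn (x - P) \<in> back_contact_set \<Omega> P K lo"
    and "\<And>r. dist P x \<le> r \<Longrightarrow> r < hi (sgn (x - P)) k \<Longrightarrow> P + r *\<^sub>R sgn (x - P) \<in> \<Omega>"
proof -
  let ?\<omega> = "sgn (x - P)" and ?r = "dist P x"
  have \<omega>: "?\<omega> \<in> radial_directions \<Omega> P" using sgn_in_radial_directions x by blast
  have n\<omega>: "norm ?\<omega> = 1" using norm_radial_directions[OF \<omega>] .
  have xr: "x = P + ?r *\<^sub>R ?\<omega>" using x(2) by (simp add: sgn_div_norm dist_norm norm_minus_commute)
  have xF: "x \<notin> frontier \<Omega>" using x(1) open_\<Omega> by (simp add: frontier_def interior_open)
  have rpos: "?r > 0" using x(2) by simp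
  show hi: "?r < hi ?\<omega> k"
  proof (rule ccontr)
    assume "\<not> ?r < hi ?\<omega> k"
    then have "hi ?\<omega> k = ?r" using r by simp
    then have "x \<in> frontier \<Omega> \<union> ({P} \<inter> \<Omega>)" using end_points(1)[OF \<omega> k] xr by simp
    then show False using xF x(2) by blast
  qed
  have lo: "lo ?\<omega> k < ?r"
  proof (rule ccontr)
    assume "\<not> lo ?\<omega> k < ?r"
    then have "lo ?\<omega> k = ?r" using r by simp
    then have "x \<in> frontier \<Omega> \<union> ({P} \<inter> \<Omega>)" using end_points(2)[OF \<omega> k] xr by simp
    then show False using xF x(2) by blast
  qed
  show "hi ?\<omega> k - ?r \<le> radial_width \<Omega> P K lo hi" using width_bound[OF \<omega> k] lo by linarith
  \<comment> \<open>Every boundary point on the ray is an end of some pair, and the pairs are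
    strictly ordered, so none of them falls between the two ends of one pair.\<close>
  have no_point: "P + s *\<^sub>R ?\<omega> \<notin> frontier \<Omega>" if s: "lo ?\<omega> k < s" "s < hi ?\<omega> k" for s
  proof
    assume F: "P + s *\<^sub>R ?\<omega> \<in> frontier \<Omega>"
    have "s \<ge> 0" using s lo_nonneg[OF \<omega> k] by linarith
    then have "P + s *\<^sub>R ?\<omega> \<in> (\<Union>k\<in>{1..K ?\<omega>}. {P + hi ?\<omega> k *\<^sub>R ?\<omega>, P + lo ?\<omega> k *\<^sub>R ?\<omega>})"
      using F radial_facts(5)[OF \<omega>] by blast
    then obtain j where j: "j \<in> {1..K ?\<omega>}" "s = hi ?\<omega> j \<or> s = lo ?\<omega> j"
      using n\<omega> by fastforce
    consider "j = k" | "j < k" | "j > k" by linarith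
    then show False
    proof cases
      case 1 then show ?thesis using j s by auto
    next
      case 2
      then have "hi ?\<omega> j < lo ?\<omega> k" using hi_less_lo[OF \<omega> j(1) k] by simp
      then show ?thesis using j s radial_facts(3)[OF \<omega> j(1)] by linarith
    next
      case 3
      then have "hi ?\<omega> k < lo ?\<omega> j" using hi_less_lo[OF \<omega> k j(1)] by simp
      then show ?thesis using j s radial_facts(3)[OF \<omega> j(1)] by linarith
    qed
  qed
  show "P + s *\<^sub>R ?\<omega> \<in> \<Omega>" if s: "?r \<le> s" "s < hi ?\<omega> k" for s
  proof (rule ccontr)
    assume n: "P + s *\<^sub>R ?\<omega> \<notin> \<Omega>"
    let ?S = "(\<lambda>s. P + s *\<^sub>R ?\<omega>) ` {?r..s}"
    have "connected ?S"
      by (intro connected_continuous_image continuous_intros) auto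
    moreover have "?S \<inter> \<Omega> \<noteq> {}" using xr x(1) s(1) by force
    moreover have "?S - \<Omega> \<noteq> {}" using n s(1) by force
    ultimately have "?S \<inter> frontier \<Omega> \<noteq> {}" by (rule connected_Int_frontier)
    then obtain s' where "s' \<in> {?r..s}" "P + s' *\<^sub>R ?\<omega> \<in> frontier \<Omega>" by blast
    then show False using no_point[of s'] lo s by auto
  qed
  \<comment> \<open>The back end has positive distance from P, which leaves only the frontier among
    the two possibilities.\<close>
  have hF: "P + hi ?\<omega> k *\<^sub>R ?\<omega> \<in> frontier \<Omega>"
  proof -
    have "hi ?\<omega> k *\<^sub>R ?\<omega> \<noteq> 0" using hi rpos n\<omega> by (auto simp: sgn_zero_iff)
    then show ?thesis using end_points(1)[OF \<omega> k] by auto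
  qed
  moreover have "P + hi ?\<omega> k *\<^sub>R ?\<omega> \<in> radial_cone \<Omega> P"
  proof -
    have "0 < hi ?\<omega> k" using hi rpos by linarith
    then show ?thesis using \<omega> unfolding radial_cone_def by blast
  qed
  \<comment> \<open>The front contact set collects the front ends of all directions. Comparing
    lengths forces equal radii and hence the same direction, and then the order of the pairs
    excludes a coincidence.\<close>
  moreover have "P + hi ?\<omega> k *\<^sub>R ?\<omega> \<notin> front_contact_set \<Omega> P K lo"
  proof
    assume "P + hi ?\<omega> k *\<^sub>R ?\<omega> \<in> front_contact_set \<Omega> P K lo"
    then obtain \<omega>' j where w': "\<omega>' \<in> radial_directions \<Omega> P" "j \<in> {1..K \<omega>'}" "hi ?\<omega> k *\<^sub>R ?\<omega> = lo \<omega>' j *\<^sub>R \<omega>'"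
      unfolding front_contact_set_def by auto
    have "\<bar>hi ?\<omega> k\<bar> * norm ?\<omega> = \<bar>lo \<omega>' j\<bar> * norm \<omega>'" using w'(3) by (metis norm_scaleR)
    then have e: "hi ?\<omega> k = lo \<omega>' j"
      using n\<omega> norm_radial_directions[OF w'(1)] lo_nonneg[OF w'(1,2)] hi rpos by simp
    then have "?\<omega> = \<omega>'" using w'(3) hi rpos by simp
    then have j: "j \<in> {1..K ?\<omega>}" "hi ?\<omega> k = lo ?\<omega> j" using w' e by auto
    consider "j \<le> k" | "j > k" by linarith
    then show False
    proof cases
      case 1
      then have "lo ?\<omega> j \<le> lo ?\<omega> k"
        using hi_less_lo[OF \<omega> j(1) k] radial_facts(3)[OF \<omega> j(1)] by (cases "j = k") auto
      then show ?thesis using j lo hi by linarith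
    next
      case 2
      then show ?thesis using hi_less_lo[OF \<omega> k j(1)] j by simp
    qed
  qed
  ultimately show "P + hi ?\<omega> k *\<^sub>R ?\<omega> \<in> back_contact_set \<Omega> P K lo"
    by (simp add: back_contact_set_def)
qed

end

text \<open>The weight that the Jacobian of the dilations \<open>x \<mapsto> P + (1 + s) (x - P)\<close> leaves at distance \<open>R\<close> from \<open>P\<close>.\<close>

lemma nn_integral_dilation_weight:
  fixes R d :: real
  assumes R: "R \<ge> 0" and d: "d \<ge> 0"
  shows "(\<integral>\<^sup>+s. indicator {s. 0 \<le> s \<and> s * R \<le> d * (1 + s)} s * ennreal (R / (1 + s)\<^sup>2) \<partial>lborel) \<le> ennreal d"
proof (cases "R \<le> d")
  \<comment> \<open>For R \<le> d the constraint holds for all s \<ge> 0, and the full integral of R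
    / (1 + s)^2 is R \<le> d.\<close>
  case True
  have "(\<integral>\<^sup>+s. indicator {s. 0 \<le> s \<and> s * R \<le> d * (1 + s)} s * ennreal (R / (1 + s)\<^sup>2) \<partial>lborel) \<le>
      (\<integral>\<^sup>+s. ennreal (R / (1 + s)\<^sup>2) * indicator {0..} s \<partial>lborel)"
    by (intro nn_integral_mono) (auto simp: indicator_def)
  also have "\<dots> = ennreal (0 - (- R / (1 + 0)))"
  proof (rule nn_integral_FTC_atLeast)
    show "((\<lambda>s. - R / (1 + s)) \<longlongrightarrow> 0) at_top"
      by (intro tendsto_divide_0[OF tendsto_const] filterlim_at_top_imp_at_infinity
          filterlim_tendsto_add_at_top[OF tendsto_const filterlim_ident])
  qed (use R in \<open>auto intro!: derivative_eq_intros simp: power2_eq_square\<close>)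
  also have "\<dots> \<le> ennreal d" using True by (auto intro: ennreal_leI)
  finally show ?thesis .
next
  case False
  \<comment> \<open>The largest s that the constraint admits. It satisfies R - R / (1 + b) = d, so
    the constant d is attained.\<close>
  define b where "b = d / (R - d)"
  have b: "b \<ge> 0" "1 + b = R / (R - d)" using False d by (auto simp: b_def field_simps)
  have "(\<integral>\<^sup>+s. indicator {s. 0 \<le> s \<and> s * R \<le> d * (1 + s)} s * ennreal (R / (1 + s)\<^sup>2) \<partial>lborel) \<le>
      (\<integral>\<^sup>+s. ennreal (R / (1 + s)\<^sup>2) * indicator {0..b} s \<partial>lborel)"
  proof (rule nn_integral_mono)
    fix s :: real
    have "s \<le> b" if "s * R \<le> d * (1 + s)"
      using that False by (simp add: b_def le_divide_eq algebra_simps)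
    then show "indicator {s. 0 \<le> s \<and> s * R \<le> d * (1 + s)} s * ennreal (R / (1 + s)\<^sup>2) \<le> ennreal (R / (1 + s)\<^sup>2) * indicator {0..b} s"
      by (auto simp: indicator_def)
  qed
  also have "\<dots> = ennreal (- R / (1 + b) - (- R / (1 + 0)))"
    by (rule nn_integral_FTC_Icc)
      (use R b(1) in \<open>auto intro!: derivative_eq_intros simp: power2_eq_square\<close>)
  also have "- R / (1 + b) - (- R / (1 + 0)) = d"
    unfolding b(2) using False R d by simp
  finally show ?thesis by simp
qed

lemma AE_lebesgue_on_iff_lborel:
  assumes "open \<Omega>"
  shows "(AE x in lebesgue_on \<Omega>. Q x) \<longleftrightarrow> (AE x in lborel. x \<in> \<Omega> \<longrightarrow> Q x)"
  unfolding AE_restrict_space_iff[OF lebesgue_on_open_Int[OF assms]] AE_completion_iff ..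

lemma integral_abs_lebesgue_on:
  fixes f :: "'a::euclidean_space \<Rightarrow> 'b::euclidean_space"
  assumes \<Omega>: "open \<Omega>" and f: "f \<in> borel_measurable (lebesgue_on \<Omega>)"
    and f': "integrable lborel f'" and ae: "AE x in lebesgue_on \<Omega>. f x = f' x"
  shows "ennreal (LINT x|lebesgue_on \<Omega>. norm (f x)) = (\<integral>\<^sup>+x. indicator \<Omega> x * ennreal (norm (f' x)) \<partial>lborel)"
proof -
  have [measurable]: "f' \<in> borel_measurable borel" "\<Omega> \<in> sets borel" using f' \<Omega> by auto
  have "(LINT x|lebesgue_on \<Omega>. norm (f x)) = (LINT x|lebesgue_on \<Omega>. norm (f x) * indicator \<Omega> x)"
    by (intro Bochner_Integration.integral_cong) (auto simp: space_restrict_space)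
  also have "\<dots> = (LINT x|lborel. norm (f' x) * indicator \<Omega> x)"
  proof (rule integral_lebesgue_on_eq_lborel[OF \<Omega>])
    show "AE x in lebesgue_on \<Omega>. norm (f x) = norm (f' x)" using ae by eventually_elim simp
  qed (use f in auto)
  finally have "ennreal (LINT x|lebesgue_on \<Omega>. norm (f x)) = ennreal (LINT x|lborel. norm (f' x) * indicator \<Omega> x)" by simp
  also have "\<dots> = (\<integral>\<^sup>+x. ennreal (norm (f' x) * indicator \<Omega> x) \<partial>lborel)"
  proof (rule nn_integral_eq_integral[symmetric])
    show "integrable lborel (\<lambda>x. norm (f' x) * indicator \<Omega> x)"
      using integrable_norm[OF f'] by (intro integrable_mult_bounded[where B=1]) (auto simp: indicator_def)
  qed simp
  also have "\<dots> = (\<integral>\<^sup>+x. indicator \<Omega> x * ennreal (norm (f' x)) \<partial>lborel)"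
    by (intro nn_integral_cong) (auto simp: indicator_def)
  finally show ?thesis .
qed

context radial_domain
begin

text \<open>Almost every point of \<open>\<Omega>\<close> is carried by a dilation with rational parameter into the region near the back
  end of its segment where \<open>g\<close> vanishes, without leaving \<open>\<Omega>\<close>; the rational parameters keep the exceptional
  sets countable in number, and no measurability of \<open>lo\<close> and \<open>hi\<close> is needed.\<close>

theorem radial_poincare_near:
  assumes p: "p \<ge> 1" and \<Gamma>: "back_contact_set \<Omega> P K lo \<subseteq> \<Gamma>" and g: "g \<in> vanishing_near p \<Omega> \<Gamma>"
  shows "(LINT x|lebesgue_on \<Omega>. \<bar>g x\<bar>) \<le> radial_width \<Omega> P K lo hi * (LINT x|lebesgue_on \<Omega>. norm (weak_grad \<Omega> g x))"
proof -
  define d where "d = radial_width \<Omega> P K lo hi"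
  have d0: "d \<ge> 0" unfolding d_def by (rule width_nonneg)
  have gS: "g \<in> sobolev_space p \<Omega>" using g by (simp add: vanishing_near_def)
  obtain U where U: "open U" "\<Gamma> \<subseteq> U" "AE x in lebesgue_on \<Omega>. x \<in> U \<longrightarrow> g x = 0"
    using g by (auto simp: vanishing_near_def)
  obtain u G where uG: "borel_weak_gradient \<Omega> u G" "AE x in lebesgue_on \<Omega>. g x = u x"
    "AE x in lebesgue_on \<Omega>. weak_grad \<Omega> g x = G x"
    by (rule sobolev_representative[OF open_\<Omega> bounded_\<Omega> p gS])
  have ui: "integrable lborel u" and Gi: "integrable lborel G" using uG by (auto simp: borel_weak_gradient_def)
  have [measurable]: "u \<in> borel_measurable borel" "G \<in> borel_measurable borel" "\<Omega> \<in> sets borel"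
    using ui Gi open_\<Omega> by auto
  interpret flow: affine_flow 1 "- P" by unfold_locales simp
  have \<sigma>: "flow.\<sigma> s = 1 + s" for s by (simp add: flow.\<sigma>_def)
  have V: "flow.V x = x - P" for x by (simp add: flow.V_def)
  have \<theta>: "flow.\<theta> s x = P + (1 + s) *\<^sub>R (x - P)" for s x
    by (simp add: flow.\<theta>_def \<sigma> algebra_simps)
  have \<theta>P: "flow.\<theta> s x - P = (1 + s) *\<^sub>R (x - P)" for s x by (simp add: \<theta>)
  define Gn where "Gn y = indicator \<Omega> y * ennreal (norm (G y))" for y
  have [measurable]: "Gn \<in> borel_measurable borel" unfolding Gn_def[abs_def] by measurable
  \<comment> \<open>An orbit used below stays within one radial segment and has length s |x - P|,
    hence s |x - P| \<le> d. Recording this constraint in the integrand is what later bounds the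
    weight by d.\<close>
  let ?A = "\<lambda>s x. indicator {s. 0 \<le> s \<and> s * norm (x - P) \<le> d} s * (Gn (flow.\<theta> s x) * ennreal (norm (x - P)))"
  have ae1: "AE x in lborel. \<forall>q::rat. 0 \<le> q \<longrightarrow> (\<forall>s\<in>{0..real_of_rat q}. flow.\<theta> s x \<in> \<Omega>) \<longrightarrow>
     u (flow.\<theta> (real_of_rat q) x) - u x = (LINT s|lborel. indicator {0..real_of_rat q} s * (G (flow.\<theta> s x) \<bullet> flow.V x))"
    unfolding AE_all_countable
  proof (intro allI)
    fix q :: rat
    show "AE x in lborel. 0 \<le> q \<longrightarrow> (\<forall>s\<in>{0..real_of_rat q}. flow.\<theta> s x \<in> \<Omega>) \<longrightarrow>
     u (flow.\<theta> (real_of_rat q) x) - u x = (LINT s|lborel. indicator {0..real_of_rat q} s * (G (flow.\<theta> s x) \<bullet> flow.V x))"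
    proof (cases "0 \<le> q")
      case True
      then show ?thesis using flow.flow_formula[OF uG(1) _ open_\<Omega>, of "real_of_rat q"] by simp
    qed simp
  qed
  have "AE x in lborel. x \<in> \<Omega> \<longrightarrow> x \<in> U \<longrightarrow> u x = 0"
    using U(3) uG(2) unfolding AE_lebesgue_on_iff_lborel[OF open_\<Omega>] by eventually_elim auto
  then have aeU: "AE x in lborel. flow.\<theta> t x \<in> \<Omega> \<longrightarrow> flow.\<theta> t x \<in> U \<longrightarrow> u (flow.\<theta> t x) = 0" if "t \<ge> 0" for t
    unfolding flow.\<theta>_def using flow.\<sigma>_pos(1)[OF that]
    by (intro AE_lborel_affine[of "\<lambda>x. x \<in> \<Omega> \<longrightarrow> x \<in> U \<longrightarrow> u x = 0"]) auto
  have ae2: "AE x in lborel. \<forall>q::rat. 0 \<le> q \<longrightarrow> flow.\<theta> (real_of_rat q) x \<in> \<Omega> \<longrightarrow> flow.\<theta> (real_of_rat q) x \<in> U \<longrightarrow> u (flow.\<theta> (real_of_rat q) x) = 0"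
    unfolding AE_all_countable
  proof (intro allI)
    fix q :: rat
    show "AE x in lborel. 0 \<le> q \<longrightarrow> flow.\<theta> (real_of_rat q) x \<in> \<Omega> \<longrightarrow> flow.\<theta> (real_of_rat q) x \<in> U \<longrightarrow> u (flow.\<theta> (real_of_rat q) x) = 0"
    proof (cases "0 \<le> q")
      case True
      then show ?thesis using aeU[of "real_of_rat q"] by simp
    qed simp
  qed
  have ae3: "AE x in lborel. x \<in> \<Omega> \<longrightarrow> (\<exists>k\<in>{1..K (sgn (x - P))}. lo (sgn (x - P)) k \<le> dist P x \<and> dist P x \<le> hi (sgn (x - P)) k)"
    using radial unfolding radial_property_def AE_lebesgue_on_iff_lborel[OF open_\<Omega>] by blast
  have ae4: "AE x in lborel. x \<noteq> P" by (rule AE_lborel_singleton)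
  have bound: "AE x in lborel. indicator \<Omega> x * ennreal \<bar>u x\<bar> \<le> (\<integral>\<^sup>+s. ?A s x \<partial>lborel)"
    using ae1 ae2 ae3 ae4
  proof eventually_elim
    case (elim x)
    show ?case
    proof (cases "x \<in> \<Omega>")
      case True
      let ?\<omega> = "sgn (x - P)" and ?r = "dist P x"
      obtain k where k: "k \<in> {1..K ?\<omega>}" "lo ?\<omega> k \<le> ?r" "?r \<le> hi ?\<omega> k" using elim(3) True by blast
      note seg = radial_segment[OF True elim(4) k]
      have rpos: "?r > 0" using elim(4) by simp
      have xP: "x - P = ?r *\<^sub>R ?\<omega>" using elim(4) by (simp add: sgn_div_norm dist_norm norm_minus_commute)
      have \<theta>r: "flow.\<theta> s x = P + ((1 + s) * ?r) *\<^sub>R ?\<omega>" for s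
        unfolding \<theta> by (subst xP) simp
      let ?e = "P + hi ?\<omega> k *\<^sub>R ?\<omega>"
      have "?e \<in> U" using seg(3) \<Gamma> U(2) by blast
      then obtain \<epsilon> where \<epsilon>: "\<epsilon> > 0" "ball ?e \<epsilon> \<subseteq> U" using U(1) open_contains_ball by blast
      \<comment> \<open>A time between \<open>a\<close> and the upper limit carries x to a point
        before the back end and within \<epsilon> of it; the maximum with 0 makes the time
        positive.\<close>
      define a where "a = max 0 ((hi ?\<omega> k - \<epsilon>) / ?r - 1)"
      have "a < hi ?\<omega> k / ?r - 1"
        using rpos \<epsilon>(1) seg(1) by (auto simp: a_def divide_strict_right_mono less_divide_eq)
      then obtain q where q: "a < real_of_rat q" "real_of_rat q < hi ?\<omega> k / ?r - 1"
        using of_rat_dense by blast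
      let ?t = "real_of_rat q"
      have t0: "?t > 0" using q(1) by (simp add: a_def)
      have q0: "0 \<le> q" using t0 by (simp add: less_imp_le)
      have t1: "(1 + ?t) * ?r < hi ?\<omega> k" using q(2) rpos by (simp add: less_divide_eq algebra_simps less_diff_eq)
      have t2: "hi ?\<omega> k - \<epsilon> < (1 + ?t) * ?r"
      proof -
        have "(hi ?\<omega> k - \<epsilon>) / ?r - 1 < ?t" using q(1) by (simp add: a_def)
        then have "(hi ?\<omega> k - \<epsilon>) / ?r < 1 + ?t" by linarith
        then show ?thesis using rpos by (simp add: divide_less_eq)
      qed
      have in\<Omega>: "flow.\<theta> s x \<in> \<Omega>" if s: "s \<in> {0..?t}" for s
        unfolding \<theta>r
      proof (rule seg(4))
        show "?r \<le> (1 + s) * ?r" using s rpos by simp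
        have "(1 + s) * ?r \<le> (1 + ?t) * ?r" using s rpos by (intro mult_right_mono) auto
        then show "(1 + s) * ?r < hi ?\<omega> k" using t1 by linarith
      qed
      have "flow.\<theta> ?t x \<in> ball ?e \<epsilon>"
      proof -
        have n1: "norm ?\<omega> = 1" using elim(4) by (simp add: norm_sgn)
        have "dist ?e (flow.\<theta> ?t x) = norm ((hi ?\<omega> k - (1 + ?t) * ?r) *\<^sub>R ?\<omega>)"
          unfolding \<theta>r by (simp add: dist_norm scaleR_diff_left)
        also have "\<dots> = hi ?\<omega> k - (1 + ?t) * ?r" using n1 t1 by simp
        also have "\<dots> < \<epsilon>" using t2 by linarith
        finally show ?thesis by simp
      qed
      then have inU: "flow.\<theta> ?t x \<in> U" using \<epsilon>(2) by blast
      have tt: "?t \<in> {0..?t}" using t0 by simp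
      have z: "u (flow.\<theta> ?t x) = 0"
        using elim(2)[rule_format, OF q0 in\<Omega>[OF tt] inU] .
      have form: "u (flow.\<theta> ?t x) - u x = (LINT s|lborel. indicator {0..?t} s * (G (flow.\<theta> s x) \<bullet> flow.V x))"
        using elim(1)[rule_format, OF q0 in\<Omega>] .
      have "ennreal \<bar>u x\<bar> = ennreal (norm (LINT s|lborel. indicator {0..?t} s * (G (flow.\<theta> s x) \<bullet> flow.V x)))"
        unfolding form[symmetric] z by simp
      also have "\<dots> \<le> (\<integral>\<^sup>+s. norm (indicator {0..?t} s * (G (flow.\<theta> s x) \<bullet> flow.V x)) \<partial>lborel)"
      \<comment> \<open>Integrability along this particular orbit is not known. If it fails, the
        integral is 0 by convention and the bound is trivial.\<close>
      proof (cases "integrable lborel (\<lambda>s. indicator {0..?t} s * (G (flow.\<theta> s x) \<bullet> flow.V x))")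
        case True
        then show ?thesis by (rule integral_norm_bound_ennreal)
      next
        case False
        then show ?thesis by (simp add: not_integrable_integral_eq)
      qed
      also have "\<dots> \<le> (\<integral>\<^sup>+s. ?A s x \<partial>lborel)"
      proof (rule nn_integral_mono)
        fix s :: real
        show "ennreal (norm (indicator {0..?t} s * (G (flow.\<theta> s x) \<bullet> flow.V x))) \<le> ?A s x"
        proof (cases "s \<in> {0..?t}")
          case True
          have "s * ?r \<le> ?t * ?r" using True rpos by (intro mult_right_mono) auto
          then have "s * norm (x - P) \<le> d"
            using t1 seg(2) by (simp add: d_def dist_norm norm_minus_commute algebra_simps)
          moreover have "ennreal \<bar>G (flow.\<theta> s x) \<bullet> flow.V x\<bar> \<le> ennreal (norm (G (flow.\<theta> s x))) * ennreal (norm (x - P))"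
            unfolding V by (simp add: Cauchy_Schwarz_ineq2 ennreal_leI flip: ennreal_mult)
          ultimately show ?thesis using True in\<Omega>[OF True] by (simp add: Gn_def)
        qed simp
      qed
      finally show ?thesis using True by simp
    qed simp
  qed
  have "ennreal (LINT x|lebesgue_on \<Omega>. norm (g x)) = (\<integral>\<^sup>+x. indicator \<Omega> x * ennreal (norm (u x)) \<partial>lborel)"
    using gS by (intro integral_abs_lebesgue_on[OF open_\<Omega> _ ui uG(2)]) (auto simp: sobolev_space_def Lp_space_def)
  also have "\<dots> \<le> (\<integral>\<^sup>+x. \<integral>\<^sup>+s. ?A s x \<partial>lborel \<partial>lborel)"
    using bound by (intro nn_integral_mono_AE) simp
  also have "\<dots> = (\<integral>\<^sup>+s. \<integral>\<^sup>+x. ?A s x \<partial>lborel \<partial>lborel)"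
    by (rule lborel_pair.Fubini') measurable
  also have "\<dots> \<le> (\<integral>\<^sup>+s. \<integral>\<^sup>+y. Gn y * (indicator {s. 0 \<le> s \<and> s * norm (y - P) \<le> d * (1 + s)} s * ennreal (norm (y - P) / (1 + s)\<^sup>2)) \<partial>lborel \<partial>lborel)"
  proof (rule nn_integral_mono)
    fix s :: real
    show "(\<integral>\<^sup>+x. ?A s x \<partial>lborel) \<le> (\<integral>\<^sup>+y. Gn y * (indicator {s. 0 \<le> s \<and> s * norm (y - P) \<le> d * (1 + s)} s * ennreal (norm (y - P) / (1 + s)\<^sup>2)) \<partial>lborel)"
    proof (cases "s \<ge> 0")
      case True
      \<comment> \<open>The integrand expressed at the image point y =
        \<open>flow.\<theta> s x\<close>, where |x - P| = |y - P| / (1 + s).\<close>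
      define F where "F y = Gn y * (indicator {s. 0 \<le> s \<and> s * norm (y - P) \<le> d * (1 + s)} s * ennreal (norm (y - P) / (1 + s)))" for y
      have [measurable]: "F \<in> borel_measurable borel" unfolding F_def[abs_def] by measurable
      have AF: "?A s x = F (flow.\<theta> s x)" for x
      proof -
        have "s * ((1 + s) * norm (x - P)) \<le> d * (1 + s) \<longleftrightarrow> s * norm (x - P) \<le> d"
        proof -
          have "s * ((1 + s) * norm (x - P)) \<le> d * (1 + s) \<longleftrightarrow> (s * norm (x - P)) * (1 + s) \<le> d * (1 + s)"
            by (simp add: mult_ac)
          then show ?thesis using True by (simp add: mult_le_cancel_right)
        qed
        then show ?thesis using True unfolding F_def \<theta>P by (simp add: indicator_def mult_ac)
      qed
      have "(\<integral>\<^sup>+y. F y \<partial>lborel) = ennreal (\<bar>flow.\<sigma> s\<bar> ^ DIM('a)) * (\<integral>\<^sup>+x. F (flow.\<theta> s x) \<partial>lborel)"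
        unfolding flow.\<theta>_def using flow.\<sigma>_pos[OF True] by (intro nn_integral_lborel_affine) auto
      \<comment> \<open>Only one factor of the Jacobian (1 + s)^N is kept. Together with the 1 / (1
        + s) in \<open>F\<close> it gives the weight |y - P| / (1 + s)^2, whose mass in s is at most
        d in every dimension.\<close>
      also have "\<dots> \<ge> ennreal (1 + s) * (\<integral>\<^sup>+x. F (flow.\<theta> s x) \<partial>lborel)"
        using self_le_power[of "1 + s" "DIM('a)"] True
        by (intro mult_right_mono ennreal_leI) (auto simp: \<sigma>)
      finally have le: "ennreal (1 + s) * (\<integral>\<^sup>+x. F (flow.\<theta> s x) \<partial>lborel) \<le> (\<integral>\<^sup>+y. F y \<partial>lborel)" .
      have "(\<integral>\<^sup>+x. ?A s x \<partial>lborel) = ennreal (1 / (1 + s)) * (ennreal (1 + s) * (\<integral>\<^sup>+x. F (flow.\<theta> s x) \<partial>lborel))"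
      proof -
        have "ennreal (1 / (1 + s)) * ennreal (1 + s) = 1"
          using True by (subst ennreal_mult[symmetric]) auto
        then show ?thesis unfolding AF by (simp only: mult.assoc[symmetric] mult_1_left)
      qed
      also have "\<dots> \<le> ennreal (1 / (1 + s)) * (\<integral>\<^sup>+y. F y \<partial>lborel)"
        by (intro mult_left_mono le) simp
      also have "\<dots> = (\<integral>\<^sup>+y. ennreal (1 / (1 + s)) * F y \<partial>lborel)"
        by (rule nn_integral_cmult[symmetric]) simp
      also have "\<dots> = (\<integral>\<^sup>+y. Gn y * (indicator {s. 0 \<le> s \<and> s * norm (y - P) \<le> d * (1 + s)} s * ennreal (norm (y - P) / (1 + s)\<^sup>2)) \<partial>lborel)"
      proof (intro nn_integral_cong)
        fix y
        have *: "ennreal (1 / (1 + s)) * ennreal (norm (y - P) / (1 + s)) = ennreal (norm (y - P) / (1 + s)\<^sup>2)"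
          using True by (simp add: power2_eq_square flip: ennreal_mult)
        show "ennreal (1 / (1 + s)) * F y = Gn y * (indicator {s. 0 \<le> s \<and> s * norm (y - P) \<le> d * (1 + s)} s * ennreal (norm (y - P) / (1 + s)\<^sup>2))"
          unfolding F_def *[symmetric] by (simp only: mult_ac)
      qed
      finally show ?thesis .
    qed simp
  qed
  also have "\<dots> = (\<integral>\<^sup>+y. \<integral>\<^sup>+s. Gn y * (indicator {s. 0 \<le> s \<and> s * norm (y - P) \<le> d * (1 + s)} s * ennreal (norm (y - P) / (1 + s)\<^sup>2)) \<partial>lborel \<partial>lborel)"
    by (rule lborel_pair.Fubini') measurable
  also have "\<dots> = (\<integral>\<^sup>+y. Gn y * (\<integral>\<^sup>+s. indicator {s. 0 \<le> s \<and> s * norm (y - P) \<le> d * (1 + s)} s * ennreal (norm (y - P) / (1 + s)\<^sup>2) \<partial>lborel) \<partial>lborel)"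
    by (intro nn_integral_cong nn_integral_cmult) measurable
  also have "\<dots> \<le> (\<integral>\<^sup>+y. Gn y * ennreal d \<partial>lborel)"
    using d0 by (intro nn_integral_mono mult_left_mono nn_integral_dilation_weight) auto
  also have "\<dots> = (\<integral>\<^sup>+y. indicator \<Omega> y * ennreal (norm (G y)) \<partial>lborel) * ennreal d"
    unfolding Gn_def by (rule nn_integral_multc) measurable
  also have "(\<integral>\<^sup>+y. indicator \<Omega> y * ennreal (norm (G y)) \<partial>lborel) = ennreal (LINT x|lebesgue_on \<Omega>. norm (weak_grad \<Omega> g x))"
    using gS by (intro integral_abs_lebesgue_on[symmetric, OF open_\<Omega> _ Gi uG(3)]) (auto simp: sobolev_space_def Lp_space_def)
  finally have "ennreal (LINT x|lebesgue_on \<Omega>. norm (g x)) \<le> ennreal ((LINT x|lebesgue_on \<Omega>. norm (weak_grad \<Omega> g x)) * d)"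
    using d0 by (simp add: ennreal_mult Bochner_Integration.integral_nonneg)
  then have "(LINT x|lebesgue_on \<Omega>. norm (g x)) \<le> (LINT x|lebesgue_on \<Omega>. norm (weak_grad \<Omega> g x)) * d"
    using d0 by (subst (asm) ennreal_le_iff) (auto intro!: mult_nonneg_nonneg Bochner_Integration.integral_nonneg)
  then show ?thesis by (simp add: d_def mult.commute)
qed

end

section \<open>Functions vanishing on a part of the boundary\<close>

lemma Lp_norm_tendsto_0_iff:
  assumes p: "p > 0"
  shows "(\<lambda>n. Lp_norm p \<Omega> (f n)) \<longlonglongrightarrow> 0 \<longleftrightarrow> (\<lambda>n. LINT x|lebesgue_on \<Omega>. norm (f n x) powr p) \<longlonglongrightarrow> 0"
proof -
  have I: "(LINT x|lebesgue_on \<Omega>. norm (f n x) powr p) \<ge> 0" for n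
    by (intro Bochner_Integration.integral_nonneg) simp
  show ?thesis
  proof
    assume "(\<lambda>n. Lp_norm p \<Omega> (f n)) \<longlonglongrightarrow> 0"
    then have "(\<lambda>n. Lp_norm p \<Omega> (f n) powr p) \<longlonglongrightarrow> 0 powr p"
      using p by (intro tendsto_powr' tendsto_const) (auto simp: Lp_norm_def)
    then show "(\<lambda>n. LINT x|lebesgue_on \<Omega>. norm (f n x) powr p) \<longlonglongrightarrow> 0"
      using p I by (simp add: Lp_norm_def powr_powr)
  next
    assume "(\<lambda>n. LINT x|lebesgue_on \<Omega>. norm (f n x) powr p) \<longlonglongrightarrow> 0"
    then have "(\<lambda>n. (LINT x|lebesgue_on \<Omega>. norm (f n x) powr p) powr (1 / p)) \<longlonglongrightarrow> 0 powr (1 / p)"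
      using p I by (intro tendsto_powr' tendsto_const) auto
    then show "(\<lambda>n. Lp_norm p \<Omega> (f n)) \<longlonglongrightarrow> 0"
      using p by (simp add: Lp_norm_def)
  qed
qed

text \<open>If t > \<epsilon>, then (t / \<epsilon>)^(p - 1) \<ge> 1. On a set of finite measure
  this bounds an L^1 norm by L^p quantities up to an arbitrarily small error, in place of Hoelder's
  inequality.\<close>

lemma le_eps_plus_powr:
  fixes t p \<epsilon> :: real
  assumes "t \<ge> 0" "\<epsilon> > 0" "p \<ge> 1"
  shows "t \<le> \<epsilon> + \<epsilon> powr (1 - p) * t powr p"
proof (cases "t \<le> \<epsilon>")
  case False
  have "t = t powr p * t powr (1 - p)" using False assms by (simp add: powr_add[symmetric])
  also have "\<dots> \<le> t powr p * \<epsilon> powr (1 - p)"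
    using False assms by (intro mult_left_mono powr_mono2') auto
  finally show ?thesis using assms by (simp add: mult.commute)
qed (use assms in \<open>simp add: add_increasing2\<close>)

lemma L1_tendsto_0_from_Lp:
  fixes f :: "nat \<Rightarrow> 'a::euclidean_space \<Rightarrow> 'b::euclidean_space"
  assumes \<Omega>: "open \<Omega>" "bounded \<Omega>" and p: "p \<ge> 1" and f: "\<And>n. f n \<in> Lp_space p \<Omega>"
    and lim: "(\<lambda>n. LINT x|lebesgue_on \<Omega>. norm (f n x) powr p) \<longlonglongrightarrow> 0"
  shows "(\<lambda>n. LINT x|lebesgue_on \<Omega>. norm (f n x)) \<longlonglongrightarrow> 0"
proof (rule LIMSEQ_I)
  interpret finite_measure "lebesgue_on \<Omega>" by (rule finite_measure_lebesgue_on[OF \<Omega>])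
  let ?m = "measure (lebesgue_on \<Omega>) (space (lebesgue_on \<Omega>))"
  fix r :: real assume r: "r > 0"
  \<comment> \<open>Half of r is reserved for \<epsilon> times the measure of \<Omega> and half for
    the L^p part; the added 1 keeps the denominator positive.\<close>
  define \<epsilon> where "\<epsilon> = r / (2 * (?m + 1))"
  have m1: "?m + 1 > 0" using measure_nonneg[of "lebesgue_on \<Omega>" "space (lebesgue_on \<Omega>)"] by linarith
  have \<epsilon>: "\<epsilon> > 0" using r m1 by (simp add: \<epsilon>_def)
  define c where "c = \<epsilon> powr (1 - p)"
  have c: "c > 0" using \<epsilon> by (simp add: c_def)
  obtain n0 where n0: "\<And>n. n \<ge> n0 \<Longrightarrow> \<bar>LINT x|lebesgue_on \<Omega>. norm (f n x) powr p\<bar> < r / (2 * c)"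
    using LIMSEQ_D[OF lim, of "r / (2 * c)"] r c by auto
  have "(LINT x|lebesgue_on \<Omega>. norm (f n x)) < r" if n: "n \<ge> n0" for n
  proof -
    have fp: "integrable (lebesgue_on \<Omega>) (\<lambda>x. norm (f n x) powr p)" using f[of n] by (simp add: Lp_space_def)
    have "(LINT x|lebesgue_on \<Omega>. norm (f n x)) \<le> (LINT x|lebesgue_on \<Omega>. \<epsilon> + c * norm (f n x) powr p)"
    proof (rule integral_mono)
      show "integrable (lebesgue_on \<Omega>) (\<lambda>x. norm (f n x))"
        using Lp_space_imp_integrable[OF \<Omega> p f[of n]] by (rule integrable_norm)
      show "integrable (lebesgue_on \<Omega>) (\<lambda>x. \<epsilon> + c * norm (f n x) powr p)" using fp by simp
      show "norm (f n x) \<le> \<epsilon> + c * norm (f n x) powr p" for x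
        unfolding c_def by (rule le_eps_plus_powr[OF norm_ge_zero \<epsilon> p])
    qed
    also have "\<dots> = \<epsilon> * ?m + c * (LINT x|lebesgue_on \<Omega>. norm (f n x) powr p)"
      using fp by simp
    also have "\<dots> < r / 2 + r / 2"
    proof (rule add_le_less_mono)
      have "\<epsilon> * ?m \<le> \<epsilon> * (?m + 1)" using \<epsilon> by (intro mult_left_mono) auto
      also have "\<dots> = r / 2"
      proof -
        have "r / (2 * a) * a = r / 2" if "a > 0" for a :: real using that by simp
        from this[OF m1] show ?thesis by (simp only: \<epsilon>_def)
      qed
      finally show "\<epsilon> * ?m \<le> r / 2" .
      have "c * (LINT x|lebesgue_on \<Omega>. norm (f n x) powr p) < c * (r / (2 * c))"
        using n0[OF n] c by (intro mult_strict_left_mono) auto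
      then show "c * (LINT x|lebesgue_on \<Omega>. norm (f n x) powr p) < r / 2" using c by simp
    qed
    finally show ?thesis by simp
  qed
  moreover have "(LINT x|lebesgue_on \<Omega>. norm (f n x)) \<ge> 0" for n
    by (intro Bochner_Integration.integral_nonneg) simp
  ultimately show "\<exists>no. \<forall>n\<ge>no. norm ((LINT x|lebesgue_on \<Omega>. norm (f n x)) - 0) < r"
    by (auto simp: abs_of_nonneg)
qed

lemma sobolev_norm_tendsto_0_iff:
  assumes p: "p > 0"
  shows "(\<lambda>n. sobolev_norm p \<Omega> (f n)) \<longlonglongrightarrow> 0 \<longleftrightarrow>
    (\<lambda>n. LINT x|lebesgue_on \<Omega>. \<bar>f n x\<bar> powr p) \<longlonglongrightarrow> 0 \<and>
    (\<lambda>n. LINT x|lebesgue_on \<Omega>. norm (weak_grad \<Omega> (f n) x) powr p) \<longlonglongrightarrow> 0"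
proof -
  have "(\<lambda>n. sobolev_norm p \<Omega> (f n)) \<longlonglongrightarrow> 0 \<longleftrightarrow>
      (\<lambda>n. Lp_norm p \<Omega> (f n)) \<longlonglongrightarrow> 0 \<and> (\<lambda>n. Lp_norm p \<Omega> (weak_grad \<Omega> (f n))) \<longlonglongrightarrow> 0"
  proof
    assume lim: "(\<lambda>n. sobolev_norm p \<Omega> (f n)) \<longlonglongrightarrow> 0"
    show "(\<lambda>n. Lp_norm p \<Omega> (f n)) \<longlonglongrightarrow> 0 \<and> (\<lambda>n. Lp_norm p \<Omega> (weak_grad \<Omega> (f n))) \<longlonglongrightarrow> 0"
      by (intro conjI; rule Lim_null_comparison[OF _ lim]) (auto simp: sobolev_norm_def Lp_norm_def)
  next
    assume "(\<lambda>n. Lp_norm p \<Omega> (f n)) \<longlonglongrightarrow> 0 \<and> (\<lambda>n. Lp_norm p \<Omega> (weak_grad \<Omega> (f n))) \<longlonglongrightarrow> 0"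
    then have "(\<lambda>n. Lp_norm p \<Omega> (f n) + Lp_norm p \<Omega> (weak_grad \<Omega> (f n))) \<longlonglongrightarrow> 0 + 0"
      by (intro tendsto_add) auto
    then show "(\<lambda>n. sobolev_norm p \<Omega> (f n)) \<longlonglongrightarrow> 0" by (simp add: sobolev_norm_def)
  qed
  then show ?thesis by (simp add: Lp_norm_tendsto_0_iff[OF p])
qed

lemma sobolev_vanishing_approx:
  assumes \<Omega>: "open \<Omega>" "bounded \<Omega>" and p: "p \<ge> 1" and v: "v \<in> sobolev_space_vanishing p \<Omega> \<Gamma>"
  shows "\<exists>w. (\<forall>j. w j \<in> vanishing_near p \<Omega> \<Gamma>) \<and>
    (\<lambda>j. LINT x|lebesgue_on \<Omega>. \<bar>w j x - v x\<bar> powr p) \<longlonglongrightarrow> 0 \<and>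
    (\<lambda>j. LINT x|lebesgue_on \<Omega>. norm (weak_grad \<Omega> (w j) x - weak_grad \<Omega> v x) powr p) \<longlonglongrightarrow> 0"
proof -
  obtain w where w: "\<And>j. w j \<in> vanishing_near p \<Omega> \<Gamma>" "(\<lambda>j. sobolev_norm p \<Omega> (\<lambda>x. w j x - v x)) \<longlonglongrightarrow> 0"
    using v by (auto simp: sobolev_space_vanishing_def)
  have vS: "v \<in> sobolev_space p \<Omega>" using v by (simp add: sobolev_space_vanishing_def)
  have wS: "w j \<in> sobolev_space p \<Omega>" for j using w(1)[of j] by (simp add: vanishing_near_def)
  have L: "weak_grad \<Omega> (w j) \<in> Lp_space p \<Omega>" "weak_grad \<Omega> v \<in> Lp_space p \<Omega>" for j
    using wS[of j] vS by (auto simp: sobolev_space_def)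
  have "(LINT x|lebesgue_on \<Omega>. norm (weak_grad \<Omega> (\<lambda>x. w j x - v x) x) powr p) =
      (LINT x|lebesgue_on \<Omega>. norm (weak_grad \<Omega> (w j) x - weak_grad \<Omega> v x) powr p)" for j
  proof (rule integral_cong_AE)
    have "weak_grad \<Omega> (\<lambda>x. w j x - v x) \<in> Lp_space p \<Omega>"
      using sobolev_space_diff(1)[OF \<Omega> p wS[of j] vS] by (simp add: sobolev_space_def)
    then show "(\<lambda>x. norm (weak_grad \<Omega> (\<lambda>x. w j x - v x) x) powr p) \<in> borel_measurable (lebesgue_on \<Omega>)"
      by (auto simp: Lp_space_def)
    show "(\<lambda>x. norm (weak_grad \<Omega> (w j) x - weak_grad \<Omega> v x) powr p) \<in> borel_measurable (lebesgue_on \<Omega>)"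
      using L(1)[of j] L(2) by (auto simp: Lp_space_def)
    show "AE x in lebesgue_on \<Omega>. norm (weak_grad \<Omega> (\<lambda>x. w j x - v x) x) powr p =
        norm (weak_grad \<Omega> (w j) x - weak_grad \<Omega> v x) powr p"
      using sobolev_space_diff(2)[OF \<Omega> p wS[of j] vS] by eventually_elim simp
  qed
  then show ?thesis
    using w p by (auto simp: sobolev_norm_tendsto_0_iff)
qed

lemma L1_norm_limit:
  fixes f :: "nat \<Rightarrow> 'a \<Rightarrow> 'b::{banach, second_countable_topology}"
  assumes f: "\<And>n. integrable M (f n)" "integrable M g"
    and lim: "(\<lambda>n. LINT x|M. norm (f n x - g x)) \<longlonglongrightarrow> 0"
  shows "(\<lambda>n. LINT x|M. norm (f n x)) \<longlonglongrightarrow> (LINT x|M. norm (g x))"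
proof -
  have "(\<lambda>n. (LINT x|M. norm (f n x)) - (LINT x|M. norm (g x))) \<longlonglongrightarrow> 0"
  proof (rule Lim_null_comparison[OF _ lim], rule always_eventually, rule allI)
    fix n
    have "norm ((LINT x|M. norm (f n x)) - (LINT x|M. norm (g x))) = norm (LINT x|M. norm (f n x) - norm (g x))"
      using f by simp
    also have "\<dots> \<le> (LINT x|M. norm (norm (f n x) - norm (g x)))" by (rule integral_norm_bound)
    also have "\<dots> \<le> (LINT x|M. norm (f n x - g x))"
      using f by (intro integral_mono) (auto simp: norm_triangle_ineq3)
    finally show "norm ((LINT x|M. norm (f n x)) - (LINT x|M. norm (g x))) \<le> (LINT x|M. norm (f n x - g x))" .
  qed
  then show ?thesis by (simp add: LIM_zero_iff)
qed

text \<open>Both sides are continuous under L^1 convergence of functions and gradients, which on a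
  bounded set follows from the L^p convergence of the approximants.\<close>

theorem (in radial_domain) radial_poincare:
  assumes p: "p \<ge> 1" and \<Gamma>: "back_contact_set \<Omega> P K lo \<subseteq> \<Gamma>" and v: "v \<in> sobolev_space_vanishing p \<Omega> \<Gamma>"
  shows "(LINT x|lebesgue_on \<Omega>. \<bar>v x\<bar>) \<le> radial_width \<Omega> P K lo hi * (LINT x|lebesgue_on \<Omega>. norm (weak_grad \<Omega> v x))"
proof -
  note \<Omega> = open_\<Omega> bounded_\<Omega>
  obtain w where w: "\<And>j. w j \<in> vanishing_near p \<Omega> \<Gamma>"
    "(\<lambda>j. LINT x|lebesgue_on \<Omega>. \<bar>w j x - v x\<bar> powr p) \<longlonglongrightarrow> 0"
    "(\<lambda>j. LINT x|lebesgue_on \<Omega>. norm (weak_grad \<Omega> (w j) x - weak_grad \<Omega> v x) powr p) \<longlonglongrightarrow> 0"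
    using sobolev_vanishing_approx[OF \<Omega> p v] by blast
  have vS: "v \<in> sobolev_space p \<Omega>" using v by (simp add: sobolev_space_vanishing_def)
  have wS: "w j \<in> sobolev_space p \<Omega>" for j using w(1)[of j] by (simp add: vanishing_near_def)
  have L: "w j \<in> Lp_space p \<Omega>" "v \<in> Lp_space p \<Omega>" "weak_grad \<Omega> (w j) \<in> Lp_space p \<Omega>" "weak_grad \<Omega> v \<in> Lp_space p \<Omega>" for j
    using wS[of j] vS by (auto simp: sobolev_space_def)
  have p0: "p \<ge> 0" using p by simp
  have "(\<lambda>j. LINT x|lebesgue_on \<Omega>. norm (w j x - v x)) \<longlonglongrightarrow> 0"
    using w(2) by (intro L1_tendsto_0_from_Lp[OF \<Omega> p] Lp_space_diff L p0) simp
  then have 1: "(\<lambda>j. LINT x|lebesgue_on \<Omega>. norm (w j x)) \<longlonglongrightarrow> (LINT x|lebesgue_on \<Omega>. norm (v x))"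
    by (rule L1_norm_limit[rotated 2]) (intro Lp_space_imp_integrable[OF \<Omega> p] L)+
  have "(\<lambda>j. LINT x|lebesgue_on \<Omega>. norm (weak_grad \<Omega> (w j) x - weak_grad \<Omega> v x)) \<longlonglongrightarrow> 0"
    using w(3) by (intro L1_tendsto_0_from_Lp[OF \<Omega> p] Lp_space_diff L p0) simp
  then have 2: "(\<lambda>j. LINT x|lebesgue_on \<Omega>. norm (weak_grad \<Omega> (w j) x)) \<longlonglongrightarrow> (LINT x|lebesgue_on \<Omega>. norm (weak_grad \<Omega> v x))"
    by (rule L1_norm_limit[rotated 2]) (intro Lp_space_imp_integrable[OF \<Omega> p] L)+
  have "(LINT x|lebesgue_on \<Omega>. norm (v x)) \<le> radial_width \<Omega> P K lo hi * (LINT x|lebesgue_on \<Omega>. norm (weak_grad \<Omega> v x))"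
    by (rule LIMSEQ_le[OF 1 tendsto_mult_left[OF 2]])
      (use radial_poincare_near[OF p \<Gamma> w(1)] in auto)
  then show ?thesis by simp
qed

text \<open>As \<phi> 0 = 0, composition preserves vanishing near \<Gamma>. The difference of the
  gradients splits into \<phi>'(w_j) (\<nabla>w_j - \<nabla>v), which is small because \<phi>' is
  bounded, and (\<phi>'(w_j) - \<phi>'(v)) \<nabla>v, which is small by dominated convergence. The
  second part needs pointwise convergence, hence the passage to a subsequence.\<close>

theorem sobolev_vanishing_chain:
  assumes \<Omega>: "open \<Omega>" "bounded \<Omega>" and p: "p \<ge> 1" and v: "v \<in> sobolev_space_vanishing p \<Omega> \<Gamma>"
    and d: "\<And>x. (\<phi> has_real_derivative \<phi>' x) (at x)" and M: "\<And>x. \<bar>\<phi>' x\<bar> \<le> M"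
    and c: "continuous_on UNIV \<phi>'" and \<phi>0: "\<phi> 0 = 0"
  shows "(\<lambda>x. \<phi> (v x)) \<in> sobolev_space_vanishing p \<Omega> \<Gamma>"
proof -
  obtain w where w: "\<And>j. w j \<in> vanishing_near p \<Omega> \<Gamma>"
    "(\<lambda>j. LINT x|lebesgue_on \<Omega>. \<bar>w j x - v x\<bar> powr p) \<longlonglongrightarrow> 0"
    "(\<lambda>j. LINT x|lebesgue_on \<Omega>. norm (weak_grad \<Omega> (w j) x - weak_grad \<Omega> v x) powr p) \<longlonglongrightarrow> 0"
    using sobolev_vanishing_approx[OF \<Omega> p v] by blast
  have p0: "p \<ge> 0" "p > 0" using p by auto
  have M0: "M \<ge> 0" using M[of 0] by linarith
  have vS: "v \<in> sobolev_space p \<Omega>" using v by (simp add: sobolev_space_vanishing_def)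
  have wS: "w j \<in> sobolev_space p \<Omega>" for j using w(1)[of j] by (simp add: vanishing_near_def)
  have L: "w j \<in> Lp_space p \<Omega>" "v \<in> Lp_space p \<Omega>" "weak_grad \<Omega> (w j) \<in> Lp_space p \<Omega>" "weak_grad \<Omega> v \<in> Lp_space p \<Omega>" for j
    using wS[of j] vS by (auto simp: sobolev_space_def)
  have [measurable]: "w j \<in> borel_measurable (lebesgue_on \<Omega>)" "v \<in> borel_measurable (lebesgue_on \<Omega>)"
    "weak_grad \<Omega> (w j) \<in> borel_measurable (lebesgue_on \<Omega>)" "weak_grad \<Omega> v \<in> borel_measurable (lebesgue_on \<Omega>)" for j
    using L(1,3)[of j] L(2,4) by (auto simp: Lp_space_def)
  have [measurable]: "\<phi>' \<in> borel_measurable borel" using c by (rule borel_measurable_continuous_onI)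
  have "continuous_on UNIV \<phi>"
    using d DERIV_isCont by (auto simp: continuous_on_eq_continuous_at)
  then have [measurable]: "\<phi> \<in> borel_measurable borel" by (rule borel_measurable_continuous_onI)
  note lip = lipschitz_from_derivative[OF d M]
  note chain = sobolev_space_chain[OF \<Omega> p _ d M c \<phi>0]
  have near: "(\<lambda>x. \<phi> (w j x)) \<in> vanishing_near p \<Omega> \<Gamma>" for j
  proof -
    obtain U where U: "open U" "\<Gamma> \<subseteq> U" "AE x in lebesgue_on \<Omega>. x \<in> U \<longrightarrow> w j x = 0"
      using w(1)[of j] by (auto simp: vanishing_near_def)
    have "AE x in lebesgue_on \<Omega>. x \<in> U \<longrightarrow> \<phi> (w j x) = 0"
      using U(3) by eventually_elim (simp add: \<phi>0)
    then show ?thesis using U chain(1)[OF wS[of j]] by (auto simp: vanishing_near_def)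
  qed
  have dL: "(\<lambda>x. w j x - v x) \<in> Lp_space p \<Omega>" "(\<lambda>x. weak_grad \<Omega> (w j) x - weak_grad \<Omega> v x) \<in> Lp_space p \<Omega>" for j
    using L p0 by (auto intro!: Lp_space_diff)
  have di: "integrable (lebesgue_on \<Omega>) (\<lambda>x. \<bar>w j x - v x\<bar> powr p)"
    "integrable (lebesgue_on \<Omega>) (\<lambda>x. norm (weak_grad \<Omega> (w j) x - weak_grad \<Omega> v x) powr p)" for j
    using dL[of j] by (auto simp: Lp_space_def)
  obtain r where r: "strict_mono r" "AE x in lebesgue_on \<Omega>. (\<lambda>j. w (r j) x - v x) \<longlonglongrightarrow> 0"
  proof -
    have "(\<lambda>j. LINT x|lebesgue_on \<Omega>. norm (w j x - v x)) \<longlonglongrightarrow> 0"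
      using w(2) by (intro L1_tendsto_0_from_Lp[OF \<Omega> p] dL) simp
    moreover have "integrable (lebesgue_on \<Omega>) (\<lambda>x. w j x - v x)" for j
      by (rule Lp_space_imp_integrable[OF \<Omega> p dL(1)])
    ultimately have "\<exists>r. strict_mono r \<and> (AE x in lebesgue_on \<Omega>. (\<lambda>j. w (r j) x - v x) \<longlonglongrightarrow> 0)"
      by (intro tendsto_L1_AE_subseq)
    then show ?thesis using that by blast
  qed
  have lim0: "(\<lambda>j. LINT x|lebesgue_on \<Omega>. \<bar>\<phi> (w (r j) x) - \<phi> (v x)\<bar> powr p) \<longlonglongrightarrow> 0"
  proof (rule Lim_null_comparison)
    show "(\<lambda>j. M powr p * (LINT x|lebesgue_on \<Omega>. \<bar>w (r j) x - v x\<bar> powr p)) \<longlonglongrightarrow> 0"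
      using tendsto_mult_left[OF LIMSEQ_subseq_LIMSEQ[OF w(2) r(1)], of "M powr p"] by (simp add: o_def)
    show "\<forall>\<^sub>F j in sequentially. norm (LINT x|lebesgue_on \<Omega>. \<bar>\<phi> (w (r j) x) - \<phi> (v x)\<bar> powr p) \<le>
        M powr p * (LINT x|lebesgue_on \<Omega>. \<bar>w (r j) x - v x\<bar> powr p)"
    proof (rule always_eventually, rule allI)
      fix j
      have pt: "\<bar>\<phi> (w (r j) x) - \<phi> (v x)\<bar> powr p \<le> M powr p * \<bar>w (r j) x - v x\<bar> powr p" for x
      proof -
        have "\<bar>\<phi> (w (r j) x) - \<phi> (v x)\<bar> powr p \<le> (M * \<bar>w (r j) x - v x\<bar>) powr p"
          using lip p0 by (intro powr_mono2) auto
        then show ?thesis using M0 by (simp add: powr_mult)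
      qed
      have "norm (LINT x|lebesgue_on \<Omega>. \<bar>\<phi> (w (r j) x) - \<phi> (v x)\<bar> powr p) =
          (LINT x|lebesgue_on \<Omega>. \<bar>\<phi> (w (r j) x) - \<phi> (v x)\<bar> powr p)"
        by (simp add: Bochner_Integration.integral_nonneg)
      also have "\<dots> \<le> (LINT x|lebesgue_on \<Omega>. M powr p * \<bar>w (r j) x - v x\<bar> powr p)"
      proof (rule integral_mono[OF _ _ pt])
        show 1: "integrable (lebesgue_on \<Omega>) (\<lambda>x. M powr p * \<bar>w (r j) x - v x\<bar> powr p)" using di(1) by simp
        show "integrable (lebesgue_on \<Omega>) (\<lambda>x. \<bar>\<phi> (w (r j) x) - \<phi> (v x)\<bar> powr p)"
          by (rule Bochner_Integration.integrable_bound[OF 1]) (use pt in \<open>auto intro!: AE_I2\<close>)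
      qed
      finally show "norm (LINT x|lebesgue_on \<Omega>. \<bar>\<phi> (w (r j) x) - \<phi> (v x)\<bar> powr p) \<le>
          M powr p * (LINT x|lebesgue_on \<Omega>. \<bar>w (r j) x - v x\<bar> powr p)" by simp
    qed
  qed
  let ?D = "\<lambda>j x. \<phi>' (w (r j) x) *\<^sub>R weak_grad \<Omega> (w (r j)) x - \<phi>' (v x) *\<^sub>R weak_grad \<Omega> v x"
  have limD: "(\<lambda>j. LINT x|lebesgue_on \<Omega>. norm (?D j x) powr p) \<longlonglongrightarrow> 0"
  proof (rule Lim_null_comparison)
    let ?a = "\<lambda>j. LINT x|lebesgue_on \<Omega>. norm (weak_grad \<Omega> (w (r j)) x - weak_grad \<Omega> v x) powr p"
    let ?b = "\<lambda>j x. \<bar>\<phi>' (w (r j) x) - \<phi>' (v x)\<bar> powr p * norm (weak_grad \<Omega> v x) powr p"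
    have vi: "integrable (lebesgue_on \<Omega>) (\<lambda>x. norm (weak_grad \<Omega> v x) powr p)" using L by (simp add: Lp_space_def)
    have bb: "?b j x \<le> (2 * M) powr p * norm (weak_grad \<Omega> v x) powr p" for j x
    proof -
      have "\<bar>\<phi>' (w (r j) x) - \<phi>' (v x)\<bar> \<le> 2 * M" using M[of "w (r j) x"] M[of "v x"] by linarith
      then show ?thesis using p0 by (intro mult_right_mono powr_mono2) auto
    qed
    have bi: "integrable (lebesgue_on \<Omega>) (?b j)" for j
      by (rule Bochner_Integration.integrable_bound[OF integrable_mult_right[OF vi, of "(2 * M) powr p"]]) (use bb in \<open>auto intro!: AE_I2\<close>)
    have blim: "(\<lambda>j. LINT x|lebesgue_on \<Omega>. ?b j x) \<longlonglongrightarrow> (LINT x|lebesgue_on \<Omega>. 0)"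
    proof (rule integral_dominated_convergence[where w="\<lambda>x. (2 * M) powr p * norm (weak_grad \<Omega> v x) powr p"])
      show "AE x in lebesgue_on \<Omega>. (\<lambda>j. ?b j x) \<longlonglongrightarrow> 0"
        using r(2)
      proof eventually_elim
        case (elim x)
        then have "(\<lambda>j. w (r j) x) \<longlonglongrightarrow> v x" by (simp add: LIM_zero_iff)
        moreover have "isCont \<phi>' (v x)" using c by (simp add: continuous_on_eq_continuous_at)
        ultimately have "(\<lambda>j. \<phi>' (w (r j) x)) \<longlonglongrightarrow> \<phi>' (v x)" by (rule isCont_tendsto_compose[rotated])
        then have "(\<lambda>j. \<bar>\<phi>' (w (r j) x) - \<phi>' (v x)\<bar>) \<longlonglongrightarrow> 0"
          by (simp add: LIM_zero tendsto_rabs_zero)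
        then have "(\<lambda>j. \<bar>\<phi>' (w (r j) x) - \<phi>' (v x)\<bar> powr p) \<longlonglongrightarrow> 0 powr p"
          using p0 by (intro tendsto_powr' tendsto_const) auto
        then have "(\<lambda>j. ?b j x) \<longlonglongrightarrow> 0 powr p * norm (weak_grad \<Omega> v x) powr p"
          by (rule tendsto_mult_right)
        then show ?case using p0 by simp
      qed
      show "AE x in lebesgue_on \<Omega>. norm (?b j x) \<le> (2 * M) powr p * norm (weak_grad \<Omega> v x) powr p" for j
        using bb by (intro AE_I2) simp
    qed (use vi in simp_all)
    have "(\<lambda>j. 2 powr p * (M powr p * ?a j + (LINT x|lebesgue_on \<Omega>. ?b j x))) \<longlonglongrightarrow> 2 powr p * (M powr p * 0 + 0)"
      using LIMSEQ_subseq_LIMSEQ[OF w(3) r(1)] blim by (intro tendsto_intros) (simp_all add: o_def)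
    then show "(\<lambda>j. 2 powr p * (M powr p * ?a j + (LINT x|lebesgue_on \<Omega>. ?b j x))) \<longlonglongrightarrow> 0" by simp
    show "\<forall>\<^sub>F j in sequentially. norm (LINT x|lebesgue_on \<Omega>. norm (?D j x) powr p) \<le>
        2 powr p * (M powr p * ?a j + (LINT x|lebesgue_on \<Omega>. ?b j x))"
    proof (rule always_eventually, rule allI)
      fix j
      let ?g = "\<lambda>x. 2 powr p * (M powr p * norm (weak_grad \<Omega> (w (r j)) x - weak_grad \<Omega> v x) powr p + ?b j x)"
      have pt: "norm (?D j x) powr p \<le> ?g x" for x
      proof -
        have "?D j x = \<phi>' (w (r j) x) *\<^sub>R (weak_grad \<Omega> (w (r j)) x - weak_grad \<Omega> v x) +
            (\<phi>' (w (r j) x) - \<phi>' (v x)) *\<^sub>R weak_grad \<Omega> v x"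
          by (simp add: algebra_simps)
        then have "norm (?D j x) \<le> \<bar>\<phi>' (w (r j) x)\<bar> * norm (weak_grad \<Omega> (w (r j)) x - weak_grad \<Omega> v x) +
            \<bar>\<phi>' (w (r j) x) - \<phi>' (v x)\<bar> * norm (weak_grad \<Omega> v x)"
          by (metis norm_scaleR norm_triangle_ineq)
        also have "\<dots> \<le> M * norm (weak_grad \<Omega> (w (r j)) x - weak_grad \<Omega> v x) +
            \<bar>\<phi>' (w (r j) x) - \<phi>' (v x)\<bar> * norm (weak_grad \<Omega> v x)"
          using M by (intro add_right_mono mult_right_mono) auto
        finally have "norm (?D j x) powr p \<le> (M * norm (weak_grad \<Omega> (w (r j)) x - weak_grad \<Omega> v x) +
            \<bar>\<phi>' (w (r j) x) - \<phi>' (v x)\<bar> * norm (weak_grad \<Omega> v x)) powr p"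
          using p0 by (intro powr_mono2) auto
        also have "\<dots> \<le> 2 powr p * ((M * norm (weak_grad \<Omega> (w (r j)) x - weak_grad \<Omega> v x)) powr p +
            (\<bar>\<phi>' (w (r j) x) - \<phi>' (v x)\<bar> * norm (weak_grad \<Omega> v x)) powr p)"
          using M0 p0 by (intro powr_add_bound) auto
        finally show ?thesis using M0 by (simp add: powr_mult)
      qed
      have gi: "integrable (lebesgue_on \<Omega>) ?g" using di(2)[of "r j"] bi[of j] by simp
      have "norm (LINT x|lebesgue_on \<Omega>. norm (?D j x) powr p) = (LINT x|lebesgue_on \<Omega>. norm (?D j x) powr p)"
        by (simp add: Bochner_Integration.integral_nonneg)
      also have "\<dots> \<le> (LINT x|lebesgue_on \<Omega>. ?g x)"
      proof (rule integral_mono[OF _ gi pt])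
        show "integrable (lebesgue_on \<Omega>) (\<lambda>x. norm (?D j x) powr p)"
        proof (rule Bochner_Integration.integrable_bound[OF gi])
          show "AE x in lebesgue_on \<Omega>. norm (norm (?D j x) powr p) \<le> norm (?g x)"
          proof (rule AE_I2)
            fix x
            show "norm (norm (?D j x) powr p) \<le> norm (?g x)"
              using pt[of x] powr_ge_zero[of "norm (?D j x)" p] unfolding real_norm_def by linarith
          qed
        qed measurable
      qed
      also have "\<dots> = 2 powr p * (M powr p * ?a j + (LINT x|lebesgue_on \<Omega>. ?b j x))"
        using di(2)[of "r j"] bi[of j] by simp
      finally show "norm (LINT x|lebesgue_on \<Omega>. norm (?D j x) powr p) \<le>
        2 powr p * (M powr p * ?a j + (LINT x|lebesgue_on \<Omega>. ?b j x))" .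
    qed
  qed
  have gradeq: "(LINT x|lebesgue_on \<Omega>. norm (weak_grad \<Omega> (\<lambda>x. \<phi> (w (r j) x) - \<phi> (v x)) x) powr p) =
      (LINT x|lebesgue_on \<Omega>. norm (?D j x) powr p)" for j
  proof (rule integral_cong_AE)
    have "weak_grad \<Omega> (\<lambda>x. \<phi> (w (r j) x) - \<phi> (v x)) \<in> Lp_space p \<Omega>"
      using sobolev_space_diff(1)[OF \<Omega> p chain(1)[OF wS[of "r j"]] chain(1)[OF vS]] by (simp add: sobolev_space_def)
    then show "(\<lambda>x. norm (weak_grad \<Omega> (\<lambda>x. \<phi> (w (r j) x) - \<phi> (v x)) x) powr p) \<in> borel_measurable (lebesgue_on \<Omega>)"
      by (auto simp: Lp_space_def)
    show "AE x in lebesgue_on \<Omega>. norm (weak_grad \<Omega> (\<lambda>x. \<phi> (w (r j) x) - \<phi> (v x)) x) powr p = norm (?D j x) powr p"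
      using sobolev_space_diff(2)[OF \<Omega> p chain(1)[OF wS[of "r j"]] chain(1)[OF vS]] chain(2)[OF wS[of "r j"]] chain(2)[OF vS]
      by eventually_elim simp
  qed measurable
  have "(\<lambda>j. sobolev_norm p \<Omega> (\<lambda>x. \<phi> (w (r j) x) - \<phi> (v x))) \<longlonglongrightarrow> 0"
    unfolding sobolev_norm_tendsto_0_iff[OF p0(2)] gradeq using lim0 limD by simp
  then show ?thesis
    unfolding sobolev_space_vanishing_def
    using chain(1)[OF vS] near by (auto intro!: exI[of _ "\<lambda>j x. \<phi> (w (r j) x)"])
qed

section \<open>The Finsler field\<close>

locale finsler_gauge =
  fixes H :: "'a::euclidean_space \<Rightarrow> real" and c1 :: real
  assumes dim: "DIM('a) \<ge> 2"
    and gauge: "gauge_function H" and C2: "Ck_on 2 (UNIV - {0}) H"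
    and c1_pos: "c1 > 0"
    and ellipticity: "\<And>\<xi>\<^sub>1 \<xi>\<^sub>2. \<xi>\<^sub>1 \<noteq> 0 \<Longrightarrow> \<xi>\<^sub>2 \<noteq> 0 \<Longrightarrow>
         (finsler_field H \<xi>\<^sub>1 - finsler_field H \<xi>\<^sub>2) \<bullet> (\<xi>\<^sub>1 - \<xi>\<^sub>2)
           \<ge> c1 * (norm \<xi>\<^sub>1 + norm \<xi>\<^sub>2) ^ (DIM('a) - 2) * (norm (\<xi>\<^sub>1 - \<xi>\<^sub>2))\<^sup>2"
begin

lemma gauge_scale: "t > 0 \<Longrightarrow> H (t *\<^sub>R \<xi>) = t * H \<xi>"
  using gauge by (simp add: gauge_function_def)

lemma gauge_0: "H 0 = 0"
  using gauge_scale[of 2 0] by simp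

lemma gauge_has_derivative:
  assumes "\<xi> \<noteq> 0"
  shows "(H has_derivative frechet_derivative H (at \<xi>)) (at \<xi>)"
proof -
  have "Ck_on (Suc (Suc 0)) (UNIV - {0}) H" using C2 by (simp add: numeral_2_eq_2 del: Ck_on.simps)
  then have "H differentiable (at \<xi>)" using assms by auto
  then show ?thesis by (simp add: frechet_derivative_works)
qed

lemma gauge_deriv_continuous: "continuous_on (UNIV - {0}) (\<lambda>\<xi>. frechet_derivative H (at \<xi>) v)"
proof -
  have "Ck_on (Suc (Suc 0)) (UNIV - {0}) H" using C2 by (simp add: numeral_2_eq_2 del: Ck_on.simps)
  then have "\<forall>\<xi>\<in>UNIV - {0}. (\<lambda>\<xi>. frechet_derivative H (at \<xi>) v) differentiable (at \<xi>)" by simp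
  then show ?thesis
    by (intro continuous_at_imp_continuous_on) (auto intro: differentiable_imp_continuous_within)
qed

lemma gauge_GDERIV:
  assumes "\<xi> \<noteq> 0"
  shows "GDERIV H \<xi> :> (\<Sum>b\<in>Basis. frechet_derivative H (at \<xi>) b *\<^sub>R b)"
proof -
  let ?D = "\<Sum>b\<in>Basis. frechet_derivative H (at \<xi>) b *\<^sub>R b"
  have lin: "linear (frechet_derivative H (at \<xi>))"
    using gauge_has_derivative[OF assms] has_derivative_linear by blast
  have "frechet_derivative H (at \<xi>) v = v \<bullet> ?D" for v
  proof -
    have "frechet_derivative H (at \<xi>) (\<Sum>b\<in>Basis. (v \<bullet> b) *\<^sub>R b) = (\<Sum>b\<in>Basis. (v \<bullet> b) * frechet_derivative H (at \<xi>) b)"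
      by (simp add: linear_sum[OF lin] linear_scale[OF lin])
    then show ?thesis by (simp add: euclidean_representation inner_sum_right mult.commute)
  qed
  then have "frechet_derivative H (at \<xi>) = (\<lambda>v. v \<bullet> ?D)" by blast
  then show ?thesis using gauge_has_derivative[OF assms] unfolding gderiv_def by simp
qed

lemma GDERIV_unique: "GDERIV f x :> D \<Longrightarrow> GDERIV f x :> E \<Longrightarrow> D = E"
  for D E :: 'a
proof -
  assume "GDERIV f x :> D" "GDERIV f x :> E"
  then have "(\<lambda>h. h \<bullet> D) = (\<lambda>h. h \<bullet> E)"
    unfolding gderiv_def by (rule has_derivative_unique)
  then show ?thesis by (metis vector_eq_ldot)
qed

lemma gradient_eqI: "GDERIV f x :> D \<Longrightarrow> gradient f x = D"
  for D :: 'a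
  unfolding gradient_def by (rule the_equality) (auto intro: GDERIV_unique)

lemma gauge_gradient: "\<xi> \<noteq> 0 \<Longrightarrow> gradient H \<xi> = (\<Sum>b\<in>Basis. frechet_derivative H (at \<xi>) b *\<^sub>R b)"
  by (rule gradient_eqI[OF gauge_GDERIV])

text \<open>Differentiating the identity t H(\<eta> / t) = H(\<eta>) at \<eta> = t \<xi> compares
  the gradients at \<xi> and t \<xi>.\<close>

lemma gradient_scale:
  assumes \<xi>: "\<xi> \<noteq> 0" and t: "t > 0"
  shows "gradient H (t *\<^sub>R \<xi>) = gradient H \<xi>"
proof -
  have G: "GDERIV H \<xi> :> gradient H \<xi>" using gauge_GDERIV[OF \<xi>] gauge_gradient[OF \<xi>] by simp
  have "((\<lambda>\<eta>. (1 / t) *\<^sub>R \<eta>) has_derivative (\<lambda>h. (1 / t) *\<^sub>R h)) (at (t *\<^sub>R \<xi>))"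
    by (auto intro!: derivative_eq_intros)
  moreover have "(H has_derivative (\<lambda>h. h \<bullet> gradient H \<xi>)) (at ((1 / t) *\<^sub>R (t *\<^sub>R \<xi>)))"
    using G t by (simp add: gderiv_def)
  ultimately have "((\<lambda>\<eta>. H ((1 / t) *\<^sub>R \<eta>)) has_derivative (\<lambda>h. ((1 / t) *\<^sub>R h) \<bullet> gradient H \<xi>)) (at (t *\<^sub>R \<xi>))"
    by (rule has_derivative_compose)
  then have "((\<lambda>\<eta>. t * H ((1 / t) *\<^sub>R \<eta>)) has_derivative (\<lambda>h. t * (((1 / t) *\<^sub>R h) \<bullet> gradient H \<xi>))) (at (t *\<^sub>R \<xi>))"
    by (rule has_derivative_mult_right)
  moreover have "t * H ((1 / t) *\<^sub>R \<eta>) = H \<eta>" for \<eta> using gauge_scale[of "1 / t" \<eta>] t by simp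
  moreover have "t * (((1 / t) *\<^sub>R h) \<bullet> gradient H \<xi>) = h \<bullet> gradient H \<xi>" for h using t by simp
  ultimately have "GDERIV H (t *\<^sub>R \<xi>) :> gradient H \<xi>" by (simp add: gderiv_def)
  then show ?thesis by (rule gradient_eqI)
qed

lemma field_0: "finsler_field H 0 = 0"
  using dim by (simp add: finsler_field_def gauge_0)

lemma field_scale:
  assumes "t > 0"
  shows "finsler_field H (t *\<^sub>R \<xi>) = t ^ (DIM('a) - 1) *\<^sub>R finsler_field H \<xi>"
  using assms gradient_scale[OF _ assms] field_0
  by (cases "\<xi> = 0") (auto simp: finsler_field_def gauge_scale power_mult_distrib)

lemma field_continuous: "continuous_on (UNIV - {0}) (finsler_field H)"
proof -
  have H: "continuous_on (UNIV - {0}) H"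
    by (intro continuous_at_imp_continuous_on ballI) (rule has_derivative_continuous[OF gauge_has_derivative], simp)
  have "continuous_on (UNIV - {0}) (\<lambda>\<xi>. \<Sum>b\<in>Basis. frechet_derivative H (at \<xi>) b *\<^sub>R b)"
    by (intro continuous_intros gauge_deriv_continuous)
  then have "continuous_on (UNIV - {0}) (gradient H)"
    by (rule continuous_on_eq) (simp add: gauge_gradient)
  then show ?thesis unfolding finsler_field_def[abs_def] using H by (intro continuous_intros)
qed

lemma field_borel [measurable]: "finsler_field H \<in> borel_measurable borel"
proof -
  have "(\<lambda>\<xi>. if \<xi> \<in> UNIV - {0} then finsler_field H \<xi> else 0) \<in> borel_measurable borel"
    by (rule borel_measurable_continuous_on_if) (auto simp: field_continuous)
  moreover have "(\<lambda>\<xi>. if \<xi> \<in> UNIV - {0} then finsler_field H \<xi> else 0) = finsler_field H"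
    by (auto simp: field_0)
  ultimately show ?thesis by simp
qed

text \<open>Homogeneity of degree N - 1 reduces the bound to the unit sphere, where the field is
  continuous.\<close>

lemma field_bound: "\<exists>C\<ge>0. \<forall>\<xi>. norm (finsler_field H \<xi>) \<le> C * norm \<xi> ^ (DIM('a) - 1)"
proof -
  have "continuous_on (sphere 0 1) (finsler_field H)"
    by (rule continuous_on_subset[OF field_continuous]) auto
  then have "bounded (finsler_field H ` sphere 0 1)"
    by (intro compact_imp_bounded compact_continuous_image) auto
  then obtain C where C: "\<forall>\<xi>\<in>sphere 0 1. norm (finsler_field H \<xi>) \<le> C" by (auto simp: bounded_iff)
  have "norm (finsler_field H \<xi>) \<le> max C 0 * norm \<xi> ^ (DIM('a) - 1)" for \<xi>
  proof (cases "\<xi> = 0")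
    case False
    have "\<xi> = norm \<xi> *\<^sub>R sgn \<xi>" using False by (simp add: sgn_div_norm)
    then have "finsler_field H \<xi> = norm \<xi> ^ (DIM('a) - 1) *\<^sub>R finsler_field H (sgn \<xi>)"
      using field_scale[of "norm \<xi>" "sgn \<xi>"] False by simp
    then have "norm (finsler_field H \<xi>) = norm (finsler_field H (sgn \<xi>)) * norm \<xi> ^ (DIM('a) - 1)"
      by simp
    also have "\<dots> \<le> max C 0 * norm \<xi> ^ (DIM('a) - 1)"
    proof -
      have "sgn \<xi> \<in> sphere 0 1" using False by (simp add: norm_sgn)
      then have "norm (finsler_field H (sgn \<xi>)) \<le> C" using C by blast
      then show ?thesis by (intro mult_right_mono) auto
    qed
    finally show ?thesis .
  qed (use dim in \<open>simp add: field_0\<close>)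
  then show ?thesis by (intro exI[of _ "max C 0"]) auto
qed

text \<open>The case \<open>\<xi>\<^sub>2 = 0\<close>, excluded in the ellipticity assumption, is the limit \<open>\<xi>\<^sub>2 = t \<xi> \<rightarrow> 0\<close>.\<close>

lemma field_coercive: "finsler_field H \<xi> \<bullet> \<xi> \<ge> c1 * norm \<xi> ^ DIM('a)"
proof (cases "\<xi> = 0")
  case False
  let ?n = "DIM('a)"
  let ?L = "\<lambda>t::real. (1 - t ^ (?n - 1)) * (1 - t) * (finsler_field H \<xi> \<bullet> \<xi>)"
  let ?R = "\<lambda>t::real. c1 * ((1 + t) * norm \<xi>) ^ (?n - 2) * ((1 - t) * norm \<xi>)\<^sup>2"
  have le: "?R t \<le> ?L t" if t: "0 < t" "t < 1" for t
  proof -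
    have e1: "\<xi> - t *\<^sub>R \<xi> = (1 - t) *\<^sub>R \<xi>" by (simp add: algebra_simps)
    have e2: "finsler_field H \<xi> - finsler_field H (t *\<^sub>R \<xi>) = (1 - t ^ (?n - 1)) *\<^sub>R finsler_field H \<xi>"
      unfolding field_scale[OF t(1)] by (simp add: algebra_simps)
    have e3: "norm \<xi> + norm (t *\<^sub>R \<xi>) = (1 + t) * norm \<xi>" using t by (simp add: algebra_simps)
    have e4: "norm ((1 - t) *\<^sub>R \<xi>) = (1 - t) * norm \<xi>" using t by simp
    have "(finsler_field H \<xi> - finsler_field H (t *\<^sub>R \<xi>)) \<bullet> (\<xi> - t *\<^sub>R \<xi>) \<ge>
        c1 * (norm \<xi> + norm (t *\<^sub>R \<xi>)) ^ (?n - 2) * (norm (\<xi> - t *\<^sub>R \<xi>))\<^sup>2"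
      using False t by (intro ellipticity) auto
    then show ?thesis
      unfolding e1 e2 e3 e4 inner_scaleR_left inner_scaleR_right by (simp only: mult.assoc mult.left_commute)
  qed
  have "(?L \<longlongrightarrow> ?L 0) (at_right 0)" "(?R \<longlongrightarrow> ?R 0) (at_right 0)"
    by (intro tendsto_intros)+
  moreover have "eventually (\<lambda>t. ?R t \<le> ?L t) (at_right 0)"
    using le by (auto simp: eventually_at_right[of 0 1] intro!: exI[of _ 1])
  ultimately have "?R 0 \<le> ?L 0"
    by (intro tendsto_le[of "at_right (0::real)" ?L "?L 0" ?R "?R 0"]) auto
  moreover have "norm \<xi> ^ ?n = norm \<xi> ^ (?n - 2) * (norm \<xi>)\<^sup>2"
    using dim by (metis le_add_diff_inverse2 power_add)
  \<comment> \<open>N \<ge> 2 makes this exponent positive, so that \<open>?L 0\<close> is the plain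
    product of the field with \<xi>.\<close>
  moreover have "(0::real) ^ (?n - Suc 0) = 0" using dim by (simp add: power_0_left)
  ultimately show ?thesis by (simp add: mult.assoc)
qed (use dim in \<open>simp add: field_0 power_0_left\<close>)

text \<open>By the triangle inequality the weight (|\<xi>| + |\<eta>|)^(N - 2) dominates |\<xi> -
  \<eta>|^(N - 2). What remains is a pure N-th power of the difference, that is, of the gradient of
  u - h in the application.\<close>

lemma field_monotone: "(finsler_field H \<xi> - finsler_field H \<eta>) \<bullet> (\<xi> - \<eta>) \<ge> c1 * norm (\<xi> - \<eta>) ^ DIM('a)"
proof -
  consider "\<eta> = 0" | "\<xi> = 0" | "\<xi> \<noteq> 0" "\<eta> \<noteq> 0" by blast
  then show ?thesis
  proof cases
    case 1
    then show ?thesis using field_coercive[of \<xi>] by (simp add: field_0)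
  next
    case 2
    then show ?thesis using field_coercive[of \<eta>] by (simp add: field_0)
  next
    case 3
    have "norm (\<xi> - \<eta>) ^ DIM('a) = norm (\<xi> - \<eta>) ^ (DIM('a) - 2) * (norm (\<xi> - \<eta>))\<^sup>2"
      using dim by (metis le_add_diff_inverse2 power_add)
    then have "c1 * norm (\<xi> - \<eta>) ^ DIM('a) = c1 * norm (\<xi> - \<eta>) ^ (DIM('a) - 2) * (norm (\<xi> - \<eta>))\<^sup>2" by simp
    also have "\<dots> \<le> c1 * (norm \<xi> + norm \<eta>) ^ (DIM('a) - 2) * (norm (\<xi> - \<eta>))\<^sup>2"
      using c1_pos by (intro mult_right_mono mult_left_mono power_mono norm_triangle_ineq4) auto
    also have "\<dots> \<le> (finsler_field H \<xi> - finsler_field H \<eta>) \<bullet> (\<xi> - \<eta>)"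
      using 3 by (rule ellipticity)
    finally show ?thesis .
  qed
qed

end

section \<open>The energy estimate\<close>

text \<open>Hoelder's inequality for g and 1 with respect to the measure with density k. It is
  integrated from Young's inequality with an optimal scaling, which degenerates when one of the
  integrals is 0; these cases are separated.\<close>

lemma weighted_holder:
  fixes k g :: "'a \<Rightarrow> real"
  assumes k: "integrable M k" "\<And>x. 0 \<le> k x" and g: "g \<in> borel_measurable M" "\<And>x. 0 \<le> g x"
    and X: "integrable M (\<lambda>x. k x * g x powr N)" and N: "N > 1"
  shows "integrable M (\<lambda>x. k x * g x)"
    and "(LINT x|M. k x * g x) \<le> (LINT x|M. k x * g x powr N) powr (1 / N) * (LINT x|M. k x) powr (1 - 1 / N)"
proof -
  have [measurable]: "k \<in> borel_measurable M" "g \<in> borel_measurable M" using k g by auto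
  show i: "integrable M (\<lambda>x. k x * g x)"
  proof (rule Bochner_Integration.integrable_bound)
    show "integrable M (\<lambda>x. k x + k x * g x powr N)" using k X by simp
    show "AE x in M. norm (k x * g x) \<le> norm (k x + k x * g x powr N)"
    proof (rule AE_I2)
      fix x
      have "k x * g x \<le> k x * (1 + g x powr N)"
        using k(2) g(2) N by (intro mult_left_mono norm_powr_one_bound) auto
      then show "norm (k x * g x) \<le> norm (k x + k x * g x powr N)"
        using k(2)[of x] g(2)[of x] by (simp add: algebra_simps)
    qed
  qed measurable
  define A where "A = (LINT x|M. k x * g x powr N)"
  define Y where "Y = (LINT x|M. k x)"
  have A0: "A \<ge> 0" unfolding A_def using k(2) by (intro Bochner_Integration.integral_nonneg) simp
  have Y0: "Y \<ge> 0" unfolding Y_def using k(2) by (intro Bochner_Integration.integral_nonneg) simp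
  consider "Y = 0" | "A = 0" | "A > 0" "Y > 0" using A0 Y0 by linarith
  then have "(LINT x|M. k x * g x) \<le> A powr (1 / N) * Y powr (1 - 1 / N)"
  proof cases
    case 1
    then have "AE x in M. k x = 0" unfolding Y_def using k by (subst (asm) integral_nonneg_eq_0_iff_AE) auto
    then have "AE x in M. k x * g x = 0" by eventually_elim simp
    then have "(LINT x|M. k x * g x) = 0" by (rule integral_eq_zero_AE)
    then show ?thesis by simp
  next
    case 2
    then have "AE x in M. k x * g x powr N = 0" unfolding A_def using k(2) X by (subst (asm) integral_nonneg_eq_0_iff_AE) auto
    then have "AE x in M. k x * g x = 0" by eventually_elim auto
    then have "(LINT x|M. k x * g x) = 0" by (rule integral_eq_zero_AE)
    then show ?thesis by simp
  next
    case 3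
    \<comment> \<open>This scaling balances Young's inequality: after integration the two terms
      contribute \<alpha> Y / N and \<alpha> Y (1 - 1 / N).\<close>
    define \<alpha> where "\<alpha> = (A / Y) powr (1 / N)"
    have \<alpha>: "\<alpha> > 0" "\<alpha> powr N = A / Y" using 3 N by (auto simp: \<alpha>_def powr_powr)
    have young: "g x \<le> \<alpha> * (g x powr N / (A / Y) / N + (1 - 1 / N))" for x
    proof -
      have "(g x / \<alpha>) * 1 \<le> (g x / \<alpha>) powr N / N + 1 powr (N / (N - 1)) / (N / (N - 1))"
        using N g(2)[of x] \<alpha> by (intro Youngs_inequality) (auto simp: field_simps)
      also have "(g x / \<alpha>) powr N = g x powr N / (A / Y)"
        using g(2)[of x] \<alpha> by (simp add: powr_divide)
      also have "1 powr (N / (N - 1)) / (N / (N - 1)) = 1 - 1 / N" using N by (simp add: field_simps)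
      finally show ?thesis using \<alpha>(1) by (simp add: divide_le_eq mult.commute)
    qed
    have "(LINT x|M. k x * g x) \<le> (LINT x|M. (\<alpha> / (A / Y) / N) * (k x * g x powr N) + (\<alpha> * (1 - 1 / N)) * k x)"
    proof (rule integral_mono[OF i])
      show "integrable M (\<lambda>x. (\<alpha> / (A / Y) / N) * (k x * g x powr N) + (\<alpha> * (1 - 1 / N)) * k x)" using k X by simp
      fix x
      have "k x * g x \<le> k x * (\<alpha> * (g x powr N / (A / Y) / N + (1 - 1 / N)))"
        by (rule mult_left_mono[OF young k(2)])
      also have "\<dots> = (\<alpha> / (A / Y) / N) * (k x * g x powr N) + (\<alpha> * (1 - 1 / N)) * k x"
        by (simp add: algebra_simps)
      finally show "k x * g x \<le> (\<alpha> / (A / Y) / N) * (k x * g x powr N) + (\<alpha> * (1 - 1 / N)) * k x" .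
    qed
    also have "\<dots> = (\<alpha> / (A / Y) / N) * A + (\<alpha> * (1 - 1 / N)) * Y"
      using k X by (simp add: A_def Y_def)
    also have "\<dots> = \<alpha> * Y" using 3 N by (simp add: field_simps)
    also have "\<dots> = A powr (1 / N) * (Y powr (- (1 / N)) * Y powr 1)"
    proof -
      have "\<alpha> = A powr (1 / N) / Y powr (1 / N)" unfolding \<alpha>_def using 3 by (simp add: powr_divide)
      then show ?thesis using 3 by (simp add: powr_minus divide_inverse)
    qed
    also have "\<dots> = A powr (1 / N) * Y powr (1 - 1 / N)"
      by (simp only: powr_add[symmetric]) simp
    finally show ?thesis .
  qed
  then show "(LINT x|M. k x * g x) \<le> (LINT x|M. k x * g x powr N) powr (1 / N) * (LINT x|M. k x) powr (1 - 1 / N)"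
    by (simp only: A_def Y_def)
qed

lemma norm_powr_nat: "n \<ge> 1 \<Longrightarrow> norm x powr real n = norm x ^ n"
  by (cases "norm x = 0") (auto simp: powr_realpow power_0_left)

locale finsler_domain = radial_domain \<Omega> P K lo hi + finsler_gauge H c1
  for \<Omega> :: "'a::euclidean_space set" and P K lo hi and H :: "'a \<Rightarrow> real" and c1 +
  fixes N q :: real
  assumes N_def: "N = real DIM('a)" and q_def: "q = N / (N - 1)"
    and embedding: "sobolev_constants \<Omega> \<noteq> {}"
begin

abbreviation M\<^sub>\<Omega> :: "'a measure" where "M\<^sub>\<Omega> \<equiv> lebesgue_on \<Omega>"
definition L :: real where "L = sobolev_constant \<Omega> * (radial_width \<Omega> P K lo hi + 1)"
definition \<mu> :: real where "\<mu> = (c1 powr (1 / N) / L) powr q"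

lemma N2: "N \<ge> 2" "N > 1" "N \<ge> 1" using dim by (auto simp: N_def)

lemma q1: "q > 1" "1 / q = 1 - 1 / N" "q / N = 1 / (N - 1)" "q = 1 + 1 / (N - 1)"
  using N2 by (auto simp: q_def field_simps)

text \<open>Dividing by the norm on the right gives one lower bound for all admissible constants,
  which their infimum inherits; if that norm is 0, any admissible constant yields the
  estimate.\<close>

lemma sobolev_inequality:
  assumes "g \<in> sobolev_space 1 \<Omega>"
  shows "g \<in> Lp_space q \<Omega>"
    and "Lp_norm q \<Omega> g \<le> sobolev_constant \<Omega> * (Lp_norm 1 \<Omega> (weak_grad \<Omega> g) + Lp_norm 1 \<Omega> g)"
proof -
  let ?c = "Lp_norm 1 \<Omega> (weak_grad \<Omega> g) + Lp_norm 1 \<Omega> g"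
  have *: "0 \<le> S \<and> g \<in> Lp_space q \<Omega> \<and> Lp_norm q \<Omega> g \<le> S * ?c" if "S \<in> sobolev_constants \<Omega>" for S
    using that assms unfolding sobolev_constants_def q_def N_def by (auto simp: Let_def)
  then show "g \<in> Lp_space q \<Omega>" using embedding by blast
  have c: "?c \<ge> 0" by (simp add: Lp_norm_def)
  show "Lp_norm q \<Omega> g \<le> sobolev_constant \<Omega> * ?c"
  proof (cases "?c = 0")
    case True
    then show ?thesis using * embedding by fastforce
  next
    case False
    then have "Lp_norm q \<Omega> g / ?c \<le> S" if "S \<in> sobolev_constants \<Omega>" for S
      using *[OF that] c by (simp add: divide_le_eq)
    then have "Lp_norm q \<Omega> g / ?c \<le> sobolev_constant \<Omega>"
      unfolding sobolev_constant_def using embedding by (intro cInf_greatest) auto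
    then show ?thesis using False c by (simp add: divide_le_eq)
  qed
qed

lemma measure_\<Omega>_pos: "measure lebesgue \<Omega> > 0"
proof -
  obtain x where "x \<in> \<Omega>" using nonempty_\<Omega> by blast
  then obtain e where e: "e > 0" "ball x e \<subseteq> \<Omega>" using open_\<Omega> open_contains_ball by blast
  have "0 < measure lebesgue (ball x e)" using content_ball_pos[OF e(1), of x] by simp
  also have "\<dots> \<le> measure lebesgue \<Omega>"
    using e(2) open_\<Omega> bounded_\<Omega> by (intro measure_mono_fmeasurable lmeasurable_open) auto
  finally show ?thesis .
qed

sublocale finite_measure M\<^sub>\<Omega>
  by (rule finite_measure_lebesgue_on[OF open_\<Omega> bounded_\<Omega>])

lemma measure_space_\<Omega>: "measure M\<^sub>\<Omega> (space M\<^sub>\<Omega>) = measure lebesgue \<Omega>"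
  using open_\<Omega> by (simp add: space_restrict_space measure_restrict_space)

text \<open>The constant function 1 has positive norm, which the constant 0 cannot bound. With
  S(\<Omega>) = 0 the division convention would turn \<open>\<mu>\<close> into 0.\<close>

lemma sobolev_constant_pos: "sobolev_constant \<Omega> > 0"
proof -
  have "sobolev_constant \<Omega> \<ge> 0"
    unfolding sobolev_constant_def using embedding by (intro cInf_greatest) (auto simp: sobolev_constants_def Let_def)
  moreover have "sobolev_constant \<Omega> \<noteq> 0"
  proof
    assume "sobolev_constant \<Omega> = 0"
    then have "Lp_norm q \<Omega> (\<lambda>x. 1::real) \<le> 0"
      using sobolev_inequality(2)[OF const_sobolev_space(1)[OF open_\<Omega> bounded_\<Omega>]] by simp
    moreover have "Lp_norm q \<Omega> (\<lambda>x. 1::real) > 0"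
      using measure_\<Omega>_pos by (simp add: Lp_norm_def measure_space_\<Omega>[simplified])
    ultimately show False by simp
  qed
  ultimately show ?thesis by simp
qed

lemma L_pos: "L > 0"
  unfolding L_def using sobolev_constant_pos width_nonneg by (intro mult_pos_pos) auto

lemma \<mu>_pos: "\<mu> > 0"
  unfolding \<mu>_def using L_pos c1_pos by simp

text \<open>The field grows with power N - 1, and a^(N - 1) b \<le> max(a, b)^N \<le> a^N +
  b^N.\<close>

lemma field_integrable:
  assumes G: "G \<in> Lp_space N \<Omega>" and Z: "Z \<in> Lp_space N \<Omega>"
  shows "integrable M\<^sub>\<Omega> (\<lambda>x. finsler_field H (G x) \<bullet> Z x)"
proof -
  let ?n = "DIM('a)"
  have n: "?n \<ge> 1" using dim by simp
  obtain C where C: "C \<ge> 0" "\<And>\<xi>. norm (finsler_field H \<xi>) \<le> C * norm \<xi> ^ (?n - 1)" using field_bound by blast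
  have [measurable]: "G \<in> borel_measurable M\<^sub>\<Omega>" "Z \<in> borel_measurable M\<^sub>\<Omega>" using G Z by (auto simp: Lp_space_def)
  show ?thesis
  proof (rule Bochner_Integration.integrable_bound)
    show "integrable M\<^sub>\<Omega> (\<lambda>x. C * (norm (G x) powr N + norm (Z x) powr N))"
      using G Z by (simp add: Lp_space_def)
    show "AE x in M\<^sub>\<Omega>. norm (finsler_field H (G x) \<bullet> Z x) \<le> norm (C * (norm (G x) powr N + norm (Z x) powr N))"
    proof (rule AE_I2)
      fix x
      let ?m = "max (norm (G x)) (norm (Z x))"
      have "\<bar>finsler_field H (G x) \<bullet> Z x\<bar> \<le> norm (finsler_field H (G x)) * norm (Z x)"
        by (rule Cauchy_Schwarz_ineq2)
      also have "\<dots> \<le> (C * norm (G x) ^ (?n - 1)) * norm (Z x)" by (intro mult_right_mono C) auto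
      also have "\<dots> \<le> (C * ?m ^ (?n - 1)) * ?m"
        using C(1) by (intro mult_mono mult_left_mono power_mono)
          (auto intro!: mult_nonneg_nonneg zero_le_power simp: le_max_iff_disj)
      also have "\<dots> = C * ?m ^ ?n" using n by (simp add: power_eq_if mult.assoc)
      also have "\<dots> \<le> C * (norm (G x) ^ ?n + norm (Z x) ^ ?n)"
        using C(1) by (intro mult_left_mono) (auto simp: max_def)
      finally show "norm (finsler_field H (G x) \<bullet> Z x) \<le> norm (C * (norm (G x) powr N + norm (Z x) powr N))"
        using C(1) unfolding N_def norm_powr_nat[OF n] by simp
    qed
  qed measurable
qed

text \<open>The factor 1 / \<mu> collects S(\<Omega>) (d + 1) to the power q, from the Sobolev and
  Poincare inequalities, and 1 / c1 to the power q / N, from the energy estimate. The weight k is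
  kept inside the integral so that it can later be compared with the indicator of a slab.\<close>

lemma key_inequality:
  assumes \<Gamma>: "back_contact_set \<Omega> P K lo \<subseteq> \<Gamma>"
    and f: "f \<in> Lp_space 1 \<Omega>" and u: "u \<in> sobolev_space N \<Omega>" and h: "h \<in> sobolev_space N \<Omega>"
    and weak_u: "weak_solution H \<Omega> \<Gamma> f u" and weak_h: "weak_solution H \<Omega> \<Gamma> (\<lambda>x. 0) h"
    and w: "(\<lambda>x. u x - h x) \<in> sobolev_space_vanishing N \<Omega> \<Gamma>"
    and d: "\<And>s. (\<phi> has_real_derivative k s) (at s)" and k: "\<And>s. 0 \<le> k s" "\<And>s. k s \<le> 1"
    and c: "continuous_on UNIV k" and \<phi>0: "\<phi> 0 = 0" and m: "\<And>s. \<bar>\<phi> s\<bar> \<le> m"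
  shows "(LINT x|M\<^sub>\<Omega>. \<bar>\<phi> (u x - h x)\<bar> powr q) \<le>
    (Lp_norm 1 \<Omega> f * m) powr (1 / (N - 1)) / \<mu> * (LINT x|M\<^sub>\<Omega>. k (u x - h x))"
proof -
  let ?n = "DIM('a)"
  note \<Omega> = open_\<Omega> bounded_\<Omega>
  have n: "?n \<ge> 1" using dim by simp
  have m0: "m \<ge> 0" using m[of 0] by linarith
  define F where "F = Lp_norm 1 \<Omega> f"
  have F: "F = (LINT x|M\<^sub>\<Omega>. \<bar>f x\<bar>)" unfolding F_def by (simp add: Lp_norm_1)
  have F0: "F \<ge> 0" unfolding F by (intro Bochner_Integration.integral_nonneg) simp
  define v where "v x = u x - h x" for x
  define z where "z x = \<phi> (v x)" for x
  have kM: "\<bar>k s\<bar> \<le> 1" for s using k[of s] by simp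
  have vV: "v \<in> sobolev_space_vanishing N \<Omega> \<Gamma>" using w by (simp add: v_def[abs_def])
  have vS: "v \<in> sobolev_space N \<Omega>" using vV by (simp add: sobolev_space_vanishing_def)
  have zV: "z \<in> sobolev_space_vanishing N \<Omega> \<Gamma>"
    unfolding z_def[abs_def] by (rule sobolev_vanishing_chain[OF \<Omega> N2(3) vV d kM c \<phi>0])
  have zS: "z \<in> sobolev_space N \<Omega>" using zV by (simp add: sobolev_space_vanishing_def)
  have z1: "z \<in> sobolev_space 1 \<Omega>" by (rule sobolev_space_mono_1[OF \<Omega> N2(3) zS])
  have gz: "AE x in M\<^sub>\<Omega>. weak_grad \<Omega> z x = k (v x) *\<^sub>R weak_grad \<Omega> v x"
    unfolding z_def[abs_def] by (rule sobolev_space_chain(2)[OF \<Omega> N2(3) vS d kM c \<phi>0])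
  have gv: "AE x in M\<^sub>\<Omega>. weak_grad \<Omega> v x = weak_grad \<Omega> u x - weak_grad \<Omega> h x"
    unfolding v_def[abs_def] by (rule sobolev_space_diff(2)[OF \<Omega> N2(3) u h])
  have Lp: "weak_grad \<Omega> u \<in> Lp_space N \<Omega>" "weak_grad \<Omega> h \<in> Lp_space N \<Omega>" "weak_grad \<Omega> v \<in> Lp_space N \<Omega>"
    "weak_grad \<Omega> z \<in> Lp_space N \<Omega>" "v \<in> Lp_space N \<Omega>" "z \<in> Lp_space N \<Omega>"
    using u h vS zS by (auto simp: sobolev_space_def)
  have [measurable]: "weak_grad \<Omega> v \<in> borel_measurable M\<^sub>\<Omega>" "weak_grad \<Omega> z \<in> borel_measurable M\<^sub>\<Omega>"
    "v \<in> borel_measurable M\<^sub>\<Omega>" "z \<in> borel_measurable M\<^sub>\<Omega>" "f \<in> borel_measurable M\<^sub>\<Omega>"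
    using Lp f by (auto simp: Lp_space_def)
  have [measurable]: "k \<in> borel_measurable borel" using c by (rule borel_measurable_continuous_onI)
  have fi: "integrable M\<^sub>\<Omega> f" using f by (simp add: Lp_space_1_iff)
  have fzi: "integrable M\<^sub>\<Omega> (\<lambda>x. f x * z x)"
  proof (rule integrable_mult_bounded[OF fi])
    show "z \<in> borel_measurable M\<^sub>\<Omega>" by measurable
    show "\<bar>z x\<bar> \<le> m" for x using m by (simp add: z_def)
  qed
  have bounded_z: "essentially_bounded \<Omega> z"
    unfolding essentially_bounded_def z_def using m by (intro exI[of _ m] AE_I2) simp
  have iu: "integrable M\<^sub>\<Omega> (\<lambda>x. finsler_field H (weak_grad \<Omega> u x) \<bullet> weak_grad \<Omega> z x)"
    and ih: "integrable M\<^sub>\<Omega> (\<lambda>x. finsler_field H (weak_grad \<Omega> h x) \<bullet> weak_grad \<Omega> z x)"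
    by (intro field_integrable Lp)+
  have "(LINT x|M\<^sub>\<Omega>. finsler_field H (weak_grad \<Omega> u x) \<bullet> weak_grad \<Omega> z x) = (LINT x|M\<^sub>\<Omega>. f x * z x)"
    using weak_u zV bounded_z unfolding weak_solution_def N_def by blast
  moreover have "(LINT x|M\<^sub>\<Omega>. finsler_field H (weak_grad \<Omega> h x) \<bullet> weak_grad \<Omega> z x) = (LINT x|M\<^sub>\<Omega>. 0 * z x)"
    using weak_h zV bounded_z unfolding weak_solution_def N_def by blast
  ultimately have weak: "(LINT x|M\<^sub>\<Omega>. (finsler_field H (weak_grad \<Omega> u x) - finsler_field H (weak_grad \<Omega> h x)) \<bullet> weak_grad \<Omega> z x) =
      (LINT x|M\<^sub>\<Omega>. f x * z x)"
    using iu ih by (simp add: inner_diff_left)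
  define X where "X = (LINT x|M\<^sub>\<Omega>. k (v x) * norm (weak_grad \<Omega> v x) powr N)"
  define Y where "Y = (LINT x|M\<^sub>\<Omega>. k (v x))"
  have gi: "integrable M\<^sub>\<Omega> (\<lambda>x. norm (weak_grad \<Omega> v x) powr N)" using Lp(3) by (simp add: Lp_space_def)
  have Xi: "integrable M\<^sub>\<Omega> (\<lambda>x. k (v x) * norm (weak_grad \<Omega> v x) powr N)"
    using integrable_mult_bounded[OF gi, of "\<lambda>x. k (v x)" 1] kM by (simp add: mult.commute)
  have Yi: "integrable M\<^sub>\<Omega> (\<lambda>x. k (v x))"
    using integrable_mult_bounded[of M\<^sub>\<Omega> "\<lambda>x. 1" "\<lambda>x. k (v x)" 1] kM by simp
  have X0: "X \<ge> 0" unfolding X_def using k(1) by (intro Bochner_Integration.integral_nonneg) simp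
  have Y0: "Y \<ge> 0" unfolding Y_def using k(1) by (intro Bochner_Integration.integral_nonneg) simp
  \<comment> \<open>The gradient of z is k(v) times that of u - h with k \<ge> 0, so the
    monotonicity of the field can be used pointwise.\<close>
  have "c1 * X = (LINT x|M\<^sub>\<Omega>. c1 * (k (v x) * norm (weak_grad \<Omega> v x) powr N))" by (simp add: X_def)
  also have "\<dots> \<le> (LINT x|M\<^sub>\<Omega>. (finsler_field H (weak_grad \<Omega> u x) - finsler_field H (weak_grad \<Omega> h x)) \<bullet> weak_grad \<Omega> z x)"
  proof (rule integral_mono_AE)
    show "integrable M\<^sub>\<Omega> (\<lambda>x. c1 * (k (v x) * norm (weak_grad \<Omega> v x) powr N))" using Xi by simp
    show "integrable M\<^sub>\<Omega> (\<lambda>x. (finsler_field H (weak_grad \<Omega> u x) - finsler_field H (weak_grad \<Omega> h x)) \<bullet> weak_grad \<Omega> z x)"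
      using iu ih by (simp add: inner_diff_left)
    show "AE x in M\<^sub>\<Omega>. c1 * (k (v x) * norm (weak_grad \<Omega> v x) powr N) \<le>
        (finsler_field H (weak_grad \<Omega> u x) - finsler_field H (weak_grad \<Omega> h x)) \<bullet> weak_grad \<Omega> z x"
      using gz gv
    proof eventually_elim
      case (elim x)
      have "k (v x) * (c1 * norm (weak_grad \<Omega> u x - weak_grad \<Omega> h x) ^ ?n) \<le>
          k (v x) * ((finsler_field H (weak_grad \<Omega> u x) - finsler_field H (weak_grad \<Omega> h x)) \<bullet> (weak_grad \<Omega> u x - weak_grad \<Omega> h x))"
        by (intro mult_left_mono field_monotone k)
      then show ?case
        unfolding elim N_def norm_powr_nat[OF n] inner_scaleR_right by (simp only: mult.left_commute)
    qed
  qed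
  also have "\<dots> = (LINT x|M\<^sub>\<Omega>. f x * z x)" by (rule weak)
  also have "\<dots> \<le> (LINT x|M\<^sub>\<Omega>. \<bar>f x\<bar> * m)"
  proof (rule integral_mono[OF fzi])
    show "integrable M\<^sub>\<Omega> (\<lambda>x. \<bar>f x\<bar> * m)" using fi by simp
    fix x
    have "f x * z x \<le> \<bar>f x\<bar> * \<bar>z x\<bar>" by (metis abs_ge_self abs_mult)
    also have "\<dots> \<le> \<bar>f x\<bar> * m" using m by (intro mult_left_mono) (auto simp: z_def)
    finally show "f x * z x \<le> \<bar>f x\<bar> * m" .
  qed
  also have "\<dots> = F * m" by (simp add: F)
  finally have X: "X \<le> F * m / c1" using c1_pos by (simp add: le_divide_eq mult.commute)
  have grad1: "Lp_norm 1 \<Omega> (weak_grad \<Omega> z) = (LINT x|M\<^sub>\<Omega>. k (v x) * norm (weak_grad \<Omega> v x))"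
    unfolding Lp_norm_1
  proof (rule integral_cong_AE)
    show "AE x in M\<^sub>\<Omega>. norm (weak_grad \<Omega> z x) = k (v x) * norm (weak_grad \<Omega> v x)"
      using gz by eventually_elim (simp add: k)
  qed measurable
  have "Lp_norm q \<Omega> z \<le> sobolev_constant \<Omega> * (Lp_norm 1 \<Omega> (weak_grad \<Omega> z) + Lp_norm 1 \<Omega> z)"
    by (rule sobolev_inequality(2)[OF z1])
  \<comment> \<open>The norm of z itself is absorbed by the radial Poincare inequality; this is the
    origin of the factor d + 1.\<close>
  also have "\<dots> \<le> sobolev_constant \<Omega> * (Lp_norm 1 \<Omega> (weak_grad \<Omega> z) + radial_width \<Omega> P K lo hi * Lp_norm 1 \<Omega> (weak_grad \<Omega> z))"
    using radial_poincare[OF N2(3) \<Gamma> zV] sobolev_constant_pos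
    by (intro mult_left_mono add_left_mono) (auto simp: Lp_norm_1)
  also have "\<dots> = L * (LINT x|M\<^sub>\<Omega>. k (v x) * norm (weak_grad \<Omega> v x))"
    unfolding grad1[symmetric] by (simp add: L_def algebra_simps)
  also have "\<dots> \<le> L * (X powr (1 / N) * Y powr (1 - 1 / N))"
    unfolding X_def Y_def using L_pos k N2 by (intro mult_left_mono weighted_holder(2) Yi Xi) auto
  also have "\<dots> \<le> L * ((F * m / c1) powr (1 / N) * Y powr (1 / q))"
    unfolding q1(2) using L_pos X X0 N2 by (intro mult_left_mono mult_right_mono powr_mono2) auto
  finally have le: "Lp_norm q \<Omega> z \<le> L * ((F * m / c1) powr (1 / N) * Y powr (1 / q))" .
  have Q0: "(LINT x|M\<^sub>\<Omega>. \<bar>z x\<bar> powr q) \<ge> 0" by (intro Bochner_Integration.integral_nonneg) simp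
  have "(LINT x|M\<^sub>\<Omega>. \<bar>z x\<bar> powr q) = Lp_norm q \<Omega> z powr q"
    using Q0 q1(1) by (simp add: Lp_norm_def powr_powr)
  also have "\<dots> \<le> (L * ((F * m / c1) powr (1 / N) * Y powr (1 / q))) powr q"
    using le q1(1) by (intro powr_mono2) (auto simp: Lp_norm_def)
  also have "\<dots> = L powr q * ((F * m / c1) powr (1 / N * q) * Y)"
    using L_pos Y0 q1(1) by (simp add: powr_mult powr_powr)
  also have "\<dots> = (F * m) powr (1 / (N - 1)) * (L powr q / c1 powr (1 / N * q)) * Y"
    using F0 m0 c1_pos q1(3) by (simp add: powr_divide)
  also have "L powr q / c1 powr (1 / N * q) = 1 / \<mu>"
    unfolding \<mu>_def using L_pos c1_pos by (simp add: powr_divide powr_powr)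
  finally show ?thesis by (simp add: z_def v_def F_def Y_def)
qed

end

section \<open>Decay of the level sets and exponential integrability\<close>

text \<open>The building block of the truncation: its derivative is continuous and piecewise
  linear.\<close>

lemma has_derivative_max_0_square:
  "((\<lambda>x::real. (max 0 x)\<^sup>2) has_real_derivative 2 * max 0 x) (at x)"
proof -
  consider "x > 0" | "x < 0" | "x = 0" by linarith
  then show ?thesis
  proof cases
    case 1
    have "((\<lambda>x::real. x\<^sup>2) has_real_derivative 2 * max 0 x) (at x)"
      using 1 by (auto intro!: derivative_eq_intros)
    then show ?thesis
      by (rule has_field_derivative_transform_within_open[where S="{0<..}"]) (use 1 in auto)
  next
    case 2
    have "((\<lambda>x::real. 0) has_real_derivative 2 * max 0 x) (at x)"
      using 2 by auto
    then show ?thesis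
      by (rule has_field_derivative_transform_within_open[where S="{..<0}"]) (use 2 in auto)
  next
    case 3
    have eq: "((max 0 (0 + h))\<^sup>2 - (max 0 0)\<^sup>2) / h = max 0 h" for h :: real
      by (cases "h > 0") (auto simp: max_def power2_eq_square)
    have "((\<lambda>h::real. max 0 h) \<longlongrightarrow> max 0 0) (at 0)" by (intro tendsto_intros)
    then show ?thesis unfolding 3 DERIV_def eq by simp
  qed
qed

text \<open>The sharp truncation has a discontinuous slope, while the chain rule asks for a
  continuous one, so the slope is ramped inside the slab. Its area on one side is \<delta> -
  \<epsilon>, which is therefore the height of \<phi>.\<close>

lemma smooth_truncation:
  fixes t \<delta> \<epsilon> :: real
  assumes t: "t \<ge> 0" and \<epsilon>: "0 < \<epsilon>" "\<epsilon> < \<delta>"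
  shows "\<exists>\<phi> k. (\<forall>s. (\<phi> has_real_derivative k s) (at s)) \<and> continuous_on UNIV k \<and>
    (\<forall>s. 0 \<le> k s) \<and> (\<forall>s. k s \<le> 1) \<and> \<phi> 0 = 0 \<and> (\<forall>s. \<bar>\<phi> s\<bar> \<le> \<delta> - \<epsilon>) \<and>
    (\<forall>s. t + \<delta> \<le> \<bar>s\<bar> \<longrightarrow> \<bar>\<phi> s\<bar> = \<delta> - \<epsilon>) \<and> (\<forall>s. k s \<noteq> 0 \<longrightarrow> t < \<bar>s\<bar> \<and> \<bar>s\<bar> < t + \<delta>)"
proof -
  (* A primitive of the trapezoid j, which climbs from 0 to 1 on [t, t + eps] and falls back to 0 on
     [t + delta - eps, t + delta]. *)
  define \<psi> where "\<psi> s = ((max 0 (s - t))\<^sup>2 - (max 0 (s - (t + \<epsilon>)))\<^sup>2 - (max 0 (s - (t + \<delta> - \<epsilon>)))\<^sup>2 + (max 0 (s - (t + \<delta>)))\<^sup>2) / (2 * \<epsilon>)" for s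
  define j where "j s = (max 0 (s - t) - max 0 (s - (t + \<epsilon>)) - max 0 (s - (t + \<delta> - \<epsilon>)) + max 0 (s - (t + \<delta>))) / \<epsilon>" for s
  have dsq: "((\<lambda>s. (max 0 (s - c))\<^sup>2) has_real_derivative 2 * max 0 (s - c)) (at s)" for s c :: real
  proof -
    have "((\<lambda>s. s - c) has_real_derivative 1) (at s)" by (auto intro!: derivative_eq_intros)
    from DERIV_chain2[OF has_derivative_max_0_square this] show ?thesis by simp
  qed
  have d\<psi>: "(\<psi> has_real_derivative j s) (at s)" for s
    unfolding \<psi>_def[abs_def] j_def
    by (rule DERIV_cong[OF DERIV_cdivide[OF DERIV_add[OF DERIV_diff[OF DERIV_diff[OF dsq dsq] dsq] dsq]]])
      (use \<epsilon> in \<open>simp add: field_simps\<close>)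
  have j01: "0 \<le> j s" "j s \<le> 1" for s
    using \<epsilon> unfolding j_def by (auto simp: divide_le_eq max_def)
  have j_supp: "t < s \<and> s < t + \<delta>" if "j s \<noteq> 0" for s
    using that \<epsilon> unfolding j_def by (auto simp: max_def split: if_splits)
  have \<psi>_left: "\<psi> s = 0" if "s \<le> t" for s
    using that \<epsilon> unfolding \<psi>_def by (auto simp: max_def)
  have \<psi>_right: "\<psi> s = \<delta> - \<epsilon>" if "s \<ge> t + \<delta>" for s
  proof -
    have "\<psi> s = ((s - t)\<^sup>2 - (s - (t + \<epsilon>))\<^sup>2 - (s - (t + \<delta> - \<epsilon>))\<^sup>2 + (s - (t + \<delta>))\<^sup>2) / (2 * \<epsilon>)"
      using that \<epsilon> unfolding \<psi>_def by (simp add: max_def)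
    also have "(s - t)\<^sup>2 - (s - (t + \<epsilon>))\<^sup>2 - (s - (t + \<delta> - \<epsilon>))\<^sup>2 + (s - (t + \<delta>))\<^sup>2 = (\<delta> - \<epsilon>) * (2 * \<epsilon>)"
      by (simp add: power2_eq_square algebra_simps)
    finally show ?thesis using \<epsilon> by simp
  qed
  have mono: "\<psi> a \<le> \<psi> b" if "a \<le> b" for a b
    using DERIV_nonneg_imp_nondecreasing[OF that] d\<psi> j01 by blast
  have \<psi>0: "0 \<le> \<psi> s" for s
    using mono[of "min s t" s] \<psi>_left[of "min s t"] by simp
  have \<psi>1: "\<psi> s \<le> \<delta> - \<epsilon>" for s
    using mono[of s "max s (t + \<delta>)"] \<psi>_right[of "max s (t + \<delta>)"] by simp
  \<comment> \<open>Odd reflection. As t \<ge> 0, the slopes of the two halves are never nonzero at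
    the same point, which keeps k \<le> 1.\<close>
  define \<phi> where "\<phi> s = \<psi> s - \<psi> (- s)" for s
  define k where "k s = j s + j (- s)" for s
  show ?thesis
  proof (rule exI[of _ \<phi>], rule exI[of _ k], intro conjI allI impI)
    show "(\<phi> has_real_derivative k s) (at s)" for s
    proof -
      have "((\<lambda>s. \<psi> (- s)) has_real_derivative j (- s) * (- 1)) (at s)"
        by (rule DERIV_chain2[OF d\<psi>]) (auto intro: derivative_eq_intros)
      then show ?thesis
        unfolding \<phi>_def[abs_def] k_def using DERIV_diff[OF d\<psi>[of s]] by fastforce
    qed
    have "continuous_on UNIV j" unfolding j_def[abs_def] using \<epsilon> by (intro continuous_intros) auto
    then show "continuous_on UNIV k"
      unfolding k_def[abs_def] by (intro continuous_intros continuous_on_compose2[of UNIV j UNIV uminus]) auto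
    show "0 \<le> k s" for s using j01 by (simp add: k_def)
    show "k s \<le> 1" for s
    proof (cases "s \<ge> 0")
      case True
      then have "j (- s) = 0" using j_supp[of "- s"] t by force
      then show ?thesis using j01 by (simp add: k_def)
    next
      case False
      then have "j s = 0" using j_supp[of s] t by force
      then show ?thesis using j01 by (simp add: k_def)
    qed
    show "\<phi> 0 = 0" by (simp add: \<phi>_def)
    show "\<bar>\<phi> s\<bar> \<le> \<delta> - \<epsilon>" for s
      using \<psi>0[of s] \<psi>0[of "- s"] \<psi>1[of s] \<psi>1[of "- s"] unfolding \<phi>_def by linarith
    show "\<bar>\<phi> s\<bar> = \<delta> - \<epsilon>" if "t + \<delta> \<le> \<bar>s\<bar>" for s
    proof (cases "s \<ge> 0")
      case True
      then show ?thesis using that t \<epsilon> \<psi>_right[of s] \<psi>_left[of "- s"] by (simp add: \<phi>_def)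
    next
      case False
      then show ?thesis using that t \<epsilon> \<psi>_right[of "- s"] \<psi>_left[of s] by (simp add: \<phi>_def)
    qed
    fix s assume "k s \<noteq> 0"
    then have "j s \<noteq> 0 \<or> j (- s) \<noteq> 0" by (auto simp: k_def)
    then show "t < \<bar>s\<bar>" "\<bar>s\<bar> < t + \<delta>" using j_supp[of s] j_supp[of "- s"] t by auto
  qed
qed

context finite_measure
begin

text \<open>The truncation has modulus m = \<delta> - \<epsilon> on the upper level set and positive
  slope only in the slab. Dividing both sides by m^p leaves a single factor m, which tends to
  \<delta> as \<epsilon> \<rightarrow> 0.\<close>

lemma level_set_difference:
  fixes w :: "'a \<Rightarrow> real" and F \<mu> p :: real
  assumes [measurable]: "w \<in> borel_measurable M" and F: "F \<ge> 0" and \<mu>: "\<mu> > 0"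
    and key: "\<And>\<phi> k m. (\<And>s. (\<phi> has_real_derivative k s) (at s)) \<Longrightarrow> continuous_on UNIV k \<Longrightarrow> (\<And>s. 0 \<le> k s) \<Longrightarrow>
      (\<And>s. k s \<le> 1) \<Longrightarrow> \<phi> 0 = 0 \<Longrightarrow> (\<And>s. \<bar>\<phi> s\<bar> \<le> m) \<Longrightarrow>
      (LINT x|M. \<bar>\<phi> (w x)\<bar> powr (1 + p)) \<le> (F * m) powr p / \<mu> * (LINT x|M. k (w x))"
    and p: "p > 0" and t: "t \<ge> 0" and \<delta>: "\<delta> > 0"
  defines "l \<equiv> \<lambda>t. measure M {x\<in>space M. t \<le> \<bar>w x\<bar>}"
  shows "\<delta> * l (t + \<delta>) \<le> F powr p / \<mu> * (l t - l (t + \<delta>))"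
proof (rule field_le_epsilon)
  have eps: "(\<delta> - \<epsilon>) * l (t + \<delta>) \<le> F powr p / \<mu> * (l t - l (t + \<delta>))" if \<epsilon>: "0 < \<epsilon>" "\<epsilon> < \<delta>" for \<epsilon>
  proof -
    obtain \<phi> k where \<phi>: "\<And>s. (\<phi> has_real_derivative k s) (at s)" "continuous_on UNIV k"
      "\<And>s. 0 \<le> k s" "\<And>s. k s \<le> 1" "\<phi> 0 = 0" "\<And>s. \<bar>\<phi> s\<bar> \<le> \<delta> - \<epsilon>"
      "\<And>s. t + \<delta> \<le> \<bar>s\<bar> \<Longrightarrow> \<bar>\<phi> s\<bar> = \<delta> - \<epsilon>" "\<And>s. k s \<noteq> 0 \<Longrightarrow> t < \<bar>s\<bar> \<and> \<bar>s\<bar> < t + \<delta>"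
      using smooth_truncation[OF t \<epsilon>] by blast
    define m where "m = \<delta> - \<epsilon>"
    have m: "m > 0" using \<epsilon> by (simp add: m_def)
    have [measurable]: "k \<in> borel_measurable borel" using \<phi>(2) by (rule borel_measurable_continuous_onI)
    have "continuous_on UNIV \<phi>"
      using \<phi>(1) DERIV_isCont by (auto simp: continuous_on_eq_continuous_at)
    then have [measurable]: "\<phi> \<in> borel_measurable borel" by (rule borel_measurable_continuous_onI)
    let ?A = "{x\<in>space M. t + \<delta> \<le> \<bar>w x\<bar>}" and ?B = "{x\<in>space M. t < \<bar>w x\<bar> \<and> \<bar>w x\<bar> < t + \<delta>}"
    have "m powr (1 + p) * l (t + \<delta>) = (LINT x|M. m powr (1 + p) * indicator ?A x)"
      by (simp add: l_def)
    also have "\<dots> \<le> (LINT x|M. \<bar>\<phi> (w x)\<bar> powr (1 + p))"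
    proof (rule integral_mono)
      show "integrable M (\<lambda>x. \<bar>\<phi> (w x)\<bar> powr (1 + p))"
        using \<phi>(6) p by (intro integrable_const_bound[of _ "m powr (1 + p)"] AE_I2) (auto simp: m_def intro!: powr_mono2)
      show "m powr (1 + p) * indicator ?A x \<le> \<bar>\<phi> (w x)\<bar> powr (1 + p)" for x
        using \<phi>(7)[of "w x"] by (auto simp: indicator_def m_def)
    qed (simp add: emeasure_eq_measure)
    also have "\<dots> \<le> (F * m) powr p / \<mu> * (LINT x|M. k (w x))"
      unfolding m_def by (rule key[OF \<phi>(1-6)])
    also have "\<dots> \<le> (F * m) powr p / \<mu> * (LINT x|M. indicator ?B x)"
    proof (rule mult_left_mono[OF integral_mono])
      show "integrable M (\<lambda>x. k (w x))"
        using \<phi>(3,4) by (intro integrable_const_bound[of _ 1] AE_I2) auto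
      show "k (w x) \<le> indicator ?B x" if "x \<in> space M" for x
        using \<phi>(4)[of "w x"] \<phi>(8)[of "w x"] that by (cases "k (w x) = 0") auto
      show "integrable M (\<lambda>x. indicator ?B x :: real)"
        by (simp add: emeasure_eq_measure)
    qed (use \<mu> in simp)
    also have "(LINT x|M. indicator ?B x) = measure M ?B" by simp
    also have "measure M ?B \<le> l t - l (t + \<delta>)"
    proof -
      have "measure M ?B + measure M ?A = measure M (?B \<union> ?A)"
        by (rule finite_measure_Union[symmetric]) auto
      also have "\<dots> \<le> l t" unfolding l_def using \<delta> by (intro finite_measure_mono) auto
      finally show ?thesis by (simp add: l_def)
    qed
    finally have "m powr (1 + p) * l (t + \<delta>) \<le> (F * m) powr p / \<mu> * (l t - l (t + \<delta>))"
      using \<mu> by (simp add: mult_left_mono divide_right_mono)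
    then have "m powr p * (m * l (t + \<delta>)) \<le> m powr p * (F powr p / \<mu> * (l t - l (t + \<delta>)))"
      using m F by (simp add: powr_add powr_mult mult_ac)
    then have "m * l (t + \<delta>) \<le> F powr p / \<mu> * (l t - l (t + \<delta>))"
      using m by (subst (asm) mult_le_cancel_left_pos) auto
    then show ?thesis by (simp only: m_def)
  qed
  fix e :: real assume e: "e > 0"
  have l0: "l (t + \<delta>) \<ge> 0" by (simp add: l_def)
  \<comment> \<open>So small that replacing \<delta> by \<delta> - \<epsilon> costs at most e; the
    added 1 covers a level set of measure 0.\<close>
  define \<epsilon> where "\<epsilon> = min (\<delta> / 2) (e / (l (t + \<delta>) + 1))"
  have \<epsilon>: "0 < \<epsilon>" "\<epsilon> < \<delta>" using \<delta> e l0 by (auto simp: \<epsilon>_def)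
  have "\<epsilon> * l (t + \<delta>) \<le> e / (l (t + \<delta>) + 1) * (l (t + \<delta>) + 1)"
    using l0 e by (intro mult_mono) (auto simp: \<epsilon>_def)
  also have "\<dots> = e" using l0 by simp
  finally show "\<delta> * l (t + \<delta>) \<le> F powr p / \<mu> * (l t - l (t + \<delta>)) + e"
    using eps[OF \<epsilon>] by (simp add: algebra_simps)
qed

text \<open>With b A \<le> 1 the difference inequality becomes (1 + b \<delta>) l(t + \<delta>)
  \<le> l(t). Then n steps of length t / n bound (1 + b t / n)^n l(t) by the total mass, and n
  \<rightarrow> \<infinity> gives the exponential. Assuming b A \<le> 1 instead of b = 1 / A
  includes A = 0, where every rate is allowed.\<close>

lemma level_set_decay:
  fixes w :: "'a \<Rightarrow> real" and A b :: real
  defines "l \<equiv> \<lambda>t. measure M {x\<in>space M. t \<le> \<bar>w x\<bar>}"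
  assumes [measurable]: "w \<in> borel_measurable M" and b: "b \<ge> 0" "b * A \<le> 1"
    and diff: "\<And>t \<delta>. t \<ge> 0 \<Longrightarrow> \<delta> > 0 \<Longrightarrow> \<delta> * l (t + \<delta>) \<le> A * (l t - l (t + \<delta>))"
    and t: "t \<ge> 0"
  shows "l t \<le> measure M (space M) * exp (- b * t)"
proof (cases "t = 0")
  case True
  then show ?thesis unfolding l_def by (auto intro!: finite_measure_mono)
next
  case False
  let ?V = "measure M (space M)"
  have step: "(1 + b * \<delta>) * l (t + \<delta>) \<le> l t" if "t \<ge> 0" "\<delta> > 0" for t \<delta>
  proof -
    have mono: "l (t + \<delta>) \<le> l t" unfolding l_def using that by (intro finite_measure_mono) auto
    have "b * (\<delta> * l (t + \<delta>)) \<le> b * (A * (l t - l (t + \<delta>)))"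
      by (rule mult_left_mono[OF diff[OF that] b(1)])
    also have "\<dots> = (b * A) * (l t - l (t + \<delta>))" by simp
    also have "\<dots> \<le> 1 * (l t - l (t + \<delta>))" using mono by (intro mult_right_mono b) auto
    finally show ?thesis by (simp add: algebra_simps)
  qed
  have iter: "(1 + b * \<delta>) ^ n * l (real n * \<delta>) \<le> ?V" if \<delta>: "\<delta> > 0" for n \<delta>
  proof (induction n)
    case 0
    then show ?case unfolding l_def by (auto intro!: finite_measure_mono)
  next
    case (Suc n)
    have "(1 + b * \<delta>) ^ Suc n * l (real (Suc n) * \<delta>) = (1 + b * \<delta>) ^ n * ((1 + b * \<delta>) * l (real n * \<delta> + \<delta>))"
      by (simp add: algebra_simps)
    also have "\<dots> \<le> (1 + b * \<delta>) ^ n * l (real n * \<delta>)"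
      using b \<delta> by (intro mult_left_mono step) auto
    finally show ?case using Suc by simp
  qed
  have "(\<lambda>n. (1 + (b * t) / real n) ^ n) \<longlonglongrightarrow> exp (b * t)"
    by (rule tendsto_exp_limit_sequentially)
  then have lim: "(\<lambda>n. (1 + (b * t) / real n) ^ n * l t) \<longlonglongrightarrow> exp (b * t) * l t"
    by (rule tendsto_mult_right)
  have "exp (b * t) * l t \<le> ?V"
  proof (rule LIMSEQ_le_const2[OF lim], intro exI[of _ 1] allI impI)
    fix n :: nat assume n: "n \<ge> 1"
    then have "t / real n > 0" "real n * (t / real n) = t" using t False by auto
    then show "(1 + (b * t) / real n) ^ n * l t \<le> ?V" using iter[of "t / real n" n] by simp
  qed
  then show ?thesis by (simp add: exp_minus field_simps)
qed

text \<open>The exponential e^(s |w|) is 1 plus the integral of s e^(s t) over 0 \<le> t \<le> |w|.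
  After exchanging the integrals, the decay leaves V s / (b - s) with V the total mass, and 1 + s /
  (b - s) = b / (b - s). The computation uses nonnegative integrals because integrability is part of
  the claim.\<close>

lemma exponential_integrability:
  fixes w :: "'a \<Rightarrow> real" and b s :: real
  assumes w [measurable]: "w \<in> borel_measurable M" and s: "0 < s" "s < b"
    and decay: "\<And>t. t \<ge> 0 \<Longrightarrow> measure M {x\<in>space M. t \<le> \<bar>w x\<bar>} \<le> measure M (space M) * exp (- b * t)"
  shows "integrable M (\<lambda>x. exp (s * \<bar>w x\<bar>))"
    and "(LINT x|M. exp (s * \<bar>w x\<bar>)) \<le> measure M (space M) * (b / (b - s))"
proof -
  interpret pair_sigma_finite M lborel ..
  let ?V = "measure M (space M)"
  have layer: "ennreal (exp (s * \<bar>w x\<bar>)) = 1 + (\<integral>\<^sup>+t. ennreal (s * exp (s * t)) * indicator {t. 0 \<le> t \<and> t \<le> \<bar>w x\<bar>} t \<partial>lborel)" for x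
  proof -
    have "(\<integral>\<^sup>+t. ennreal (s * exp (s * t)) * indicator {t. 0 \<le> t \<and> t \<le> \<bar>w x\<bar>} t \<partial>lborel) = ennreal (exp (s * \<bar>w x\<bar>) - exp (s * 0))"
    proof -
      have se: "{t. 0 \<le> t \<and> t \<le> \<bar>w x\<bar>} = {0..\<bar>w x\<bar>}" by auto
      show ?thesis
        unfolding se using s by (intro nn_integral_FTC_Icc) (auto intro!: derivative_eq_intros)
    qed
    moreover have "exp (s * \<bar>w x\<bar>) \<ge> 1" using s by simp
    ultimately show ?thesis by (simp flip: ennreal_1 ennreal_plus)
  qed
  have "(\<integral>\<^sup>+x. ennreal (exp (s * \<bar>w x\<bar>)) \<partial>M) =
      (\<integral>\<^sup>+x. 1 \<partial>M) + (\<integral>\<^sup>+x. \<integral>\<^sup>+t. ennreal (s * exp (s * t)) * indicator {t. 0 \<le> t \<and> t \<le> \<bar>w x\<bar>} t \<partial>lborel \<partial>M)"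
    unfolding layer by (rule nn_integral_add) measurable
  also have "(\<integral>\<^sup>+x. \<integral>\<^sup>+t. ennreal (s * exp (s * t)) * indicator {t. 0 \<le> t \<and> t \<le> \<bar>w x\<bar>} t \<partial>lborel \<partial>M) =
      (\<integral>\<^sup>+t. \<integral>\<^sup>+x. ennreal (s * exp (s * t)) * indicator {t. 0 \<le> t \<and> t \<le> \<bar>w x\<bar>} t \<partial>M \<partial>lborel)"
    by (rule Fubini'[symmetric]) measurable
  also have "\<dots> \<le> (\<integral>\<^sup>+t. ennreal (?V * s * exp (- ((b - s) * t))) * indicator {0..} t \<partial>lborel)"
  proof (rule nn_integral_mono)
    fix t :: real
    show "(\<integral>\<^sup>+x. ennreal (s * exp (s * t)) * indicator {t. 0 \<le> t \<and> t \<le> \<bar>w x\<bar>} t \<partial>M) \<le>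
        ennreal (?V * s * exp (- ((b - s) * t))) * indicator {0..} t"
    proof (cases "t \<ge> 0")
      case True
      have "(\<integral>\<^sup>+x. ennreal (s * exp (s * t)) * indicator {t. 0 \<le> t \<and> t \<le> \<bar>w x\<bar>} t \<partial>M) =
          (\<integral>\<^sup>+x. ennreal (s * exp (s * t)) * indicator {x\<in>space M. t \<le> \<bar>w x\<bar>} x \<partial>M)"
        using True by (intro nn_integral_cong) (auto simp: indicator_def)
      also have "\<dots> = ennreal (s * exp (s * t)) * ennreal (measure M {x\<in>space M. t \<le> \<bar>w x\<bar>})"
        by (subst nn_integral_cmult_indicator) (auto simp: emeasure_eq_measure)
      also have "\<dots> \<le> ennreal (s * exp (s * t)) * ennreal (?V * exp (- b * t))"
        by (intro mult_left_mono ennreal_leI decay True) simp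
      also have "\<dots> = ennreal (?V * s * (exp (s * t) * exp (- b * t)))"
        using s by (simp add: mult_ac flip: ennreal_mult)
      also have "exp (s * t) * exp (- b * t) = exp (- ((b - s) * t))"
        by (simp add: algebra_simps flip: exp_add)
      finally show ?thesis using True by simp
    qed (auto simp: indicator_def)
  qed
  also have "\<dots> = ennreal (0 - (- (?V * s / (b - s)) * exp (- ((b - s) * 0))))"
  proof (rule nn_integral_FTC_atLeast)
    show "((\<lambda>t. - (?V * s / (b - s)) * exp (- ((b - s) * t))) has_real_derivative ?V * s * exp (- ((b - s) * t))) (at t)" for t
    proof -
      have "((\<lambda>t. exp (- ((b - s) * t))) has_real_derivative exp (- ((b - s) * t)) * (- (b - s))) (at t)"
        by (auto intro!: derivative_eq_intros)
      moreover have "- (c / (b - s)) * (y * (- (b - s))) = c * y" for c y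
      proof -
        have "- (c / d) * (y * (- d)) = c * y" if "d \<noteq> 0" for d using that by simp
        then show ?thesis using s by (metis diff_gt_0_iff_gt less_irrefl)
      qed
      ultimately show ?thesis by (metis DERIV_cmult)
    qed
    have "filterlim (\<lambda>t. (b - s) * t) at_top at_top"
      using s by (intro filterlim_tendsto_pos_mult_at_top[OF tendsto_const _ filterlim_ident]) auto
    then have "filterlim (\<lambda>t. - ((b - s) * t)) at_bot at_top"
      by (simp add: filterlim_uminus_at_bot)
    then have "((\<lambda>t. exp (- ((b - s) * t))) \<longlongrightarrow> 0) at_top"
      by (rule filterlim_compose[OF exp_at_bot])
    then have "((\<lambda>t. - (?V * s / (b - s)) * exp (- ((b - s) * t))) \<longlongrightarrow> - (?V * s / (b - s)) * 0) at_top"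
      by (rule tendsto_mult_left)
    then show "((\<lambda>t. - (?V * s / (b - s)) * exp (- ((b - s) * t))) \<longlongrightarrow> 0) at_top" by simp
  qed (use s in auto)
  also have "(\<integral>\<^sup>+x. 1 \<partial>M) = ennreal ?V" by (simp add: emeasure_eq_measure)
  finally have "(\<integral>\<^sup>+x. ennreal (exp (s * \<bar>w x\<bar>)) \<partial>M) \<le> ennreal ?V + ennreal (?V * s / (b - s))"
    by (simp add: add_left_mono)
  also have "\<dots> = ennreal (?V + ?V * s / (b - s))"
    using s by (simp flip: ennreal_plus)
  also have "?V + ?V * s / (b - s) = ?V * (b / (b - s))"
    using s by (simp add: field_simps)
  finally have le: "(\<integral>\<^sup>+x. ennreal (exp (s * \<bar>w x\<bar>)) \<partial>M) \<le> ennreal (?V * (b / (b - s)))" .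
  show i: "integrable M (\<lambda>x. exp (s * \<bar>w x\<bar>))"
    by (rule integrableI_bounded) (use le in \<open>auto intro: le_less_trans\<close>)
  have "ennreal (LINT x|M. exp (s * \<bar>w x\<bar>)) \<le> ennreal (?V * (b / (b - s)))"
    using le nn_integral_eq_integral[OF i] by simp
  then show "(LINT x|M. exp (s * \<bar>w x\<bar>)) \<le> ?V * (b / (b - s))"
    using s by (subst (asm) ennreal_le_iff) (auto intro!: mult_nonneg_nonneg)
qed

end

section \<open>Exponential integrability of the difference of two solutions\<close>

context finsler_domain
begin

text \<open>If f has norm 0, every s > 0 is meant to be admissible, but 0 to a negative power is 0
  by convention and would exclude all of them; hence the separate disjunct in
  \<open>small\<close>.\<close>

theorem brezis_merle:
  assumes \<Gamma>: "back_contact_set \<Omega> P K lo \<subseteq> \<Gamma>"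
    and f: "f \<in> Lp_space 1 \<Omega>" and u: "u \<in> sobolev_space N \<Omega>" and h: "h \<in> sobolev_space N \<Omega>"
    and weak: "weak_solution H \<Omega> \<Gamma> f u" "weak_solution H \<Omega> \<Gamma> (\<lambda>x. 0) h"
    and w: "(\<lambda>x. u x - h x) \<in> sobolev_space_vanishing N \<Omega> \<Gamma>"
    and s: "s > 0" and small: "Lp_norm 1 \<Omega> f = 0 \<or> s < \<mu> * Lp_norm 1 \<Omega> f powr (- 1 / (N - 1))"
  shows "integrable M\<^sub>\<Omega> (\<lambda>x. exp (s * \<bar>u x - h x\<bar>))"
    and "(LINT x|M\<^sub>\<Omega>. exp (s * \<bar>u x - h x\<bar>)) \<le>
      measure lebesgue \<Omega> / (1 - s * inverse \<mu> * Lp_norm 1 \<Omega> f powr (1 / (N - 1)))"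
proof -
  define F where "F = Lp_norm 1 \<Omega> f"
  define p where "p = 1 / (N - 1)"
  define A where "A = F powr p / \<mu>"
  define v where "v x = u x - h x" for x
  let ?V = "measure M\<^sub>\<Omega> (space M\<^sub>\<Omega>)"
  have p: "p > 0" "q = 1 + p" using N2 q1(4) by (auto simp: p_def)
  have F0: "F \<ge> 0" by (simp add: F_def Lp_norm_def)
  have A0: "A \<ge> 0" unfolding A_def using \<mu>_pos by simp
  \<comment> \<open>The smallness of s says that it lies below the decay rate 1 / A of the level
    sets.\<close>
  have sA: "s * A < 1"
  proof (cases "F = 0")
    case False
    then have "s < \<mu> * F powr (- p)" using small by (simp add: F_def p_def)
    then have "s * (F powr p / \<mu>) < (\<mu> * F powr (- p)) * (F powr p / \<mu>)"
      using False F0 \<mu>_pos by (intro mult_strict_right_mono) auto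
    also have "\<dots> = 1" using False F0 \<mu>_pos by (simp add: powr_minus)
    finally show ?thesis by (simp add: A_def)
  qed (use p in \<open>simp add: A_def\<close>)
  have vm: "v \<in> borel_measurable M\<^sub>\<Omega>"
    using w by (simp add: v_def[abs_def] sobolev_space_vanishing_def sobolev_space_def Lp_space_def)
  have key: "(LINT x|M\<^sub>\<Omega>. \<bar>\<phi> (v x)\<bar> powr (1 + p)) \<le> (F * m) powr p / \<mu> * (LINT x|M\<^sub>\<Omega>. k (v x))"
    if "\<And>s. (\<phi> has_real_derivative k s) (at s)" "continuous_on UNIV k" "\<And>s. 0 \<le> k s"
      "\<And>s. k s \<le> 1" "\<phi> 0 = 0" "\<And>s. \<bar>\<phi> s\<bar> \<le> m" for \<phi> k m
    using key_inequality[OF \<Gamma> f u h weak w that(1,3,4,2,5,6)] unfolding p(2)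
    by (simp only: v_def p_def F_def)
  note diff = level_set_difference[OF vm F0 \<mu>_pos key p(1), folded A_def]
  have bound: "integrable M\<^sub>\<Omega> (\<lambda>x. exp (s * \<bar>v x\<bar>))" "(LINT x|M\<^sub>\<Omega>. exp (s * \<bar>v x\<bar>)) \<le> ?V * (b / (b - s))"
    if b: "s < b" "b * A \<le> 1" for b
  proof -
    have b0: "b \<ge> 0" using b s by simp
    note decay = level_set_decay[OF vm b0 b(2) diff]
    show "integrable M\<^sub>\<Omega> (\<lambda>x. exp (s * \<bar>v x\<bar>))" "(LINT x|M\<^sub>\<Omega>. exp (s * \<bar>v x\<bar>)) \<le> ?V * (b / (b - s))"
      using exponential_integrability[OF vm s b(1) decay] by auto
  qed
  have "integrable M\<^sub>\<Omega> (\<lambda>x. exp (s * \<bar>v x\<bar>)) \<and> (LINT x|M\<^sub>\<Omega>. exp (s * \<bar>v x\<bar>)) \<le> ?V / (1 - s * A)"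
  proof (cases "A = 0")
    case True
    let ?I = "LINT x|M\<^sub>\<Omega>. exp (s * \<bar>v x\<bar>)"
    have "?I \<le> ?V"
    proof (rule ccontr)
      assume "\<not> ?I \<le> ?V"
      then have gt: "?I - ?V > 0" by simp
      \<comment> \<open>All rates are available when A = 0. Exceeding I s / (I - V) means I (b - s)
        > V b, which contradicts the bound at rate b; this replaces the limit of b to
        infinity.\<close>
      define b where "b = max (s + 1) (?I * s / (?I - ?V) + 1)"
      have b: "s < b" "b * A \<le> 1" using True by (auto simp: b_def)
      have "?I * s / (?I - ?V) < b" by (auto simp: b_def)
      then have "?I * s < b * (?I - ?V)" using gt by (simp add: divide_less_eq)
      moreover have "?I * (b - s) \<le> ?V * b" using bound(2)[OF b] b(1) by (simp add: le_divide_eq)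
      ultimately show False by (simp add: algebra_simps)
    qed
    then show ?thesis using bound(1)[of "s + 1"] True by simp
  next
    case False
    then have A: "A > 0" using A0 by simp
    \<comment> \<open>The best admissible rate is b = 1 / A, for which b / (b - s) = 1 / (1 - s
      A).\<close>
    have b: "s < 1 / A" "1 / A * A \<le> 1" using sA A by (auto simp: less_divide_eq)
    have "(1 / A) / (1 / A - s) = 1 / (1 - s * A)" using A by (simp add: field_simps)
    then show ?thesis using bound[OF b] by simp
  qed
  then show "integrable M\<^sub>\<Omega> (\<lambda>x. exp (s * \<bar>u x - h x\<bar>))"
    "(LINT x|M\<^sub>\<Omega>. exp (s * \<bar>u x - h x\<bar>)) \<le>
      measure lebesgue \<Omega> / (1 - s * inverse \<mu> * Lp_norm 1 \<Omega> f powr (1 / (N - 1)))"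
    unfolding measure_space_\<Omega> by (auto simp: v_def A_def F_def p_def divide_inverse mult_ac)
qed

end

text \<open>\<open>\<mu>\<close> is fixed before \<Gamma>, f, u and h, so it is the same for all of
  them. The condition u = h on \<Gamma> appears as membership of u - h in
  \<open>sobolev_space_vanishing\<close>.\<close>

theorem lemmaA5:
  fixes \<Omega> :: "(real ^ 'n) set"
    and P :: "real ^ 'n"
    and K :: "real ^ 'n \<Rightarrow> nat"
    and lo hi :: "real ^ 'n \<Rightarrow> nat \<Rightarrow> real"
    and H :: "real ^ 'n \<Rightarrow> real"
    and c1 :: real
  assumes dim: "CARD('n) \<ge> 2"
    and domain: "open \<Omega>" "connected \<Omega>" "\<Omega> \<noteq> {}" "bounded \<Omega>"
    and embedding: "sobolev_constants \<Omega> \<noteq> {}"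
    and radial: "radial_property \<Omega> P K lo hi"
    and H: "gauge_function H" "Ck_on 2 (UNIV - {0}) H" "uniformly_elliptic H"
    and c1: "c1 > 0"
      "\<And>\<xi>\<^sub>1 \<xi>\<^sub>2. \<xi>\<^sub>1 \<noteq> 0 \<Longrightarrow> \<xi>\<^sub>2 \<noteq> 0 \<Longrightarrow>
         (finsler_field H \<xi>\<^sub>1 - finsler_field H \<xi>\<^sub>2) \<bullet> (\<xi>\<^sub>1 - \<xi>\<^sub>2)
           \<ge> c1 * (norm \<xi>\<^sub>1 + norm \<xi>\<^sub>2) ^ (CARD('n) - 2) * (norm (\<xi>\<^sub>1 - \<xi>\<^sub>2))\<^sup>2"
  shows "let N = real CARD('n) in \<exists>\<mu>>0.
    \<mu> = (c1 powr (1 / N) / (sobolev_constant \<Omega> * (radial_width \<Omega> P K lo hi + 1))) powr (N / (N - 1)) \<and>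
    (\<forall>\<Gamma> f u h.
       back_contact_set \<Omega> P K lo \<subseteq> \<Gamma> \<and> \<Gamma> \<subseteq> frontier \<Omega> \<and>
       f \<in> Lp_space 1 \<Omega> \<and> u \<in> sobolev_space N \<Omega> \<and> h \<in> sobolev_space N \<Omega> \<and>
       weak_solution H \<Omega> \<Gamma> f u \<and> weak_solution H \<Omega> \<Gamma> (\<lambda>x. 0) h \<and>
       (\<lambda>x. u x - h x) \<in> sobolev_space_vanishing N \<Omega> \<Gamma> \<longrightarrow>
       (\<forall>s>0. Lp_norm 1 \<Omega> f = 0 \<or> s < \<mu> * Lp_norm 1 \<Omega> f powr (- 1 / (N - 1)) \<longrightarrow>
          integrable (lebesgue_on \<Omega>) (\<lambda>x. exp (s * \<bar>u x - h x\<bar>)) \<and>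
          (LINT x|lebesgue_on \<Omega>. exp (s * \<bar>u x - h x\<bar>))
            \<le> measure lebesgue \<Omega> / (1 - s * inverse \<mu> * Lp_norm 1 \<Omega> f powr (1 / (N - 1)))))"
proof -
  define N where N_card: "N = real CARD('n)"
  define q where q_card: "q = N / (N - 1)"
  interpret finsler_domain \<Omega> P K lo hi H c1 N q
    by unfold_locales (use assms in \<open>auto simp: N_card q_card\<close>)
  show ?thesis
    unfolding Let_def N_card[symmetric]
  proof (intro exI[of _ \<mu>] conjI allI impI)
    show "\<mu> > 0" by (rule \<mu>_pos)
    show "\<mu> = (c1 powr (1 / N) / (sobolev_constant \<Omega> * (radial_width \<Omega> P K lo hi + 1))) powr (N / (N - 1))"
      by (simp only: \<mu>_def L_def q_card[symmetric])
  qed (use brezis_merle in blast)+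
qed

end
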